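(* Consider the finite-horizon linear-quadratic game with horizon $T\in\mathbb{N}$ and $N$ decision makers described in the context, and let $F_t^i$, $G_{t,k}^i$, $H_t^i$, $\mathcal{D}_t,\mathcal{G}^p_{t,k},\mathcal{H}^p_t,\mathcal{A}_t,\mathcal{G}^X_{t,k},\mathcal{H}^X_t,\mathcal{C}_t$ be the matrices defined there from the problem data. Assume: (1) $X_0,W_0,W_1,\dots,\xi_0,\xi_1,\dots$ are mutually independent and have finite second-order moments, where $X_t=(x_t^i)_{i\in[0,N]}$ and $W_t=(w_t^i)_{i\in[0,N]}$. (2) For each $k\in[0,T)$ and arbitrary vector $\hat X_{k|k-1}$, the system of linear equations in the unknowns $(\hat y_{t|k-1})_{t\in[k,T)}$, $(\hat X_{t+1|k-1})_{t\in[k,T)}$, $$\hat{y}_{t|k-1} = \mathcal{D}_t \hat{X}_{t|k-1} + \sum_{n\in[t,T)} \mathcal{G}_{t,n}^p \hat{y}_{n|k-1} + \mathcal{H}_t^p + E[\xi_t],$$ $$\hat{X}_{t+1|k-1} = \mathcal{A}_t \hat{X}_{t|k-1} + \sum_{n\in[t,T)} \mathcal{G}_{t,n}^X \hat{y}_{n|k-1} + \mathcal{H}_t^X + \mathcal{C}_t \hat{y}_{t|k-1} + E[W_t],\qquad t\in[k,T),$$ has a unique solution. (Such a solution is necessarily of the form $\hat y_{t|k-1}=a_{t,k-1}\hat X_{k|k-1}+b_{t,k-1}$, $t\in[k,T)$, with $a_{t,k-1},b_{t,k-1}$ not depending on $\hat X_{k|k-1}$.) Let $(\bar y_t)_{t\in[0,T)}$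 be the random sequence generated by $\bar X_0=X_0$ and, for $t\in[0,T)$, $$\bar{y}_t = \mathcal{D}_t \bar{X}_t + \sum_{n\in[t,T)} \mathcal{G}_{t,n}^{p} (a_{n,t-1} E[\bar{X}_t|\bar{Y}_{t-1}] + b_{n,t-1}) + \mathcal{H}_t^p +\xi_t,$$ $$\bar{X}_{t+1} = \mathcal{A}_t \bar{X}_t + \sum_{n\in[t,T)} \mathcal{G}_{t,n}^{X} (a_{n,t-1} E[\bar{X}_t|\bar{Y}_{t-1}] + b_{n,t-1}) + \mathcal{H}_t^X+ \mathcal{C}_t \bar{y}_t + W_t,$$ where $\bar Y_{t-1}=(\bar y_k)_{k\in[0,t)}$, and let $\hat{\bar X}_{t|t-1}(\cdot)$ denote the state estimator, i.e. the measurable map taking $\bar Y_{t-1}$ to $E[\bar X_t|\bar Y_{t-1}]$ for this recursion. Then there exists an SEBEU (subjective equilibrium under beliefs of exogenous uncertainty) in pure strategies $s\in\mathbb{S}$, defined by $$s_t^i(I_t^i,Y_{t-1}) =F_t^i x_t^i +G_{t}^i\, \hat{\bar{X}}_{t|t-1}(Y_{t-1}) + \check{H}_t^i, \qquad i\in[1,N],\ t\in[0,T),$$ where $G_t^i := \sum_{k\in[t,T)} G_{t,k}^i a_{k,t-1}$ and $\check{H}_t^i := \sum_{k\in[t,T)} G_{t,k}^i b_{k,t-1} + H_t^i$.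
   Context: Notation. $[1,N]=\{1,\dots,N\}$, $[0,N]=\{0,\dots,N\}$, $[0,T)=\{0,\dots,T-1\}$, $[k,T)=\{k,\dots,T-1\}$, $[0,t]=\{0,\dots,t\}$; $|x|_Q^2=x'Qx$; $'$ is transpose; $A\succ0$ means positive definite; $\mathcal{P}(\cdot)$ is the set of Borel probability measures. All vectors are columns. Game. There are $N\in\mathbb{N}$ decision makers DM$^1,\dots,$DM$^N$ and a horizon $T\in\mathbb{N}$. DM$^i$ has state $x_t^i\in\mathbb{R}^{n_x^i}$, control $u_t^i\in\mathbb{U}^i=\mathbb{R}^{n_u^i}$, disturbance $w_t^i\in\mathbb{R}^{n_x^i}$; environment variables are $y_t\in\mathbb{Y}=\mathbb{R}^{n_y}$, with $\xi_t\in\mathbb{R}^{n_y}$; the environment dynamics has state $x_t^0$ and disturbance $w_t^0$ in $\mathbb{R}^{n_x^0}$. For $t\in[0,T)$, $$x_{t+1}^i=A_t^ix_t^i+B_t^iu_t^i+C_t^iy_t+w_t^i,\quad i\in[1,N],$$ $$x_{t+1}^0=A_t^0x_t^0+\sum_{i\in[1,N]}(B_t^{1,i}u_t^i+B_t^{2,i}x_t^i)+w_t^0,\qquad y_t=D_tx_t^0+\sum_{i\in[1,N]}(E_t^{1,i}u_t^i+E_t^{2,i}x_t^i)+\xi_t,$$ with possibly random initial states $x_0^i$, $i\in[0,N]$, and given matrices of appropriate dimensions. DM$^i$ has stage cost $$c_t^i(x^i,u^i,y)=|x^i|^2_{Q_t^i}+|u^i|^2_{R_t^i}+2y'(K_t^iu^i+L_t^ix^i),\quad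 Q_t^i\succ0,\ R_t^i\succ0,$$ terminal cost $c_T^i(x^i)=|x^i|^2_{Q_T^i}$ with $Q_T^i\succ0$, and discount factor $\beta^i\in[0,1]$. Strategies. At time $t$ DM$^i$ has access to $(I_t^i,Y_{t-1})$, where $I_t^i=((x_k^i)_{k\in[0,t]},(u_k^i)_{k\in[0,t)})$ and $Y_{t-1}=(y_k)_{k\in[0,t)}$. A pure strategy $s^i=(s_t^i)_{t\in[0,T)}$ of DM$^i$ is a collection of measurable maps giving $u_t^i=s_t^i(I_t^i,Y_{t-1})$; $\mathbb{S}^i$ is the set of these, $\mathbb{S}=\mathbb{S}^1\times\cdots\times\mathbb{S}^N$. Subjective cost. For $s^i\in\mathbb{S}^i$ and a deterministic sequence $\bar Z_{T-1}=(\bar z_t)_{t\in[0,T)}\in\mathbb{Y}^{[0,T)}$, $$J^i(s^i,\bar Z_{T-1})=E\Big[\sum_{t\in[0,T)}(\beta^i)^tc_t^i(x_t^i,u_t^i,\bar z_t)+(\beta^i)^Tc_T^i(x_T^i)\Big],$$ where $x_{t+1}^i=A_t^ix_t^i+B_t^iu_t^i+C_t^i\bar z_t+w_t^i$ and $u_t^i=s_t^i(I_t^i,\bar Z_{t-1})$, $\bar Z_{t-1}=(\bar z_k)_{k\in[0,t)}$. For $\zeta\in\mathcal{P}(\mathbb{Y}^{[0,T)})$, $E^{\zeta}[J^i(s^i,\cdot)]$ is the expectation of $J^i(s^i,\cdot)$ when the sequence has law $\zeta$ (i.e. the environment variables are an exogenous sequence with law $\zeta$, independent of all other primitive random variables).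 SEBEU. A joint strategy $s=(s^1,\dots,s^N)\in\mathbb{S}$ is a subjective equilibrium under beliefs of exogenous uncertainty (SEBEU) in pure strategies if there exist beliefs $\zeta^1,\dots,\zeta^N\in\mathcal{P}(\mathbb{Y}^{[0,T)})$ with (i) $E^{\zeta^i}[J^i(s^i,\cdot)]\le E^{\zeta^i}[J^i(\tilde s^i,\cdot)]$ for all $i\in[1,N]$, $\tilde s^i\in\mathbb{S}^i$; and (ii) $\zeta^i=\zeta_s$ for all $i\in[1,N]$, where $\zeta_s$ is the law of $(y_t)_{t\in[0,T)}$ generated endogenously by the game dynamics when all DMs use $s$. Optimal-response matrices. For each $i$ (superscript $i$ omitted on the right-hand sides), let $M_T=Q_T$ and, backward for $k\in[0,T)$, $$S_k=R_k+\beta B_k'M_{k+1}B_k,\qquad M_k=Q_k+\beta A_k'(M_{k+1}-\beta M_{k+1}B_kS_k^{-1}B_k'M_{k+1})A_k,$$ $$F_k^i=-\beta S_k^{-1}B_k'M_{k+1}A_k,\qquad G_{k,k}^i=-S_k^{-1}(K_k'+\beta B_k'M_{k+1}C_k),$$ $$\Phi_{k,k}=I,\qquad \Phi_{k,t}=\prod_{n\in[k+1,t]}\beta(A_n+B_nF_n)'\ \ (\text{factors ordered left to right by increasing } n),\ t\in[k+1,T),$$ $$G_{k,t}^i=-\beta S_k^{-1}B_k'\big(\Phi_{k,t}M_{t+1}C_t+\Phi_{k,t-1}(F_t'K_t'+L_t')\big),\ t\in[k+1,T),$$ $$H_k^i=-\beta S_k^{-1}B_k'\sum_{t\in[k,T)}\Phi_{k,t}M_{t+1}E[w_t].$$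 Aggregate matrices (with respect to $X_t=(x_t^0,x_t^1,\dots,x_t^N)$ stacked as a column): $\mathcal{D}_t=[D_t,\ E_t^{1,1}F_t^1+E_t^{2,1},\dots,E_t^{1,N}F_t^N+E_t^{2,N}]$; $\mathcal{G}^p_{t,k}=\sum_jE_t^{1,j}G_{t,k}^j$; $\mathcal{H}^p_t=\sum_jE_t^{1,j}H_t^j$; $\mathcal{A}_t$ has first block row $[A_t^0,\ B_t^{1,1}F_t^1+B_t^{2,1},\dots,B_t^{1,N}F_t^N+B_t^{2,N}]$ and, for $j\in[1,N]$, the block row of $x^j$ has only nonzero block $A_t^j+B_t^jF_t^j$ in the column of $x^j$; $\mathcal{G}^X_{t,k}$ is the column stack of $\sum_jB_t^{1,j}G_{t,k}^j,\ B_t^1G_{t,k}^1,\dots,B_t^NG_{t,k}^N$; $\mathcal{H}^X_t$ is the column stack of $\sum_jB_t^{1,j}H_t^j,\ B_t^1H_t^1,\dots,B_t^NH_t^N$; $\mathcal{C}_t$ is the column stack of $0,C_t^1,\dots,C_t^N$. (Sums over $j\in[1,N]$.) *)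

theory Defs
  imports "HOL-Probability.Probability" "Jordan_Normal_Form.Gauss_Jordan_Elimination"
begin

hide_type (open) Finite_Cartesian_Product.vec
no_notation Finite_Cartesian_Product.vec_nth (infixl \<open>$\<close> 90)
no_notation inner (infix \<open>\<bullet>\<close> 70)

section \<open>Vectors and matrices of run-time dimension\<close>

definition vec_sum :: "nat \<Rightarrow> ('k \<Rightarrow> real vec) \<Rightarrow> 'k set \<Rightarrow> real vec" where
  "vec_sum n f S = vec n (\<lambda>r. \<Sum>k\<in>S. f k $ r)"

definition mat_sum :: "nat \<Rightarrow> nat \<Rightarrow> ('k \<Rightarrow> real mat) \<Rightarrow> 'k set \<Rightarrow> real mat" where
  "mat_sum nr nc f S = mat nr nc (\<lambda>rc. \<Sum>k\<in>S. f k $$ rc)"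

text \<open>Concatenation of the blocks with indices \<open>0, \<dots>, n - 1\<close>; \<open>nr\<close> and \<open>nc\<close> are
  the common numbers of rows and of columns.\<close>

primrec stack_vec :: "nat \<Rightarrow> (nat \<Rightarrow> real vec) \<Rightarrow> real vec" where
  "stack_vec 0 v = 0\<^sub>v 0"
| "stack_vec (Suc n) v = stack_vec n v @\<^sub>v v n"

primrec stack_rows :: "nat \<Rightarrow> nat \<Rightarrow> (nat \<Rightarrow> real mat) \<Rightarrow> real mat" where
  "stack_rows nc 0 A = 0\<^sub>m 0 nc"
| "stack_rows nc (Suc n) A = stack_rows nc n A @\<^sub>r A n"

primrec stack_cols :: "nat \<Rightarrow> nat \<Rightarrow> (nat \<Rightarrow> real mat) \<Rightarrow> real mat" where
  "stack_cols nr 0 A = 0\<^sub>m nr 0"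
| "stack_cols nr (Suc n) A =
     four_block_mat (stack_cols nr n A) (A n) (0\<^sub>m 0 (dim_col (stack_cols nr n A))) (0\<^sub>m 0 (dim_col (A n)))"

definition pos_definite :: "nat \<Rightarrow> real mat \<Rightarrow> bool" where
  "pos_definite n Q \<longleftrightarrow> Q \<in> carrier_mat n n \<and> transpose_mat Q = Q \<and>
     (\<forall>v\<in>carrier_vec n. v \<noteq> 0\<^sub>v n \<longrightarrow> 0 < v \<bullet> (Q *\<^sub>v v))"

definition quad :: "real mat \<Rightarrow> real vec \<Rightarrow> real" where
  "quad Q x = x \<bullet> (Q *\<^sub>v x)"

text \<open>The value is meaningful for invertible matrices only; the matrices \<open>S\<^sub>k\<close> below are positive
  definite.\<close>

definition mat_inv :: "real mat \<Rightarrow> real mat" where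
  "mat_inv S = the (mat_inverse S)"

section \<open>Measurability and expectations of vectors\<close>

text \<open>\<open>\<real>\<^sup>n\<close> with its Borel sets, carried over from the product space of \<open>n\<close> copies of the real
  line.\<close>

definition borel_vec :: "nat \<Rightarrow> real vec measure" where
  "borel_vec n = vimage_algebra (carrier_vec n) (\<lambda>v. \<lambda>r\<in>{..<n}. v $ r) (\<Pi>\<^sub>M r\<in>{..<n}. borel)"

definition vec_expectation :: "'w measure \<Rightarrow> nat \<Rightarrow> ('w \<Rightarrow> real vec) \<Rightarrow> real vec" where
  "vec_expectation M n X = vec n (\<lambda>r. \<integral>\<omega>. X \<omega> $ r \<partial>M)"

definition vec_cond_exp ::
  "'w measure \<Rightarrow> 'w measure \<Rightarrow> nat \<Rightarrow> ('w \<Rightarrow> real vec) \<Rightarrow> 'w \<Rightarrow> real vec" where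
  "vec_cond_exp M F n X \<omega> = vec n (\<lambda>r. real_cond_exp M F (\<lambda>\<omega>'. X \<omega>' $ r) \<omega>)"

definition finite_second_moment :: "'w measure \<Rightarrow> nat \<Rightarrow> ('w \<Rightarrow> real vec) \<Rightarrow> bool" where
  "finite_second_moment M n X \<longleftrightarrow> (\<forall>r<n. integrable M (\<lambda>\<omega>. (X \<omega> $ r)\<^sup>2))"

text \<open>Expectation of an extended real function as positive part minus negative part
  (\<open>e2ennreal\<close> truncates at \<open>0\<close>). The Bochner integral would assign the value \<open>0\<close> to a cost with
  infinite expectation. In the undefined case \<open>\<infinity> - \<infinity>\<close> the value is \<open>\<infinity>\<close>; for the costs below that
  case does not arise under a belief with finite second moments, because the stage costs are
  bounded from below by a multiple of \<open>- |y|\<^sup>2\<close>.\<close>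

definition ext_expectation :: "'a measure \<Rightarrow> ('a \<Rightarrow> ereal) \<Rightarrow> ereal" where
  "ext_expectation M f =
     enn2ereal (\<integral>\<^sup>+ x. e2ennreal (f x) \<partial>M) - enn2ereal (\<integral>\<^sup>+ x. e2ennreal (- f x) \<partial>M)"

section \<open>The game\<close>

text \<open>Decision makers are numbered \<open>1, \<dots>, N\<close>; agent number \<open>0\<close> is the environment. Agent indices
  precede time indices, so \<open>Am G i t\<close> is \<open>A\<close> with superscript \<open>i\<close> and subscript \<open>t\<close>. The
  fields \<open>init\<close>, \<open>wdist\<close> and \<open>xi\<close> are the random variables \<open>x\<^sub>0\<close>, \<open>w\<^sub>t\<close> and
  \<open>\<xi>\<^sub>t\<close> on the probability space \<open>\<Omega>\<close>.\<close>

record 'w lq_game =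
  num_dm :: nat
  horizon :: nat
  dim_x :: "nat \<Rightarrow> nat"
  dim_u :: "nat \<Rightarrow> nat"
  dim_y :: nat
  Am :: "nat \<Rightarrow> nat \<Rightarrow> real mat"
  Bm :: "nat \<Rightarrow> nat \<Rightarrow> real mat"
  Cm :: "nat \<Rightarrow> nat \<Rightarrow> real mat"
  B1 :: "nat \<Rightarrow> nat \<Rightarrow> real mat"
  B2 :: "nat \<Rightarrow> nat \<Rightarrow> real mat"
  Dm :: "nat \<Rightarrow> real mat"
  E1 :: "nat \<Rightarrow> nat \<Rightarrow> real mat"
  E2 :: "nat \<Rightarrow> nat \<Rightarrow> real mat"
  Qm :: "nat \<Rightarrow> nat \<Rightarrow> real mat"
  Rm :: "nat \<Rightarrow> nat \<Rightarrow> real mat"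
  Km :: "nat \<Rightarrow> nat \<Rightarrow> real mat"
  Lm :: "nat \<Rightarrow> nat \<Rightarrow> real mat"
  disc :: "nat \<Rightarrow> real"
  \<Omega> :: "'w measure"
  init :: "nat \<Rightarrow> 'w \<Rightarrow> real vec"
  wdist :: "nat \<Rightarrow> nat \<Rightarrow> 'w \<Rightarrow> real vec"
  xi :: "nat \<Rightarrow> 'w \<Rightarrow> real vec"

definition DM :: "'w lq_game \<Rightarrow> nat set" where
  "DM G = {1..num_dm G}"

definition valid_game :: "'w lq_game \<Rightarrow> bool" where
  "valid_game G \<longleftrightarrow>
     prob_space (\<Omega> G) \<and>
     (\<forall>i\<le>num_dm G. init G i \<in> \<Omega> G \<rightarrow>\<^sub>M borel_vec (dim_x G i)) \<and>
     (\<forall>t<horizon G.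
        xi G t \<in> \<Omega> G \<rightarrow>\<^sub>M borel_vec (dim_y G) \<and>
        Dm G t \<in> carrier_mat (dim_y G) (dim_x G 0) \<and>
        (\<forall>i\<le>num_dm G.
           wdist G i t \<in> \<Omega> G \<rightarrow>\<^sub>M borel_vec (dim_x G i) \<and>
           Am G i t \<in> carrier_mat (dim_x G i) (dim_x G i)) \<and>
        (\<forall>i\<in>DM G.
           Bm G i t \<in> carrier_mat (dim_x G i) (dim_u G i) \<and>
           Cm G i t \<in> carrier_mat (dim_x G i) (dim_y G) \<and>
           B1 G i t \<in> carrier_mat (dim_x G 0) (dim_u G i) \<and>
           B2 G i t \<in> carrier_mat (dim_x G 0) (dim_x G i) \<and>
           E1 G i t \<in> carrier_mat (dim_y G) (dim_u G i) \<and>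
           E2 G i t \<in> carrier_mat (dim_y G) (dim_x G i) \<and>
           Km G i t \<in> carrier_mat (dim_y G) (dim_u G i) \<and>
           Lm G i t \<in> carrier_mat (dim_y G) (dim_x G i) \<and>
           pos_definite (dim_x G i) (Qm G i t) \<and>
           pos_definite (dim_u G i) (Rm G i t))) \<and>
     (\<forall>i\<in>DM G. pos_definite (dim_x G i) (Qm G i (horizon G)) \<and> 0 \<le> disc G i \<and> disc G i \<le> 1)"

subsection \<open>Strategies and trajectories\<close>

definition X_space :: "'w lq_game \<Rightarrow> nat \<Rightarrow> real vec measure" where
  "X_space G i = borel_vec (dim_x G i)"

definition U_space :: "'w lq_game \<Rightarrow> nat \<Rightarrow> real vec measure" where
  "U_space G i = borel_vec (dim_u G i)"

definition Y_seqs :: "'w lq_game \<Rightarrow> nat \<Rightarrow> (nat \<Rightarrow> real vec) measure" where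
  "Y_seqs G t = (\<Pi>\<^sub>M k\<in>{..<t}. borel_vec (dim_y G))"

text \<open>A strategy maps the time \<open>t\<close> and the information \<open>((x\<^sub>0, \<dots>, x\<^sub>t), (u\<^sub>0, \<dots>, u\<^sub>t\<^sub>-\<^sub>1))\<close>,
  \<open>(y\<^sub>0, \<dots>, y\<^sub>t\<^sub>-\<^sub>1)\<close> to a control. Finite sequences are extensional functions.\<close>

type_synonym strategy =
  "nat \<Rightarrow> ((nat \<Rightarrow> real vec) \<times> (nat \<Rightarrow> real vec)) \<times> (nat \<Rightarrow> real vec) \<Rightarrow> real vec"

definition pure_strategies :: "'w lq_game \<Rightarrow> nat \<Rightarrow> strategy set" where
  "pure_strategies G i =
     {s. \<forall>t<horizon G.
        s t \<in> ((\<Pi>\<^sub>M k\<in>{..t}. X_space G i) \<Otimes>\<^sub>M (\<Pi>\<^sub>M k\<in>{..<t}. U_space G i)) \<Otimes>\<^sub>M Y_seqs G t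
              \<rightarrow>\<^sub>M U_space G i}"

lemma restrict_fundef_cong [fundef_cong]:
  "A = B \<Longrightarrow> (\<And>x. x \<in> B \<Longrightarrow> f x = g x) \<Longrightarrow> restrict f A = restrict g B"
  by (auto simp: restrict_def fun_eq_iff)

text \<open>State and control of one decision maker who faces the exogenous sequence \<open>z\<close>.\<close>

function subj_x :: "'w lq_game \<Rightarrow> nat \<Rightarrow> strategy \<Rightarrow> (nat \<Rightarrow> real vec) \<Rightarrow> 'w \<Rightarrow> nat \<Rightarrow> real vec"
  and subj_u :: "'w lq_game \<Rightarrow> nat \<Rightarrow> strategy \<Rightarrow> (nat \<Rightarrow> real vec) \<Rightarrow> 'w \<Rightarrow> nat \<Rightarrow> real vec" where
  "subj_x G i s z \<omega> 0 = init G i \<omega>"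
| "subj_x G i s z \<omega> (Suc t) =
     Am G i t *\<^sub>v subj_x G i s z \<omega> t + Bm G i t *\<^sub>v subj_u G i s z \<omega> t
     + Cm G i t *\<^sub>v z t + wdist G i t \<omega>"
| "subj_u G i s z \<omega> t =
     s t ((\<lambda>k\<in>{..t}. subj_x G i s z \<omega> k, \<lambda>k\<in>{..<t}. subj_u G i s z \<omega> k), \<lambda>k\<in>{..<t}. z k)"
  by pat_completeness auto
termination
  by (relation "Wellfounded.measure (\<lambda>p. case p of
        Inl (G, i, s, z, \<omega>, t) \<Rightarrow> 2 * t | Inr (G, i, s, z, \<omega>, t) \<Rightarrow> 2 * t + 1)") auto

text \<open>State, control and environment processes when all decision makers use the joint strategy
  \<open>s\<close>.\<close>

function game_x :: "'w lq_game \<Rightarrow> (nat \<Rightarrow> strategy) \<Rightarrow> 'w \<Rightarrow> nat \<Rightarrow> nat \<Rightarrow> real vec"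
  and game_u :: "'w lq_game \<Rightarrow> (nat \<Rightarrow> strategy) \<Rightarrow> 'w \<Rightarrow> nat \<Rightarrow> nat \<Rightarrow> real vec"
  and game_y :: "'w lq_game \<Rightarrow> (nat \<Rightarrow> strategy) \<Rightarrow> 'w \<Rightarrow> nat \<Rightarrow> real vec" where
  "game_x G s \<omega> i 0 = init G i \<omega>"
| "game_x G s \<omega> i (Suc t) =
     (if i = 0 then
        Am G 0 t *\<^sub>v game_x G s \<omega> 0 t
        + vec_sum (dim_x G 0)
            (\<lambda>j. B1 G j t *\<^sub>v game_u G s \<omega> j t + B2 G j t *\<^sub>v game_x G s \<omega> j t) (DM G)
        + wdist G 0 t \<omega>
      else
        Am G i t *\<^sub>v game_x G s \<omega> i t + Bm G i t *\<^sub>v game_u G s \<omega> i t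
        + Cm G i t *\<^sub>v game_y G s \<omega> t + wdist G i t \<omega>)"
| "game_u G s \<omega> i t =
     s i t ((\<lambda>k\<in>{..t}. game_x G s \<omega> i k, \<lambda>k\<in>{..<t}. game_u G s \<omega> i k),
            \<lambda>k\<in>{..<t}. game_y G s \<omega> k)"
| "game_y G s \<omega> t =
     Dm G t *\<^sub>v game_x G s \<omega> 0 t
     + vec_sum (dim_y G)
         (\<lambda>j. E1 G j t *\<^sub>v game_u G s \<omega> j t + E2 G j t *\<^sub>v game_x G s \<omega> j t) (DM G)
     + xi G t \<omega>"
  by pat_completeness auto
termination
  by (relation "Wellfounded.measure (\<lambda>p. case p of
        Inl (G, s, \<omega>, i, t) \<Rightarrow> 3 * t
      | Inr (Inl (G, s, \<omega>, i, t)) \<Rightarrow> 3 * t + 1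
      | Inr (Inr (G, s, \<omega>, t)) \<Rightarrow> 3 * t + 2)") auto

subsection \<open>Costs and equilibrium\<close>

definition stage_cost ::
  "'w lq_game \<Rightarrow> nat \<Rightarrow> nat \<Rightarrow> real vec \<Rightarrow> real vec \<Rightarrow> real vec \<Rightarrow> real" where
  "stage_cost G i t x u y =
     quad (Qm G i t) x + quad (Rm G i t) u + 2 * (y \<bullet> (Km G i t *\<^sub>v u + Lm G i t *\<^sub>v x))"

definition subj_cost :: "'w lq_game \<Rightarrow> nat \<Rightarrow> strategy \<Rightarrow> (nat \<Rightarrow> real vec) \<Rightarrow> ereal" where
  "subj_cost G i s z =
     ext_expectation (\<Omega> G) (\<lambda>\<omega>. ereal (
       (\<Sum>t<horizon G. disc G i ^ t * stage_cost G i t (subj_x G i s z \<omega> t) (subj_u G i s z \<omega> t) (z t))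
       + disc G i ^ horizon G * quad (Qm G i (horizon G)) (subj_x G i s z \<omega> (horizon G))))"

definition beliefs :: "'w lq_game \<Rightarrow> (nat \<Rightarrow> real vec) measure set" where
  "beliefs G = {\<zeta>. prob_space \<zeta> \<and> sets \<zeta> = sets (Y_seqs G (horizon G))}"

definition env_law :: "'w lq_game \<Rightarrow> (nat \<Rightarrow> strategy) \<Rightarrow> (nat \<Rightarrow> real vec) measure" where
  "env_law G s = distr (\<Omega> G) (Y_seqs G (horizon G)) (\<lambda>\<omega>. \<lambda>t\<in>{..<horizon G}. game_y G s \<omega> t)"

definition SEBEU :: "'w lq_game \<Rightarrow> (nat \<Rightarrow> strategy) \<Rightarrow> bool" where
  "SEBEU G s \<longleftrightarrow>
     (\<forall>i\<in>DM G. s i \<in> pure_strategies G i) \<and>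
     (\<exists>\<zeta>. (\<forall>i\<in>DM G. \<zeta> i \<in> beliefs G) \<and>
        (\<forall>i\<in>DM G. \<forall>s'\<in>pure_strategies G i.
           ext_expectation (\<zeta> i) (subj_cost G i (s i)) \<le> ext_expectation (\<zeta> i) (subj_cost G i s')) \<and>
        (\<forall>i\<in>DM G. \<zeta> i = env_law G s))"

section \<open>Optimal-response matrices\<close>

definition S_of :: "'w lq_game \<Rightarrow> nat \<Rightarrow> nat \<Rightarrow> real mat \<Rightarrow> real mat" where
  "S_of G i k M = Rm G i k + disc G i \<cdot>\<^sub>m (transpose_mat (Bm G i k) * M * Bm G i k)"

function M_mat :: "'w lq_game \<Rightarrow> nat \<Rightarrow> nat \<Rightarrow> real mat" where
  "M_mat G i k =
     (if k < horizon G then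
        let M = M_mat G i (Suc k); B = Bm G i k in
        Qm G i k + disc G i \<cdot>\<^sub>m (transpose_mat (Am G i k)
          * (M - disc G i \<cdot>\<^sub>m (M * B * mat_inv (S_of G i k M) * transpose_mat B * M)) * Am G i k)
      else Qm G i (horizon G))"
  by pat_completeness auto
termination
  by (relation "Wellfounded.measure (\<lambda>(G, i, k). horizon G - k)") auto

declare M_mat.simps [simp del]

definition S_mat :: "'w lq_game \<Rightarrow> nat \<Rightarrow> nat \<Rightarrow> real mat" where
  "S_mat G i k = S_of G i k (M_mat G i (Suc k))"

definition F_mat :: "'w lq_game \<Rightarrow> nat \<Rightarrow> nat \<Rightarrow> real mat" where
  "F_mat G i k =
     - disc G i \<cdot>\<^sub>m (mat_inv (S_mat G i k) * transpose_mat (Bm G i k) * M_mat G i (Suc k) * Am G i k)"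

text \<open>The factor with the smallest index is leftmost.\<close>

definition Phi :: "'w lq_game \<Rightarrow> nat \<Rightarrow> nat \<Rightarrow> nat \<Rightarrow> real mat" where
  "Phi G i k t =
     foldr (\<lambda>n P. disc G i \<cdot>\<^sub>m transpose_mat (Am G i n + Bm G i n * F_mat G i n) * P)
       [Suc k..<Suc t] (1\<^sub>m (dim_x G i))"

definition G_mat :: "'w lq_game \<Rightarrow> nat \<Rightarrow> nat \<Rightarrow> nat \<Rightarrow> real mat" where
  "G_mat G i k t =
     (if t = k then
        - (mat_inv (S_mat G i k) * (transpose_mat (Km G i k)
            + disc G i \<cdot>\<^sub>m (transpose_mat (Bm G i k) * M_mat G i (Suc k) * Cm G i k)))
      else
        - disc G i \<cdot>\<^sub>m (mat_inv (S_mat G i k) * transpose_mat (Bm G i k)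
            * (Phi G i k t * M_mat G i (Suc t) * Cm G i t
               + Phi G i k (t - 1)
                 * (transpose_mat (F_mat G i t) * transpose_mat (Km G i t) + transpose_mat (Lm G i t)))))"

definition H_vec :: "'w lq_game \<Rightarrow> nat \<Rightarrow> nat \<Rightarrow> real vec" where
  "H_vec G i k =
     - disc G i \<cdot>\<^sub>v (mat_inv (S_mat G i k) * transpose_mat (Bm G i k)
         *\<^sub>v vec_sum (dim_x G i)
               (\<lambda>t. Phi G i k t * M_mat G i (Suc t) *\<^sub>v vec_expectation (\<Omega> G) (dim_x G i) (wdist G i t))
               {k..<horizon G})"

section \<open>Aggregate matrices\<close>

definition dim_X :: "'w lq_game \<Rightarrow> nat" where
  "dim_X G = (\<Sum>i\<le>num_dm G. dim_x G i)"

definition X_init :: "'w lq_game \<Rightarrow> 'w \<Rightarrow> real vec" where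
  "X_init G \<omega> = stack_vec (Suc (num_dm G)) (\<lambda>i. init G i \<omega>)"

definition W_dist :: "'w lq_game \<Rightarrow> nat \<Rightarrow> 'w \<Rightarrow> real vec" where
  "W_dist G t \<omega> = stack_vec (Suc (num_dm G)) (\<lambda>i. wdist G i t \<omega>)"

definition D_agg :: "'w lq_game \<Rightarrow> nat \<Rightarrow> real mat" where
  "D_agg G t = stack_cols (dim_y G) (Suc (num_dm G))
     (\<lambda>j. if j = 0 then Dm G t else E1 G j t * F_mat G j t + E2 G j t)"

definition Gp_agg :: "'w lq_game \<Rightarrow> nat \<Rightarrow> nat \<Rightarrow> real mat" where
  "Gp_agg G t k = mat_sum (dim_y G) (dim_y G) (\<lambda>j. E1 G j t * G_mat G j t k) (DM G)"

definition Hp_agg :: "'w lq_game \<Rightarrow> nat \<Rightarrow> real vec" where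
  "Hp_agg G t = vec_sum (dim_y G) (\<lambda>j. E1 G j t *\<^sub>v H_vec G j t) (DM G)"

definition A_agg :: "'w lq_game \<Rightarrow> nat \<Rightarrow> real mat" where
  "A_agg G t = stack_rows (dim_X G) (Suc (num_dm G))
     (\<lambda>i. stack_cols (dim_x G i) (Suc (num_dm G))
        (\<lambda>j. if i = 0
             then (if j = 0 then Am G 0 t else B1 G j t * F_mat G j t + B2 G j t)
             else (if j = i then Am G i t + Bm G i t * F_mat G i t
                   else 0\<^sub>m (dim_x G i) (dim_x G j))))"

definition GX_agg :: "'w lq_game \<Rightarrow> nat \<Rightarrow> nat \<Rightarrow> real mat" where
  "GX_agg G t k = stack_rows (dim_y G) (Suc (num_dm G))
     (\<lambda>i. if i = 0 then mat_sum (dim_x G 0) (dim_y G) (\<lambda>j. B1 G j t * G_mat G j t k) (DM G)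
          else Bm G i t * G_mat G i t k)"

definition HX_agg :: "'w lq_game \<Rightarrow> nat \<Rightarrow> real vec" where
  "HX_agg G t = stack_vec (Suc (num_dm G))
     (\<lambda>i. if i = 0 then vec_sum (dim_x G 0) (\<lambda>j. B1 G j t *\<^sub>v H_vec G j t) (DM G)
          else Bm G i t *\<^sub>v H_vec G i t)"

definition C_agg :: "'w lq_game \<Rightarrow> nat \<Rightarrow> real mat" where
  "C_agg G t = stack_rows (dim_y G) (Suc (num_dm G))
     (\<lambda>i. if i = 0 then 0\<^sub>m (dim_x G 0) (dim_y G) else Cm G i t)"

section \<open>Hypotheses on the primitive random variables and on the prediction equations\<close>

datatype primitive = Initial | Disturb nat | Noise nat

definition primitives :: "'w lq_game \<Rightarrow> primitive set" where
  "primitives G = {Initial} \<union> Disturb ` {..<horizon G} \<union> Noise ` {..<horizon G}"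

primrec primitive_dim :: "'w lq_game \<Rightarrow> primitive \<Rightarrow> nat" where
  "primitive_dim G Initial = dim_X G"
| "primitive_dim G (Disturb t) = dim_X G"
| "primitive_dim G (Noise t) = dim_y G"

primrec primitive_rv :: "'w lq_game \<Rightarrow> primitive \<Rightarrow> 'w \<Rightarrow> real vec" where
  "primitive_rv G Initial = X_init G"
| "primitive_rv G (Disturb t) = W_dist G t"
| "primitive_rv G (Noise t) = xi G t"

definition independent_primitives :: "'w lq_game \<Rightarrow> bool" where
  "independent_primitives G \<longleftrightarrow>
     prob_space.indep_vars (\<Omega> G) (\<lambda>p. borel_vec (primitive_dim G p)) (primitive_rv G) (primitives G) \<and>
     (\<forall>p\<in>primitives G. finite_second_moment (\<Omega> G) (primitive_dim G p) (primitive_rv G p))"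

text \<open>\<open>y t\<close> (for \<open>k \<le> t < T\<close>) and \<open>X t\<close> (for \<open>k \<le> t \<le> T\<close>) are the predictions made from
  the information of time \<open>k - 1\<close>, with \<open>X k\<close> prescribed. Outside these ranges the functions are
  undefined, so that uniqueness of solutions is meaningful.\<close>

definition prediction ::
  "'w lq_game \<Rightarrow> nat \<Rightarrow> real vec \<Rightarrow> (nat \<Rightarrow> real vec) \<times> (nat \<Rightarrow> real vec) \<Rightarrow> bool" where
  "prediction G k x yX \<longleftrightarrow> (case yX of (y, X) \<Rightarrow>
     y \<in> {k..<horizon G} \<rightarrow>\<^sub>E carrier_vec (dim_y G) \<and>
     X \<in> {k..horizon G} \<rightarrow>\<^sub>E carrier_vec (dim_X G) \<and>
     X k = x \<and>
     (\<forall>t\<in>{k..<horizon G}.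
        y t = D_agg G t *\<^sub>v X t
              + vec_sum (dim_y G) (\<lambda>n. Gp_agg G t n *\<^sub>v y n) {t..<horizon G}
              + Hp_agg G t + vec_expectation (\<Omega> G) (dim_y G) (xi G t) \<and>
        X (Suc t) = A_agg G t *\<^sub>v X t
              + vec_sum (dim_X G) (\<lambda>n. GX_agg G t n *\<^sub>v y n) {t..<horizon G}
              + HX_agg G t + C_agg G t *\<^sub>v y t + vec_expectation (\<Omega> G) (dim_X G) (W_dist G t)))"

definition unique_predictions :: "'w lq_game \<Rightarrow> bool" where
  "unique_predictions G \<longleftrightarrow>
     (\<forall>k<horizon G. \<forall>x\<in>carrier_vec (dim_X G). \<exists>!yX. prediction G k x yX)"

text \<open>\<open>a t k\<close> and \<open>b t k\<close> carry the subscript \<open>t, k - 1\<close>: the predictions made from the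
  information of time \<open>k - 1\<close>.\<close>

definition prediction_coeffs ::
  "'w lq_game \<Rightarrow> (nat \<Rightarrow> nat \<Rightarrow> real mat) \<Rightarrow> (nat \<Rightarrow> nat \<Rightarrow> real vec) \<Rightarrow> bool" where
  "prediction_coeffs G a b \<longleftrightarrow>
     (\<forall>k<horizon G. \<forall>t\<in>{k..<horizon G}.
        a t k \<in> carrier_mat (dim_y G) (dim_X G) \<and> b t k \<in> carrier_vec (dim_y G) \<and>
        (\<forall>x\<in>carrier_vec (dim_X G). \<forall>y X. prediction G k x (y, X) \<longrightarrow> y t = a t k *\<^sub>v x + b t k))"

section \<open>The state estimator and the equilibrium strategy\<close>

text \<open>\<open>bar_hat G a b t\<close> is the conditional expectation of \<open>bar_X G a b t\<close> given
  \<open>bar_y G a b k\<close>, \<open>k < t\<close>.\<close>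

function bar_X :: "'w lq_game \<Rightarrow> (nat \<Rightarrow> nat \<Rightarrow> real mat) \<Rightarrow> (nat \<Rightarrow> nat \<Rightarrow> real vec) \<Rightarrow> nat \<Rightarrow> 'w \<Rightarrow> real vec"
  and bar_hat :: "'w lq_game \<Rightarrow> (nat \<Rightarrow> nat \<Rightarrow> real mat) \<Rightarrow> (nat \<Rightarrow> nat \<Rightarrow> real vec) \<Rightarrow> nat \<Rightarrow> 'w \<Rightarrow> real vec"
  and bar_y :: "'w lq_game \<Rightarrow> (nat \<Rightarrow> nat \<Rightarrow> real mat) \<Rightarrow> (nat \<Rightarrow> nat \<Rightarrow> real vec) \<Rightarrow> nat \<Rightarrow> 'w \<Rightarrow> real vec" where
  "bar_X G a b 0 = X_init G"
| "bar_X G a b (Suc t) = (\<lambda>\<omega>.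
     A_agg G t *\<^sub>v bar_X G a b t \<omega>
     + vec_sum (dim_X G) (\<lambda>n. GX_agg G t n *\<^sub>v (a n t *\<^sub>v bar_hat G a b t \<omega> + b n t)) {t..<horizon G}
     + HX_agg G t + C_agg G t *\<^sub>v bar_y G a b t \<omega> + W_dist G t \<omega>)"
| "bar_hat G a b t =
     vec_cond_exp (\<Omega> G)
       (vimage_algebra (space (\<Omega> G)) (\<lambda>\<omega>. \<lambda>k\<in>{..<t}. bar_y G a b k \<omega>) (Y_seqs G t))
       (dim_X G) (bar_X G a b t)"
| "bar_y G a b t = (\<lambda>\<omega>.
     D_agg G t *\<^sub>v bar_X G a b t \<omega>
     + vec_sum (dim_y G) (\<lambda>n. Gp_agg G t n *\<^sub>v (a n t *\<^sub>v bar_hat G a b t \<omega> + b n t)) {t..<horizon G}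
     + Hp_agg G t + xi G t \<omega>)"
  by pat_completeness auto
termination
  by (relation "Wellfounded.measure (\<lambda>p. case p of
        Inl (G, a, b, t) \<Rightarrow> 3 * t
      | Inr (Inl (G, a, b, t)) \<Rightarrow> 3 * t + 1
      | Inr (Inr (G, a, b, t)) \<Rightarrow> 3 * t + 2)") auto

definition state_estimator ::
  "'w lq_game \<Rightarrow> (nat \<Rightarrow> nat \<Rightarrow> real mat) \<Rightarrow> (nat \<Rightarrow> nat \<Rightarrow> real vec)
     \<Rightarrow> (nat \<Rightarrow> (nat \<Rightarrow> real vec) \<Rightarrow> real vec) \<Rightarrow> bool" where
  "state_estimator G a b est \<longleftrightarrow>
     (\<forall>t<horizon G.
        est t \<in> Y_seqs G t \<rightarrow>\<^sub>M borel_vec (dim_X G) \<and>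
        (AE \<omega> in \<Omega> G. est t (\<lambda>k\<in>{..<t}. bar_y G a b k \<omega>) = bar_hat G a b t \<omega>))"

definition G_total :: "'w lq_game \<Rightarrow> (nat \<Rightarrow> nat \<Rightarrow> real mat) \<Rightarrow> nat \<Rightarrow> nat \<Rightarrow> real mat" where
  "G_total G a i t =
     mat_sum (dim_u G i) (dim_X G) (\<lambda>k. G_mat G i t k * a k t) {t..<horizon G}"

definition H_check :: "'w lq_game \<Rightarrow> (nat \<Rightarrow> nat \<Rightarrow> real vec) \<Rightarrow> nat \<Rightarrow> nat \<Rightarrow> real vec" where
  "H_check G b i t =
     vec_sum (dim_u G i) (\<lambda>k. G_mat G i t k *\<^sub>v b k t) {t..<horizon G} + H_vec G i t"

definition eq_strategy ::
  "'w lq_game \<Rightarrow> (nat \<Rightarrow> nat \<Rightarrow> real mat) \<Rightarrow> (nat \<Rightarrow> nat \<Rightarrow> real vec)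
     \<Rightarrow> (nat \<Rightarrow> (nat \<Rightarrow> real vec) \<Rightarrow> real vec) \<Rightarrow> nat \<Rightarrow> strategy" where
  "eq_strategy G a b est i t = (\<lambda>((x, u), y).
     F_mat G i t *\<^sub>v x t + G_total G a i t *\<^sub>v est t y + H_check G b i t)"

end

theory Submission
  imports Defs "Jordan_Normal_Form.Determinant"
begin

text \<open>
  The equilibrium property rests on two facts: a formula for the best response of one decision maker
  to an arbitrary exogenous sequence, and the observation that the candidate strategies generate a
  sequence for which the forecasts built into them are conditional expectations.

  \<^emph>\<open>Best response.\<close> Fix the disturbances and the exogenous sequence of one decision maker. The
  square is completed backward in time with a costate that knows the whole future and
  vanishes at the horizon. Path by path, the cost of every strategy becomes a term that no strategy
  influences plus the discounted sum of the terms \<open>|u\<^sub>t - F\<^sub>t x\<^sub>t - v\<^sub>t|\<^sup>2\<close> in the norm of \<open>S\<^sub>t\<close>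
  (\<open>cost_completed_square\<close>). Here \<open>v\<^sub>t\<close> is a linear function of the present and future of the two
  sequences and does not depend on the strategy; \<open>feedforward_explicit\<close> identifies its coefficients as
  \<open>G\<^sub>t\<^sub>,\<^sub>k\<close> and those behind \<open>H\<^sub>t\<close>. The quantity \<open>u\<^sub>t - F\<^sub>t x\<^sub>t\<close> is a function of the information at
  time \<open>t\<close>, so its best choice is the conditional expectation of \<open>v\<^sub>t\<close>, for each \<open>t\<close> separately
  (\<open>quad_least_at_projection\<close>). The disturbances are independent of the exogenous sequence and of the
  past, so this conditional expectation is obtained by putting forecasts of \<open>y\<^sub>k\<close> and means of \<open>w\<^sub>k\<close> in
  the formula for \<open>v\<^sub>t\<close> (\<open>optimal_response\<close>). All strategy-dependent terms are nonnegative,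
  so that strategies of infinite cost are covered by the same comparison.

  \<^emph>\<open>Forecasts.\<close> For the reference recursion the forecast of \<open>y\<^sub>t\<close> from the observations before time
  \<open>k\<close> has to be \<open>a\<^sub>t\<^sub>,\<^sub>k\<^sub>-\<^sub>1\<close> applied to the state estimate, plus \<open>b\<^sub>t\<^sub>,\<^sub>k\<^sub>-\<^sub>1\<close>. Average the recursion
  with a weight of mean one that is a bounded function of these observations. Estimation
  errors and centred disturbances average to zero, and what remains is a deterministic recursion in
  which the averages are fed back through the coefficients \<open>a, b\<close>. Predictions are time
  consistent (\<open>prediction_restrict\<close>), so the solution of the prediction equations satisfies the same
  recursion and therefore coincides with the averages (\<open>wt_prediction\<close>). Hence the forecast error
  is orthogonal to every bounded function of the past observations (\<open>prediction_error_orthogonal\<close>).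

  \<^emph>\<open>Consistency.\<close> When all decision makers use the candidate strategies, the stacked state
  and the environment variable of the game satisfy the reference recursion, with the estimator
  applied to the observations in place of the conditional expectation, and so agree almost
  surely with the reference processes (\<open>game_matches_reference\<close>). The law of the environment variables
  is thus a belief to which the first part applies for every decision maker.

  The coefficients \<open>a, b\<close> exist because an affine combination of predictions is a prediction
  (\<open>prediction_weighted_mean\<close>), the estimator by the factorization lemma of Doob and Dynkin.
\<close>

section \<open>Sums and stacks of vectors and matrices\<close>

lemma vec_sum_carrier [simp]: "vec_sum n f S \<in> carrier_vec n"
  by (simp add: vec_sum_def)

lemma dim_vec_sum [simp]: "dim_vec (vec_sum n f S) = n"
  by (simp add: vec_sum_def)

lemma index_vec_sum [simp]: "r < n \<Longrightarrow> vec_sum n f S $ r = (\<Sum>k\<in>S. f k $ r)"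
  by (simp add: vec_sum_def)

lemma vec_sum_cong: "S = S' \<Longrightarrow> (\<And>k. k \<in> S' \<Longrightarrow> f k = g k) \<Longrightarrow> vec_sum n f S = vec_sum n g S'"
  by (simp add: vec_sum_def)

lemma mult_mat_vec_index_sum:
  assumes "A \<in> carrier_mat m n" "v \<in> carrier_vec n" "r < m"
  shows "(A *\<^sub>v v) $ r = (\<Sum>c<n. A $$ (r, c) * v $ c)"
  using assms by (simp add: scalar_prod_def lessThan_atLeast0)

lemma mult_mat_vec_sum:
  assumes A: "A \<in> carrier_mat m n" and f: "\<And>k. k \<in> S \<Longrightarrow> f k \<in> carrier_vec n"
  shows "A *\<^sub>v vec_sum n f S = vec_sum m (\<lambda>k. A *\<^sub>v f k) S"
proof (rule eq_vecI)
  fix r assume r: "r < dim_vec (vec_sum m (\<lambda>k. A *\<^sub>v f k) S)"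
  then have r: "r < m" by simp
  have "(A *\<^sub>v vec_sum n f S) $ r = (\<Sum>c<n. A $$ (r, c) * (\<Sum>k\<in>S. f k $ c))"
    by (subst mult_mat_vec_index_sum[OF A _ r]) auto
  also have "\<dots> = (\<Sum>k\<in>S. \<Sum>c<n. A $$ (r, c) * f k $ c)"
    unfolding sum_distrib_left by (rule sum.swap)
  also have "\<dots> = (\<Sum>k\<in>S. (A *\<^sub>v f k) $ r)"
    by (rule sum.cong[OF refl], subst mult_mat_vec_index_sum[OF A _ r]) (auto simp: f)
  finally show "(A *\<^sub>v vec_sum n f S) $ r = vec_sum m (\<lambda>k. A *\<^sub>v f k) S $ r"
    using r by simp
qed (use A in auto)

lemma vec_sum_add:
  assumes "\<And>k. k \<in> S \<Longrightarrow> f k \<in> carrier_vec n" "\<And>k. k \<in> S \<Longrightarrow> g k \<in> carrier_vec n"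
  shows "vec_sum n (\<lambda>k. f k + g k) S = vec_sum n f S + vec_sum n g S"
proof (rule eq_vecI)
  fix r assume "r < dim_vec (vec_sum n f S + vec_sum n g S)"
  then have r: "r < n" by simp
  have "(\<Sum>k\<in>S. (f k + g k) $ r) = (\<Sum>k\<in>S. f k $ r + g k $ r)"
    using r assms(2) by (intro sum.cong refl index_add_vec) (auto dest!: assms(2))
  then show "vec_sum n (\<lambda>k. f k + g k) S $ r = (vec_sum n f S + vec_sum n g S) $ r"
    using r by (simp add: sum.distrib)
qed simp

lemma vec_sum_minus:
  assumes "\<And>k. k \<in> S \<Longrightarrow> f k \<in> carrier_vec n" "\<And>k. k \<in> S \<Longrightarrow> g k \<in> carrier_vec n"
  shows "vec_sum n (\<lambda>k. f k - g k) S = vec_sum n f S - vec_sum n g S"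
proof (rule eq_vecI)
  fix r assume "r < dim_vec (vec_sum n f S - vec_sum n g S)"
  then have r: "r < n" by simp
  have "(\<Sum>k\<in>S. (f k - g k) $ r) = (\<Sum>k\<in>S. f k $ r - g k $ r)"
    using r assms(2) by (intro sum.cong refl index_minus_vec) (auto dest!: assms(2))
  then show "vec_sum n (\<lambda>k. f k - g k) S $ r = (vec_sum n f S - vec_sum n g S) $ r"
    using r by (simp add: sum_subtractf)
qed simp

lemma vec_sum_head:
  assumes "t < T" "f t \<in> carrier_vec n"
  shows "vec_sum n f {t..<T} = f t + vec_sum n f {Suc t..<T}"
proof -
  have "{t..<T} = insert t {Suc t..<T}" using assms(1) by auto
  then show ?thesis using assms(2) by (intro eq_vecI) auto
qed

lemma vec_add_right_swap:
  fixes a b c :: "real vec"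
  assumes "a \<in> carrier_vec n" "b \<in> carrier_vec n" "c \<in> carrier_vec n"
  shows "a + b + c = a + c + b"
  using assms by (intro eq_vecI) auto

lemma vec_add_middle_first:
  fixes a b c :: "real vec"
  assumes "a \<in> carrier_vec n" "b \<in> carrier_vec n" "c \<in> carrier_vec n"
  shows "a + b + c = b + (a + c)"
  using assms by (intro eq_vecI) auto

lemma four_term_assoc:
  fixes a b c d :: "real vec"
  assumes "a \<in> carrier_vec n" "b \<in> carrier_vec n" "c \<in> carrier_vec n" "d \<in> carrier_vec n"
  shows "a + (b + (c + d)) = a + b + c + d"
  using assms by (intro eq_vecI) auto

lemma mat_sum_carrier [simp]: "mat_sum nr nc f S \<in> carrier_mat nr nc"
  by (simp add: mat_sum_def)

lemma mat_sum_mult_vec: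
  assumes f: "\<And>k. k \<in> S \<Longrightarrow> f k \<in> carrier_mat nr nc" and x: "x \<in> carrier_vec nc"
  shows "mat_sum nr nc f S *\<^sub>v x = vec_sum nr (\<lambda>k. f k *\<^sub>v x) S"
proof (rule eq_vecI)
  fix r assume "r < dim_vec (vec_sum nr (\<lambda>k. f k *\<^sub>v x) S)"
  then have r: "r < nr" by simp
  have "(mat_sum nr nc f S *\<^sub>v x) $ r = (\<Sum>c<nc. (\<Sum>k\<in>S. f k $$ (r, c)) * x $ c)"
    by (subst mult_mat_vec_index_sum[OF mat_sum_carrier x r]) (simp add: mat_sum_def r)
  also have "\<dots> = (\<Sum>k\<in>S. \<Sum>c<nc. f k $$ (r, c) * x $ c)"
    unfolding sum_distrib_right by (rule sum.swap)
  also have "\<dots> = (\<Sum>k\<in>S. (f k *\<^sub>v x) $ r)"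
    by (rule sum.cong[OF refl], subst mult_mat_vec_index_sum[OF f x r]) auto
  finally show "(mat_sum nr nc f S *\<^sub>v x) $ r = vec_sum nr (\<lambda>k. f k *\<^sub>v x) S $ r"
    using r by simp
qed (simp add: mat_sum_def)

lemma stack_vec_carrier:
  "(\<And>i. i < n \<Longrightarrow> v i \<in> carrier_vec (d i)) \<Longrightarrow> stack_vec n v \<in> carrier_vec (\<Sum>i<n. d i)"
  by (induction n) auto

lemma stack_vec_add:
  "(\<And>i. i < n \<Longrightarrow> u i \<in> carrier_vec (d i)) \<Longrightarrow> (\<And>i. i < n \<Longrightarrow> v i \<in> carrier_vec (d i)) \<Longrightarrow>
   stack_vec n u + stack_vec n v = stack_vec n (\<lambda>i. u i + v i)"
proof (induction n)
  case (Suc n)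
  have "stack_vec (Suc n) u + stack_vec (Suc n) v = (stack_vec n u + stack_vec n v) @\<^sub>v (u n + v n)"
    unfolding stack_vec.simps
    by (rule append_vec_add[OF stack_vec_carrier[of n u d] stack_vec_carrier[of n v d]])
      (use Suc.prems in auto)
  with Suc show ?case by simp
qed auto

lemma stack_vec_cong: "(\<And>i. i < n \<Longrightarrow> u i = v i) \<Longrightarrow> stack_vec n u = stack_vec n v"
  by (induction n) auto

text \<open>A component of a stacked vector is a component of one block, whatever the blocks are, and
  vice versa; hence componentwise properties pass between a stack and its blocks.\<close>

lemma stack_vec_index:
  fixes d :: "nat \<Rightarrow> nat"
  assumes "r < (\<Sum>i<n. d i)"
  shows "\<exists>i<n. \<exists>c<d i. \<forall>v. (\<forall>i<n. v i \<in> carrier_vec (d i)) \<longrightarrow> stack_vec n v $ r = v i $ c"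
  using assms
proof (induction n)
  case (Suc n)
  show ?case
  proof (cases "r < (\<Sum>i<n. d i)")
    case True
    then obtain i c where "i < n" "c < d i"
      "\<forall>v. (\<forall>i<n. v i \<in> carrier_vec (d i)) \<longrightarrow> stack_vec n v $ r = v i $ c"
      using Suc by blast
    moreover have "stack_vec (Suc n) v $ r = stack_vec n v $ r"
      if "\<forall>i<Suc n. v i \<in> carrier_vec (d i)" for v
      using True stack_vec_carrier[of n v d] that by (auto simp: append_vec_def)
    ultimately show ?thesis
      by (intro exI[of _ i] conjI exI[of _ c]) auto
  next
    case False
    have "stack_vec (Suc n) v $ r = v n $ (r - (\<Sum>i<n. d i))"
      if "\<forall>i<Suc n. v i \<in> carrier_vec (d i)" for v
      using False Suc.prems stack_vec_carrier[of n v d] that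
      by (auto simp: append_vec_def)
    then show ?thesis
      using False Suc.prems by (intro exI[of _ n] conjI exI[of _ "r - (\<Sum>i<n. d i)"]) auto
  qed
qed simp

lemma stack_vec_index_surj:
  fixes d :: "nat \<Rightarrow> nat"
  assumes "i < n" "c < d i"
  shows "\<exists>r<\<Sum>i<n. d i. \<forall>v. (\<forall>i<n. v i \<in> carrier_vec (d i)) \<longrightarrow> stack_vec n v $ r = v i $ c"
  using assms
proof (induction n)
  case (Suc n)
  show ?case
  proof (cases "i < n")
    case True
    then obtain r where r: "r < (\<Sum>i<n. d i)"
      "\<forall>v. (\<forall>i<n. v i \<in> carrier_vec (d i)) \<longrightarrow> stack_vec n v $ r = v i $ c"
      using Suc by blast
    moreover have "stack_vec (Suc n) v $ r = stack_vec n v $ r"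
      if "\<forall>i<Suc n. v i \<in> carrier_vec (d i)" for v
      using r stack_vec_carrier[of n v d] that by (auto simp: append_vec_def)
    ultimately show ?thesis
      by (intro exI[of _ r]) auto
  next
    case False
    then have i: "i = n" using Suc.prems by simp
    have "stack_vec (Suc n) v $ ((\<Sum>i<n. d i) + c) = v i $ c"
      if "\<forall>i<Suc n. v i \<in> carrier_vec (d i)" for v
      using i Suc.prems stack_vec_carrier[of n v d] that
      by (auto simp: append_vec_def)
    then show ?thesis
      using i Suc.prems by (intro exI[of _ "(\<Sum>i<n. d i) + c"]) auto
  qed
qed simp

lemma stack_vec_vec_sum:
  assumes f: "\<And>i k. i < n \<Longrightarrow> k \<in> S \<Longrightarrow> f i k \<in> carrier_vec (d i)"
  shows "stack_vec n (\<lambda>i. vec_sum (d i) (f i) S) = vec_sum (\<Sum>i<n. d i) (\<lambda>k. stack_vec n (\<lambda>i. f i k)) S"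
    (is "?l = ?r")
proof (rule eq_vecI)
  fix r assume "r < dim_vec ?r"
  then have r: "r < (\<Sum>i<n. d i)" by simp
  obtain i c where ic: "i < n" "c < d i"
      "\<And>v. (\<forall>i<n. v i \<in> carrier_vec (d i)) \<Longrightarrow> stack_vec n v $ r = v i $ c"
    using stack_vec_index[OF r] by blast
  have "stack_vec n (\<lambda>i. f i k) $ r = f i k $ c" if "k \<in> S" for k
    using that f by (intro ic(3)) auto
  moreover have "?l $ r = vec_sum (d i) (f i) S $ c"
    by (intro ic(3)) auto
  ultimately show "?l $ r = ?r $ r" using ic(1,2) r by simp
next
  show "dim_vec ?l = dim_vec ?r"
    using stack_vec_carrier[of n "\<lambda>i. vec_sum (d i) (f i) S" d] by simp
qed

lemma stack_rows_carrier:
  "(\<And>i. i < n \<Longrightarrow> A i \<in> carrier_mat (d i) nc) \<Longrightarrow> stack_rows nc n A \<in> carrier_mat (\<Sum>i<n. d i) nc"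
  by (induction n) auto

lemma stack_rows_mult_vec:
  assumes x: "x \<in> carrier_vec nc"
  shows "(\<And>i. i < n \<Longrightarrow> A i \<in> carrier_mat (d i) nc) \<Longrightarrow>
    stack_rows nc n A *\<^sub>v x = stack_vec n (\<lambda>i. A i *\<^sub>v x)"
proof (induction n)
  case 0
  then show ?case using x by (intro eq_vecI) auto
next
  case (Suc n)
  have "stack_rows nc (Suc n) A *\<^sub>v x = (stack_rows nc n A *\<^sub>v x) @\<^sub>v (A n *\<^sub>v x)"
    unfolding stack_rows.simps
    by (rule mat_mult_append[OF stack_rows_carrier[of n A d] _ x]) (use Suc.prems in auto)
  with Suc show ?case by simp
qed

lemma stack_cols_carrier:
  "(\<And>j. j < n \<Longrightarrow> A j \<in> carrier_mat nr (d j)) \<Longrightarrow> stack_cols nr n A \<in> carrier_mat nr (\<Sum>j<n. d j)"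
proof (induction n)
  case (Suc n)
  then have "stack_cols nr n A \<in> carrier_mat nr (\<Sum>j<n. d j)" "A n \<in> carrier_mat nr (d n)" by auto
  from carrier_matD[OF this(1)] carrier_matD[OF this(2)] show ?case
    by (intro carrier_matI) simp_all
qed auto

lemma stack_cols_mult_vec:
  "(\<And>j. j < n \<Longrightarrow> A j \<in> carrier_mat nr (d j)) \<Longrightarrow> (\<And>j. j < n \<Longrightarrow> v j \<in> carrier_vec (d j)) \<Longrightarrow>
    stack_cols nr n A *\<^sub>v stack_vec n v = vec_sum nr (\<lambda>j. A j *\<^sub>v v j) {..<n}"
proof (induction n)
  case 0
  then show ?case by (intro eq_vecI) (auto simp: scalar_prod_def)
next
  case (Suc n)
  let ?P = "stack_cols nr n A" and ?s = "stack_vec n v"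
  have P: "?P \<in> carrier_mat nr (\<Sum>j<n. d j)" by (rule stack_cols_carrier) (use Suc.prems in auto)
  have s: "?s \<in> carrier_vec (\<Sum>j<n. d j)" by (rule stack_vec_carrier) (use Suc.prems in auto)
  have An: "A n \<in> carrier_mat nr (d n)" "v n \<in> carrier_vec (d n)" using Suc.prems by auto
  have "stack_cols nr (Suc n) A *\<^sub>v stack_vec (Suc n) v
      = (?P *\<^sub>v ?s + A n *\<^sub>v v n) @\<^sub>v (0\<^sub>m 0 (\<Sum>j<n. d j) *\<^sub>v ?s + 0\<^sub>m 0 (d n) *\<^sub>v v n)"
    unfolding stack_cols.simps stack_vec.simps using P s An
    by (subst four_block_mat_mult_vec[of _ nr "\<Sum>j<n. d j" _ "d n" _ 0]) auto
  also have "\<dots> = ?P *\<^sub>v ?s + A n *\<^sub>v v n"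
    using P An by (intro eq_vecI) auto
  also have "?P *\<^sub>v ?s = vec_sum nr (\<lambda>j. A j *\<^sub>v v j) {..<n}" using Suc by simp
  also have "\<dots> + A n *\<^sub>v v n = vec_sum nr (\<lambda>j. A j *\<^sub>v v j) {..<Suc n}"
    using An by (intro eq_vecI) auto
  finally show ?case .
qed

section \<open>Quadratic forms and the completion of the square\<close>

lemma scalar_prod_transpose:
  fixes A :: "real mat"
  assumes "A \<in> carrier_mat m n" "x \<in> carrier_vec n" "y \<in> carrier_vec m"
  shows "x \<bullet> (transpose_mat A *\<^sub>v y) = (A *\<^sub>v x) \<bullet> y"
proof -
  have "x \<bullet> (transpose_mat A *\<^sub>v y) = (transpose_mat A *\<^sub>v y) \<bullet> x"
    by (rule comm_scalar_prod[of _ n]) (use assms in auto)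
  also have "\<dots> = y \<bullet> (A *\<^sub>v x)" by (rule transpose_vec_mult_scalar[OF assms])
  also have "\<dots> = (A *\<^sub>v x) \<bullet> y"
    by (rule comm_scalar_prod[of _ m]) (use assms in auto)
  finally show ?thesis .
qed

lemma symmetric_form_commute:
  fixes M :: "real mat"
  assumes "M \<in> carrier_mat n n" "transpose_mat M = M" "x \<in> carrier_vec n" "y \<in> carrier_vec n"
  shows "x \<bullet> (M *\<^sub>v y) = y \<bullet> (M *\<^sub>v x)"
proof -
  have "x \<bullet> (M *\<^sub>v y) = (M *\<^sub>v x) \<bullet> y"
    using transpose_vec_mult_scalar[OF assms(1,4,3)] unfolding assms(2) by (rule sym)
  also have "\<dots> = y \<bullet> (M *\<^sub>v x)"
    by (rule comm_scalar_prod[of _ n]) (use assms in auto)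
  finally show ?thesis .
qed

lemma quad_add:
  assumes M: "M \<in> carrier_mat n n" "transpose_mat M = M" and xy: "x \<in> carrier_vec n" "y \<in> carrier_vec n"
  shows "quad M (x + y) = quad M x + quad M y + 2 * (x \<bullet> (M *\<^sub>v y))"
proof -
  have c: "M *\<^sub>v x \<in> carrier_vec n" "M *\<^sub>v y \<in> carrier_vec n" using M xy by auto
  have "quad M (x + y) = (x + y) \<bullet> (M *\<^sub>v x + M *\<^sub>v y)"
    unfolding quad_def by (subst mult_add_distrib_mat_vec[OF M(1) xy]) (rule refl)
  also have "\<dots> = (x \<bullet> (M *\<^sub>v x) + x \<bullet> (M *\<^sub>v y)) + (y \<bullet> (M *\<^sub>v x) + y \<bullet> (M *\<^sub>v y))"
    unfolding add_scalar_prod_distrib[OF xy add_carrier_vec[OF c]]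
      scalar_prod_add_distrib[OF xy(1) c] scalar_prod_add_distrib[OF xy(2) c] by (rule refl)
  also have "y \<bullet> (M *\<^sub>v x) = x \<bullet> (M *\<^sub>v y)"
    by (rule symmetric_form_commute[OF M xy(2,1)])
  finally show ?thesis by (simp add: quad_def)
qed

lemma quad_uminus:
  "M \<in> carrier_mat n n \<Longrightarrow> x \<in> carrier_vec n \<Longrightarrow> quad M (- x) = quad M x"
  for M :: "real mat"
proof -
  assume a: "M \<in> carrier_mat n n" "x \<in> carrier_vec n"
  have "M *\<^sub>v (- x) = - (M *\<^sub>v x)"
    using a by (intro eq_vecI) auto
  with a show "quad M (- x) = quad M x"
    by (simp add: quad_def)
qed

lemma pos_definite_quad_nonneg:
  assumes "pos_definite n Q" "v \<in> carrier_vec n"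
  shows "0 \<le> quad Q v"
  using assms unfolding pos_definite_def quad_def by (cases "v = 0\<^sub>v n") (auto intro: less_imp_le)

text \<open>A vector in the kernel would have a vanishing quadratic form; hence the determinant is nonzero and
  \<open>mat_inv\<close> is a genuine inverse.\<close>

lemma pos_definite_mat_inv:
  assumes S: "pos_definite n S"
  shows "mat_inv S \<in> carrier_mat n n" "S * mat_inv S = 1\<^sub>m n"
proof -
  have C: "S \<in> carrier_mat n n" using S by (simp add: pos_definite_def)
  have "det S \<noteq> 0"
  proof
    assume "det S = 0"
    then obtain v where v: "v \<in> carrier_vec n" "v \<noteq> 0\<^sub>v n" "S *\<^sub>v v = 0\<^sub>v n"
      using det_0_iff_vec_prod_zero_field[OF C] by auto
    have "0 < v \<bullet> (S *\<^sub>v v)" using S v(1,2) unfolding pos_definite_def by blast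
    with v(1) show False unfolding v(3) by simp
  qed
  then have "S \<in> Units (ring_mat TYPE(real) n ())"
    by (rule det_non_zero_imp_unit[OF C])
  then obtain T where "mat_inverse S = Some T"
    using mat_inverse(1)[OF C, of "()"] by (cases "mat_inverse S") auto
  with mat_inverse(2)[OF C this]
  show "mat_inv S \<in> carrier_mat n n" "S * mat_inv S = 1\<^sub>m n"
    by (simp_all add: mat_inv_def)
qed

lemma smult_mat_mult_vec:
  fixes A :: "real mat"
  assumes "A \<in> carrier_mat m n" "x \<in> carrier_vec n"
  shows "(k \<cdot>\<^sub>m A) *\<^sub>v x = k \<cdot>\<^sub>v (A *\<^sub>v x)"
proof (rule eq_vecI)
  fix r assume "r < dim_vec (k \<cdot>\<^sub>v (A *\<^sub>v x))"
  then have r: "r < m" using assms by simp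
  have "((k \<cdot>\<^sub>m A) *\<^sub>v x) $ r = (\<Sum>c<n. (k \<cdot>\<^sub>m A) $$ (r, c) * x $ c)"
    by (rule mult_mat_vec_index_sum[of _ m]) (use assms r in auto)
  also have "\<dots> = k * (\<Sum>c<n. A $$ (r, c) * x $ c)"
    unfolding sum_distrib_left using assms r by (intro sum.cong) auto
  also have "\<dots> = (k \<cdot>\<^sub>v (A *\<^sub>v x)) $ r"
    using mult_mat_vec_index_sum[OF assms r] assms r by simp
  finally show "((k \<cdot>\<^sub>m A) *\<^sub>v x) $ r = (k \<cdot>\<^sub>v (A *\<^sub>v x)) $ r" .
qed (use assms in auto)

lemma mult_mat_uminus_vec:
  fixes A :: "real mat"
  assumes "A \<in> carrier_mat m n" "x \<in> carrier_vec n"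
  shows "A *\<^sub>v (- x) = - (A *\<^sub>v x)"
  using assms by (intro eq_vecI) auto

text \<open>One step of the backward recursion. The matrix \<open>M\<close> and the vector \<open>p\<close> describe the cost to go
  \<open>x'Mx + 2p'x\<close> at the next time, \<open>M'\<close> and \<open>p'\<close> the one at the present time, and \<open>d\<close> collects all that
  enters the dynamics besides state and control. The minimizer over \<open>u\<close> is
  \<open>F x + v\<close>. Since \<open>S Sn = 1\<close>, the forms \<open>y'S F x\<close> and \<open>y'S v\<close> are explicit for every \<open>y\<close> (facts
  \<open>SF\<close> and \<open>SV\<close>), and both sides become the same combination of a few scalar products.\<close>

lemma complete_square_step:
  fixes A B Q R K L M :: "real mat"
  assumes A: "A \<in> carrier_mat nx nx" and B: "B \<in> carrier_mat nx nu"
    and Q: "Q \<in> carrier_mat nx nx"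
    and R: "R \<in> carrier_mat nu nu"
    and K: "K \<in> carrier_mat ny nu" and L: "L \<in> carrier_mat ny nx"
    and M: "M \<in> carrier_mat nx nx" "transpose_mat M = M"
    and S: "S \<in> carrier_mat nu nu" "transpose_mat S = S"
      "S = R + \<beta> \<cdot>\<^sub>m (transpose_mat B * M * B)"
    and Sn: "Sn \<in> carrier_mat nu nu" "S * Sn = 1\<^sub>m nu"
    and F: "F = - \<beta> \<cdot>\<^sub>m (Sn * transpose_mat B * M * A)"
    and M': "M' = Q + \<beta> \<cdot>\<^sub>m (transpose_mat A * (M - \<beta> \<cdot>\<^sub>m (M * B * Sn * transpose_mat B * M)) * A)"
    and x: "x \<in> carrier_vec nx" and u: "u \<in> carrier_vec nu" and z: "z \<in> carrier_vec ny"
    and d: "d \<in> carrier_vec nx" and p: "p \<in> carrier_vec nx"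
    and q: "q = M *\<^sub>v d + p"
    and v: "v = - (Sn *\<^sub>v (transpose_mat K *\<^sub>v z + \<beta> \<cdot>\<^sub>v (transpose_mat B *\<^sub>v q)))"
    and p': "p' = (transpose_mat F * transpose_mat K + transpose_mat L) *\<^sub>v z
        + \<beta> \<cdot>\<^sub>v (transpose_mat (A + B * F) *\<^sub>v q)"
    and x': "x' = A *\<^sub>v x + B *\<^sub>v u + d"
  shows "quad Q x + quad R u + 2 * (z \<bullet> (K *\<^sub>v u + L *\<^sub>v x)) + \<beta> * (quad M x' + 2 * (p \<bullet> x'))
    = quad M' x + 2 * (p' \<bullet> x) + quad S (u - (F *\<^sub>v x + v))
      + (\<beta> * (quad M d + 2 * (p \<bullet> d)) - quad S v)"
proof -
  define a b f g where "a = A *\<^sub>v x" and "b = B *\<^sub>v u" and "f = F *\<^sub>v x" and "g = B *\<^sub>v f"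
  have Bt: "transpose_mat B \<in> carrier_mat nu nx" and At: "transpose_mat A \<in> carrier_mat nx nx"
    and Kt: "transpose_mat K \<in> carrier_mat nu ny" and Lt: "transpose_mat L \<in> carrier_mat nx ny"
    using A B K L by simp_all
  note SB = mult_carrier_mat[OF Sn(1) Bt]
  note SBM = mult_carrier_mat[OF SB M(1)]
  note SBMA = mult_carrier_mat[OF SBM A]
  have F_c: "F \<in> carrier_mat nu nx" unfolding F by (rule smult_carrier_mat[OF SBMA])
  have Ft: "transpose_mat F \<in> carrier_mat nx nu" using F_c by simp
  have ABF: "A + B * F \<in> carrier_mat nx nx" using A B F_c by simp
  have a: "a \<in> carrier_vec nx" using A x by (simp add: a_def)
  have b: "b \<in> carrier_vec nx" using B u by (simp add: b_def)
  have f: "f \<in> carrier_vec nu" using F_c x by (simp add: f_def)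
  have g: "g \<in> carrier_vec nx" using B f by (simp add: g_def)
  have Ma: "M *\<^sub>v a \<in> carrier_vec nx" and Md: "M *\<^sub>v d \<in> carrier_vec nx"
    using M(1) a d by simp_all
  have q_c: "q \<in> carrier_vec nx" using Md p q by simp
  define w where "w = transpose_mat B *\<^sub>v (M *\<^sub>v a)"
  have w: "w \<in> carrier_vec nu" using Bt Ma by (simp add: w_def)
  define k where "k = transpose_mat K *\<^sub>v z + \<beta> \<cdot>\<^sub>v (transpose_mat B *\<^sub>v q)"
  have Kz: "transpose_mat K *\<^sub>v z \<in> carrier_vec nu" and Bq: "transpose_mat B *\<^sub>v q \<in> carrier_vec nu"
    using Kt z Bt q_c by simp_all
  have k: "k \<in> carrier_vec nu" using Kz Bq by (simp add: k_def)
  have v_c: "v \<in> carrier_vec nu" using Sn(1) k by (simp add: v k_def[symmetric])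
  have SSn: "S *\<^sub>v (Sn *\<^sub>v y) = y" if "y \<in> carrier_vec nu" for y
    using assoc_mult_mat_vec[OF S(1) Sn(1) that] that unfolding Sn(2) by simp
  have f_eq: "f = - \<beta> \<cdot>\<^sub>v (Sn *\<^sub>v w)"
  proof -
    have "(Sn * transpose_mat B * M * A) *\<^sub>v x = Sn *\<^sub>v w"
      unfolding assoc_mult_mat_vec[OF SBM A x] a_def[symmetric] assoc_mult_mat_vec[OF SB M(1) a]
        assoc_mult_mat_vec[OF Sn(1) Bt Ma] w_def ..
    moreover have "f = - \<beta> \<cdot>\<^sub>v ((Sn * transpose_mat B * M * A) *\<^sub>v x)"
      unfolding f_def F by (rule smult_mat_mult_vec[OF SBMA x])
    ultimately show ?thesis by simp
  qed
  have SF: "y \<bullet> (S *\<^sub>v f) = - \<beta> * ((B *\<^sub>v y) \<bullet> (M *\<^sub>v a))" if y: "y \<in> carrier_vec nu" for y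
  proof -
    have "S *\<^sub>v f = - \<beta> \<cdot>\<^sub>v w"
      unfolding f_eq using mult_mat_vec[OF S(1), of "Sn *\<^sub>v w" "- \<beta>"] Sn(1) w SSn[OF w] by simp
    then show ?thesis
      using scalar_prod_transpose[OF B y Ma] y w by (simp add: w_def[symmetric])
  qed
  have SV: "y \<bullet> (S *\<^sub>v v) = - (z \<bullet> (K *\<^sub>v y) + \<beta> * ((B *\<^sub>v y) \<bullet> q))" if y: "y \<in> carrier_vec nu" for y
  proof -
    have "S *\<^sub>v v = - k"
      unfolding v k_def[symmetric] using mult_mat_uminus_vec[OF S(1), of "Sn *\<^sub>v k"] Sn(1) k SSn[OF k]
      by simp
    then have "y \<bullet> (S *\<^sub>v v) = - (y \<bullet> k)" using y k by simp
    also have "y \<bullet> k = y \<bullet> (transpose_mat K *\<^sub>v z) + \<beta> * (y \<bullet> (transpose_mat B *\<^sub>v q))"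
      unfolding k_def using y Kz Bq by (subst scalar_prod_add_distrib[of _ nu]) auto
    also have "y \<bullet> (transpose_mat K *\<^sub>v z) = (K *\<^sub>v y) \<bullet> z"
      by (rule scalar_prod_transpose[OF K y z])
    also have "\<dots> = z \<bullet> (K *\<^sub>v y)" using K y z by (intro comm_scalar_prod[of _ ny]) auto
    also have "y \<bullet> (transpose_mat B *\<^sub>v q) = (B *\<^sub>v y) \<bullet> q"
      by (rule scalar_prod_transpose[OF B y q_c])
    finally show ?thesis .
  qed
  have SU: "quad S u = quad R u + \<beta> * quad M b"
  proof -
    note BM = mult_carrier_mat[OF Bt M(1)]
    note BMB = mult_carrier_mat[OF BM B]
    have Mb: "M *\<^sub>v b \<in> carrier_vec nx" using M b by simp
    have "(transpose_mat B * M * B) *\<^sub>v u = transpose_mat B *\<^sub>v (M *\<^sub>v b)"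
      unfolding assoc_mult_mat_vec[OF BM B u] b_def[symmetric] assoc_mult_mat_vec[OF Bt M(1) b] ..
    then have "S *\<^sub>v u = R *\<^sub>v u + \<beta> \<cdot>\<^sub>v (transpose_mat B *\<^sub>v (M *\<^sub>v b))"
      unfolding S(3) using add_mult_distrib_mat_vec[OF R smult_carrier_mat[OF BMB] u]
        smult_mat_mult_vec[OF BMB u] by simp
    moreover have "u \<bullet> (transpose_mat B *\<^sub>v (M *\<^sub>v b)) = b \<bullet> (M *\<^sub>v b)"
      using scalar_prod_transpose[OF B u Mb] by (simp add: b_def)
    ultimately show ?thesis
      unfolding quad_def using scalar_prod_add_distrib[OF u, of "R *\<^sub>v u" "\<beta> \<cdot>\<^sub>v (transpose_mat B *\<^sub>v (M *\<^sub>v b))"]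
        R u Bt Mb by simp
  qed
  have g_eq: "g = - \<beta> \<cdot>\<^sub>v (B *\<^sub>v (Sn *\<^sub>v w))"
    unfolding g_def f_eq using mult_mat_vec[OF B, of "Sn *\<^sub>v w" "- \<beta>"] Sn(1) w by simp
  have Mg: "M *\<^sub>v g \<in> carrier_vec nx" using M g by simp
  have M'x: "quad M' x = quad Q x + \<beta> * (quad M a + g \<bullet> (M *\<^sub>v a))"
  proof -
    define P where "P = M * B * Sn * transpose_mat B * M"
    note MB = mult_carrier_mat[OF M(1) B]
    note MBS = mult_carrier_mat[OF MB Sn(1)]
    note MBSB = mult_carrier_mat[OF MBS Bt]
    have P: "P \<in> carrier_mat nx nx" unfolding P_def by (rule mult_carrier_mat[OF MBSB M(1)])
    have "P *\<^sub>v a = M *\<^sub>v (B *\<^sub>v (Sn *\<^sub>v w))"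
      unfolding P_def assoc_mult_mat_vec[OF MBSB M(1) a] assoc_mult_mat_vec[OF MBS Bt Ma]
        w_def[symmetric] assoc_mult_mat_vec[OF MB Sn(1) w]
      by (rule assoc_mult_mat_vec[OF M(1) B]) (use Sn(1) w in simp)
    then have "- \<beta> \<cdot>\<^sub>v (P *\<^sub>v a) = M *\<^sub>v g"
      unfolding g_eq using mult_mat_vec[OF M(1), of "B *\<^sub>v (Sn *\<^sub>v w)" "- \<beta>"] B Sn(1) w by simp
    moreover have neg: "- (\<beta> \<cdot>\<^sub>v (P *\<^sub>v a)) = - \<beta> \<cdot>\<^sub>v (P *\<^sub>v a)"
      by (intro eq_vecI) auto
    moreover have "(M - \<beta> \<cdot>\<^sub>m P) *\<^sub>v a = M *\<^sub>v a + - \<beta> \<cdot>\<^sub>v (P *\<^sub>v a)"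
      using minus_mult_distrib_mat_vec[OF M(1) smult_carrier_mat[OF P] a] smult_mat_mult_vec[OF P a] neg Ma P a
      by (simp add: minus_add_uminus_vec)
    ultimately have Pa: "(M - \<beta> \<cdot>\<^sub>m P) *\<^sub>v a = M *\<^sub>v a + M *\<^sub>v g" by simp
    have MP: "M - \<beta> \<cdot>\<^sub>m P \<in> carrier_mat nx nx" by (intro minus_carrier_mat smult_carrier_mat P)
    note AMP = mult_carrier_mat[OF At MP]
    note N = mult_carrier_mat[OF AMP A]
    have "(transpose_mat A * (M - \<beta> \<cdot>\<^sub>m P) * A) *\<^sub>v x = transpose_mat A *\<^sub>v ((M - \<beta> \<cdot>\<^sub>m P) *\<^sub>v a)"
      unfolding assoc_mult_mat_vec[OF AMP A x] a_def[symmetric] by (rule assoc_mult_mat_vec[OF At MP a])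
    then have "M' *\<^sub>v x = Q *\<^sub>v x + \<beta> \<cdot>\<^sub>v (transpose_mat A *\<^sub>v (M *\<^sub>v a + M *\<^sub>v g))"
      unfolding M' P_def[symmetric]
      using add_mult_distrib_mat_vec[OF Q smult_carrier_mat[OF N] x] smult_mat_mult_vec[OF N x] Pa by simp
    then have "quad M' x = quad Q x + \<beta> * (x \<bullet> (transpose_mat A *\<^sub>v (M *\<^sub>v a + M *\<^sub>v g)))"
      unfolding quad_def
      using scalar_prod_add_distrib[OF x, of "Q *\<^sub>v x" "\<beta> \<cdot>\<^sub>v (transpose_mat A *\<^sub>v (M *\<^sub>v a + M *\<^sub>v g))"]
        Q x At Ma Mg by simp
    also have "x \<bullet> (transpose_mat A *\<^sub>v (M *\<^sub>v a + M *\<^sub>v g)) = a \<bullet> (M *\<^sub>v a + M *\<^sub>v g)"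
      unfolding a_def by (rule scalar_prod_transpose[OF A x]) (use Ma Mg in \<open>simp add: a_def\<close>)
    also have "\<dots> = quad M a + a \<bullet> (M *\<^sub>v g)"
      using scalar_prod_add_distrib[OF a Ma Mg] by (simp add: quad_def)
    also have "a \<bullet> (M *\<^sub>v g) = g \<bullet> (M *\<^sub>v a)"
      by (rule symmetric_form_commute[OF M a g])
    finally show ?thesis .
  qed
  have Kf: "K *\<^sub>v f \<in> carrier_vec ny" and Lx: "L *\<^sub>v x \<in> carrier_vec ny" and Ku: "K *\<^sub>v u \<in> carrier_vec ny"
    using K L f x u by simp_all
  have p'x: "p' \<bullet> x = z \<bullet> (K *\<^sub>v f) + z \<bullet> (L *\<^sub>v x) + \<beta> * (a \<bullet> q + g \<bullet> q)"
  proof -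
    have p'_eq: "p' = (transpose_mat F *\<^sub>v (transpose_mat K *\<^sub>v z) + transpose_mat L *\<^sub>v z)
        + \<beta> \<cdot>\<^sub>v (transpose_mat (A + B * F) *\<^sub>v q)"
      unfolding p' using Ft Kt Lt z by (subst add_mult_distrib_mat_vec[of _ nx ny]) auto
    have c1: "transpose_mat F *\<^sub>v (transpose_mat K *\<^sub>v z) \<in> carrier_vec nx" using Ft Kz by simp
    have c2: "transpose_mat L *\<^sub>v z \<in> carrier_vec nx" using Lt z by simp
    have c3: "transpose_mat (A + B * F) *\<^sub>v q \<in> carrier_vec nx"
      using ABF q_c by (intro mult_mat_vec_carrier[of _ nx nx]) auto
    have p'c: "p' \<in> carrier_vec nx" unfolding p'_eq using c1 c2 c3 by simp
    have "p' \<bullet> x = x \<bullet> p'" by (rule comm_scalar_prod[OF p'c x])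
    also have "\<dots> = x \<bullet> (transpose_mat F *\<^sub>v (transpose_mat K *\<^sub>v z)) + x \<bullet> (transpose_mat L *\<^sub>v z)
        + \<beta> * (x \<bullet> (transpose_mat (A + B * F) *\<^sub>v q))"
      unfolding p'_eq using x c1 c2 c3 by (simp add: scalar_prod_add_distrib[of _ nx])
    also have "x \<bullet> (transpose_mat F *\<^sub>v (transpose_mat K *\<^sub>v z)) = f \<bullet> (transpose_mat K *\<^sub>v z)"
      unfolding f_def by (rule scalar_prod_transpose[OF F_c x Kz])
    also have "\<dots> = (K *\<^sub>v f) \<bullet> z" by (rule scalar_prod_transpose[OF K f z])
    also have "\<dots> = z \<bullet> (K *\<^sub>v f)" by (rule comm_scalar_prod[OF Kf z])
    also have "x \<bullet> (transpose_mat L *\<^sub>v z) = (L *\<^sub>v x) \<bullet> z" by (rule scalar_prod_transpose[OF L x z])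
    also have "\<dots> = z \<bullet> (L *\<^sub>v x)" by (rule comm_scalar_prod[OF Lx z])
    also have "x \<bullet> (transpose_mat (A + B * F) *\<^sub>v q) = ((A + B * F) *\<^sub>v x) \<bullet> q"
      by (rule scalar_prod_transpose[OF ABF x q_c])
    also have "(A + B * F) *\<^sub>v x = a + g"
      unfolding a_def g_def f_def using add_mult_distrib_mat_vec[OF A _ x, of "B * F"] B F_c x by simp
    also have "(a + g) \<bullet> q = a \<bullet> q + g \<bullet> q" by (rule add_scalar_prod_distrib[OF a g q_c])
    finally show ?thesis .
  qed
  have x'_eq: "x' = (a + b) + d" by (simp add: x' a_def b_def)
  have quad_x': "quad M x' = quad M a + quad M b + 2 * (b \<bullet> (M *\<^sub>v a)) + quad M d
      + 2 * (a \<bullet> (M *\<^sub>v d) + b \<bullet> (M *\<^sub>v d))"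
    unfolding x'_eq quad_add[OF M add_carrier_vec[OF a b] d] quad_add[OF M a b]
      add_scalar_prod_distrib[OF a b Md] symmetric_form_commute[OF M a b] by simp
  have p_x': "p \<bullet> x' = p \<bullet> a + p \<bullet> b + p \<bullet> d"
    unfolding x'_eq scalar_prod_add_distrib[OF p add_carrier_vec[OF a b] d] scalar_prod_add_distrib[OF p a b]
    by simp
  have q_dist: "y \<bullet> q = y \<bullet> (M *\<^sub>v d) + p \<bullet> y" if y: "y \<in> carrier_vec nx" for y
    unfolding q scalar_prod_add_distrib[OF y Md p] using comm_scalar_prod[OF y p] by simp
  have fv: "f + v \<in> carrier_vec nu" using f v_c by simp
  have "quad S (u - (f + v)) = quad S u + quad S (f + v) - 2 * (u \<bullet> (S *\<^sub>v (f + v)))"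
  proof -
    have "u - (f + v) = u + - (f + v)" using u fv by (simp add: minus_add_uminus_vec)
    moreover have "- (f + v) \<in> carrier_vec nu" using fv by simp
    moreover have "u \<bullet> - (S *\<^sub>v (f + v)) = - (u \<bullet> (S *\<^sub>v (f + v)))"
      by (rule scalar_prod_uminus_right) (use S(1) u in simp)
    ultimately show ?thesis
      using quad_add[OF S(1,2) u, of "- (f + v)"] quad_uminus[OF S(1) fv]
        mult_mat_uminus_vec[OF S(1) fv] by simp
  qed
  also have "S *\<^sub>v (f + v) = S *\<^sub>v f + S *\<^sub>v v"
    by (rule mult_add_distrib_mat_vec[OF S(1) f v_c])
  also have "u \<bullet> (S *\<^sub>v f + S *\<^sub>v v) = u \<bullet> (S *\<^sub>v f) + u \<bullet> (S *\<^sub>v v)"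
    using u S f v_c by (intro scalar_prod_add_distrib[of _ nu]) auto
  also have "quad S (f + v) = quad S f + quad S v + 2 * (f \<bullet> (S *\<^sub>v v))"
    by (rule quad_add[OF S(1,2) f v_c])
  finally have sq: "quad S (u - (f + v)) = quad S u + (quad S f + quad S v + 2 * (f \<bullet> (S *\<^sub>v v)))
      - 2 * (u \<bullet> (S *\<^sub>v f) + u \<bullet> (S *\<^sub>v v))" .
  have qSf: "quad S f = - \<beta> * (g \<bullet> (M *\<^sub>v a))"
    using SF[OF f] by (simp add: quad_def g_def)
  have z_dist: "z \<bullet> (K *\<^sub>v u + L *\<^sub>v x) = z \<bullet> (K *\<^sub>v u) + z \<bullet> (L *\<^sub>v x)"
    by (rule scalar_prod_add_distrib[OF z Ku Lx])
  show ?thesis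
    unfolding f_def[symmetric] sq M'x p'x quad_x' p_x' z_dist qSf SU SF[OF u] SV[OF u] SV[OF f]
      b_def[symmetric] g_def[symmetric] q_dist[OF a] q_dist[OF b] q_dist[OF g]
    by (simp add: algebra_simps)
qed

lemma mult_mat_zero_vec [simp]:
  fixes A :: "real mat"
  shows "A \<in> carrier_mat m n \<Longrightarrow> A *\<^sub>v 0\<^sub>v n = 0\<^sub>v m"
  by (intro eq_vecI) (auto simp: scalar_prod_def)

lemma quad_zero [simp]: "M \<in> carrier_mat n n \<Longrightarrow> quad M (0\<^sub>v n) = 0"
  by (simp add: quad_def)

text \<open>The completed square without exogenous input and at the minimizing control: \<open>M'\<close> is the form of
  the cost incurred by the feedback, which makes it nonnegative whenever \<open>M\<close> is.\<close>

lemma riccati_step_quad: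
  fixes A B Q R M :: "real mat"
  assumes A: "A \<in> carrier_mat nx nx" and B: "B \<in> carrier_mat nx nu"
    and Q: "Q \<in> carrier_mat nx nx"
    and R: "R \<in> carrier_mat nu nu"
    and M: "M \<in> carrier_mat nx nx" "transpose_mat M = M"
    and S: "S \<in> carrier_mat nu nu" "transpose_mat S = S"
      "S = R + \<beta> \<cdot>\<^sub>m (transpose_mat B * M * B)"
    and Sn: "Sn \<in> carrier_mat nu nu" "S * Sn = 1\<^sub>m nu"
    and F: "F = - \<beta> \<cdot>\<^sub>m (Sn * transpose_mat B * M * A)"
    and M': "M' = Q + \<beta> \<cdot>\<^sub>m (transpose_mat A * (M - \<beta> \<cdot>\<^sub>m (M * B * Sn * transpose_mat B * M)) * A)"
    and x: "x \<in> carrier_vec nx"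
  shows "quad M' x = quad Q x + quad R (F *\<^sub>v x) + \<beta> * quad M (A *\<^sub>v x + B *\<^sub>v (F *\<^sub>v x))"
proof -
  have Fc: "F \<in> carrier_mat nu nx"
    unfolding F using B
    by (intro smult_carrier_mat mult_carrier_mat[OF mult_carrier_mat[OF mult_carrier_mat[OF Sn(1) _] M(1)] A]) simp
  have u: "F *\<^sub>v x \<in> carrier_vec nu" using Fc x by simp
  \<comment> \<open>The exogenous sequence takes values in the space of dimension \<open>0\<close>.\<close>
  let ?K = "0\<^sub>m 0 nu :: real mat" and ?L = "0\<^sub>m 0 nx :: real mat" and ?z = "0\<^sub>v 0 :: real vec"
  define v where "v = - (Sn *\<^sub>v (transpose_mat ?K *\<^sub>v ?z + \<beta> \<cdot>\<^sub>v (transpose_mat B *\<^sub>v 0\<^sub>v nx)))"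
  define p' where "p' = (transpose_mat F * transpose_mat ?K + transpose_mat ?L) *\<^sub>v ?z
        + \<beta> \<cdot>\<^sub>v (transpose_mat (A + B * F) *\<^sub>v 0\<^sub>v nx)"
  have K0: "transpose_mat ?K *\<^sub>v ?z = 0\<^sub>v nu" by (intro eq_vecI) (auto simp: scalar_prod_def)
  have v0: "v = 0\<^sub>v nu"
  proof -
    have "transpose_mat B *\<^sub>v 0\<^sub>v nx = 0\<^sub>v nu" using B by (intro mult_mat_zero_vec) simp
    then have "transpose_mat ?K *\<^sub>v ?z + \<beta> \<cdot>\<^sub>v (transpose_mat B *\<^sub>v 0\<^sub>v nx) = 0\<^sub>v nu"
      unfolding K0 by (intro eq_vecI) auto
    then show ?thesis unfolding v_def using mult_mat_zero_vec[OF Sn(1)] by (intro eq_vecI) auto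
  qed
  have p0: "p' = 0\<^sub>v nx"
  proof -
    have "transpose_mat (A + B * F) *\<^sub>v 0\<^sub>v nx = 0\<^sub>v nx"
      using A B Fc by (intro mult_mat_zero_vec[of _ nx nx]) simp
    moreover have "(transpose_mat F * transpose_mat ?K + transpose_mat ?L) *\<^sub>v ?z = 0\<^sub>v nx"
      by (rule mult_mat_zero_vec) (use Fc in simp)
    ultimately show ?thesis unfolding p'_def by (intro eq_vecI) auto
  qed
  have q0: "(0\<^sub>v nx :: real vec) = M *\<^sub>v 0\<^sub>v nx + 0\<^sub>v nx"
    using mult_mat_zero_vec[OF M(1)] by simp
  have x': "A *\<^sub>v x + B *\<^sub>v (F *\<^sub>v x) = A *\<^sub>v x + B *\<^sub>v (F *\<^sub>v x) + 0\<^sub>v nx"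
    using A B Fc x by (intro eq_vecI) auto
  have Ax: "A *\<^sub>v x + B *\<^sub>v (F *\<^sub>v x) \<in> carrier_vec nx" using A B u x by simp
  have *: "quad Q x + quad R (F *\<^sub>v x) + 2 * (?z \<bullet> (?K *\<^sub>v (F *\<^sub>v x) + ?L *\<^sub>v x))
      + \<beta> * (quad M (A *\<^sub>v x + B *\<^sub>v (F *\<^sub>v x)) + 2 * (0\<^sub>v nx \<bullet> (A *\<^sub>v x + B *\<^sub>v (F *\<^sub>v x))))
    = quad M' x + 2 * (p' \<bullet> x) + quad S (F *\<^sub>v x - (F *\<^sub>v x + v))
      + (\<beta> * (quad M (0\<^sub>v nx) + 2 * (0\<^sub>v nx \<bullet> 0\<^sub>v nx)) - quad S v)"
    by (rule complete_square_step[OF A B Q R _ _ M S Sn F M' x u _ _ _ q0 v_def p'_def x']) auto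
  have "F *\<^sub>v x - (F *\<^sub>v x + v) = 0\<^sub>v nu" unfolding v0 using u by (intro eq_vecI) auto
  moreover have "?z \<bullet> (?K *\<^sub>v (F *\<^sub>v x) + ?L *\<^sub>v x) = 0" by (simp add: scalar_prod_def)
  ultimately show ?thesis
    using * quad_zero[OF S(1)] quad_zero[OF M(1)] Ax x unfolding p0 v0 by simp
qed

section \<open>Measurability of random vectors\<close>

lemma space_borel_vec [simp]: "space (borel_vec n) = carrier_vec n"
  by (simp add: borel_vec_def)

lemma measurable_borel_vec_iff:
  "f \<in> M \<rightarrow>\<^sub>M borel_vec n \<longleftrightarrow>
     (\<forall>x\<in>space M. f x \<in> carrier_vec n) \<and> (\<forall>r<n. (\<lambda>x. f x $ r) \<in> borel_measurable M)"
    (is "?L \<longleftrightarrow> ?R")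
proof
  let ?g = "\<lambda>v::real vec. \<lambda>r\<in>{..<n}. v $ r" and ?N = "\<Pi>\<^sub>M r\<in>{..<n}. (borel :: real measure)"
  assume f: ?L
  have g: "?g \<in> borel_vec n \<rightarrow>\<^sub>M ?N"
    unfolding borel_vec_def by (rule measurable_vimage_algebra1) (auto simp: space_PiM)
  have "(\<lambda>x. f x $ r) \<in> borel_measurable M" if r: "r < n" for r
  proof -
    have "(\<lambda>x. ?g (f x) r) \<in> borel_measurable M"
      by (rule measurable_compose[OF measurable_compose[OF f g]])
        (use r in \<open>auto intro: measurable_component_singleton\<close>)
    then show ?thesis using r by simp
  qed
  with measurable_space[OF f] show ?R by simp
next
  assume R: ?R
  then show ?L
    unfolding borel_vec_def
    by (intro measurable_vimage_algebra2 measurable_restrict) auto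
qed

lemma measurable_borel_vecI:
  "(\<And>x. x \<in> space M \<Longrightarrow> f x \<in> carrier_vec n) \<Longrightarrow>
   (\<And>r. r < n \<Longrightarrow> (\<lambda>x. f x $ r) \<in> borel_measurable M) \<Longrightarrow> f \<in> M \<rightarrow>\<^sub>M borel_vec n"
  by (simp add: measurable_borel_vec_iff)

lemma borel_vec_carrier: "f \<in> M \<rightarrow>\<^sub>M borel_vec n \<Longrightarrow> x \<in> space M \<Longrightarrow> f x \<in> carrier_vec n"
  by (simp add: measurable_borel_vec_iff)

lemma borel_vec_index: "f \<in> M \<rightarrow>\<^sub>M borel_vec n \<Longrightarrow> r < n \<Longrightarrow> (\<lambda>x. f x $ r) \<in> borel_measurable M"
  by (simp add: measurable_borel_vec_iff)

lemma borel_vec_add: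
  assumes f: "f \<in> M \<rightarrow>\<^sub>M borel_vec n" and g: "g \<in> M \<rightarrow>\<^sub>M borel_vec n"
  shows "(\<lambda>x. f x + g x) \<in> M \<rightarrow>\<^sub>M borel_vec n"
proof (rule measurable_borel_vecI)
  fix r assume r: "r < n"
  show "(\<lambda>x. (f x + g x) $ r) \<in> borel_measurable M"
    using borel_vec_index[OF f r] borel_vec_index[OF g r] r
    by (subst measurable_cong[where g = "\<lambda>x. f x $ r + g x $ r"])
      (auto simp: carrier_vecD[OF borel_vec_carrier[OF g]])
qed (use borel_vec_carrier[OF f] borel_vec_carrier[OF g] in auto)

lemma borel_vec_minus:
  assumes f: "f \<in> M \<rightarrow>\<^sub>M borel_vec n" and g: "g \<in> M \<rightarrow>\<^sub>M borel_vec n"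
  shows "(\<lambda>x. f x - g x) \<in> M \<rightarrow>\<^sub>M borel_vec n"
proof (rule measurable_borel_vecI)
  fix r assume r: "r < n"
  show "(\<lambda>x. (f x - g x) $ r) \<in> borel_measurable M"
    using borel_vec_index[OF f r] borel_vec_index[OF g r] r
    by (subst measurable_cong[where g = "\<lambda>x. f x $ r - g x $ r"])
      (auto simp: carrier_vecD[OF borel_vec_carrier[OF g]])
qed (use borel_vec_carrier[OF f] borel_vec_carrier[OF g] in auto)

lemma borel_vec_mult_mat:
  assumes A: "A \<in> carrier_mat m n" and f: "f \<in> M \<rightarrow>\<^sub>M borel_vec n"
  shows "(\<lambda>x. A *\<^sub>v f x) \<in> M \<rightarrow>\<^sub>M borel_vec m"
proof (rule measurable_borel_vecI)
  fix r assume r: "r < m"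
  show "(\<lambda>x. (A *\<^sub>v f x) $ r) \<in> borel_measurable M"
    by (subst measurable_cong[OF mult_mat_vec_index_sum[OF A borel_vec_carrier[OF f] r]])
      (auto intro!: borel_measurable_sum borel_measurable_times borel_vec_index[OF f])
qed (use A borel_vec_carrier[OF f] in auto)

lemma borel_vec_vec_sum:
  assumes f: "\<And>k. k \<in> S \<Longrightarrow> f k \<in> M \<rightarrow>\<^sub>M borel_vec n"
  shows "(\<lambda>x. vec_sum n (\<lambda>k. f k x) S) \<in> M \<rightarrow>\<^sub>M borel_vec n"
  by (rule measurable_borel_vecI) (auto intro!: borel_measurable_sum borel_vec_index[OF f])

lemma borel_vec_const: "c \<in> carrier_vec n \<Longrightarrow> (\<lambda>x. c) \<in> M \<rightarrow>\<^sub>M borel_vec n"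
  by (rule measurable_const) simp

lemma borel_vec_unstack:
  assumes f: "(\<lambda>x. stack_vec n (\<lambda>i. f i x)) \<in> M \<rightarrow>\<^sub>M borel_vec (\<Sum>i<n. d i)"
    and c: "\<And>i x. i < n \<Longrightarrow> x \<in> space M \<Longrightarrow> f i x \<in> carrier_vec (d i)" and i: "i < n"
  shows "f i \<in> M \<rightarrow>\<^sub>M borel_vec (d i)"
proof (rule measurable_borel_vecI)
  fix k assume k: "k < d i"
  obtain r where r: "r < (\<Sum>i<n. d i)"
    "\<And>v. (\<forall>i<n. v i \<in> carrier_vec (d i)) \<Longrightarrow> stack_vec n v $ r = v i $ k"
    using stack_vec_index_surj[of i n k d, OF i k] by blast
  have "f i x $ k = stack_vec n (\<lambda>i. f i x) $ r" if "x \<in> space M" for x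
    using r(2)[of "\<lambda>i. f i x"] c that by auto
  then show "(\<lambda>x. f i x $ k) \<in> borel_measurable M"
    by (subst measurable_cong) (auto intro: borel_vec_index[OF f r(1)])
qed (use c i in auto)

lemma borel_measurable_scalar_prod:
  assumes f: "f \<in> M \<rightarrow>\<^sub>M borel_vec n" and g: "g \<in> M \<rightarrow>\<^sub>M borel_vec n"
  shows "(\<lambda>x. f x \<bullet> g x) \<in> borel_measurable M"
proof -
  have "f x \<bullet> g x = (\<Sum>r<n. f x $ r * g x $ r)" if "x \<in> space M" for x
    using borel_vec_carrier[OF g that] by (simp add: scalar_prod_def lessThan_atLeast0)
  then show ?thesis
    by (subst measurable_cong)
      (auto intro!: borel_measurable_sum borel_measurable_times borel_vec_index[OF f] borel_vec_index[OF g])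
qed

lemma borel_measurable_quad:
  "Q \<in> carrier_mat n n \<Longrightarrow> f \<in> M \<rightarrow>\<^sub>M borel_vec n \<Longrightarrow> (\<lambda>x. quad Q (f x)) \<in> borel_measurable M"
  unfolding quad_def by (intro borel_measurable_scalar_prod borel_vec_mult_mat)

section \<open>Square integrable random vectors\<close>

definition L2_rv :: "'a measure \<Rightarrow> ('a \<Rightarrow> real) \<Rightarrow> bool" where
  "L2_rv M f \<longleftrightarrow> f \<in> borel_measurable M \<and> integrable M (\<lambda>x. (f x)\<^sup>2)"

lemma L2_rv_mult_integrable:
  assumes f: "L2_rv M f" and g: "L2_rv M g"
  shows "integrable M (\<lambda>x. f x * g x)"
proof (rule Bochner_Integration.integrable_bound)
  show "integrable M (\<lambda>x. (f x)\<^sup>2 + (g x)\<^sup>2)"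
    using f g by (simp add: L2_rv_def)
  show "(\<lambda>x. f x * g x) \<in> borel_measurable M"
    using f g unfolding L2_rv_def by (intro borel_measurable_times) auto
  have "\<bar>a * b\<bar> \<le> a\<^sup>2 + b\<^sup>2" for a b :: real
  proof -
    have "2 * \<bar>a * b\<bar> \<le> a\<^sup>2 + b\<^sup>2"
      using sum_squares_bound[of "\<bar>a\<bar>" "\<bar>b\<bar>"] by (simp add: abs_mult mult.assoc)
    with abs_ge_zero[of "a * b"] show ?thesis by linarith
  qed
  then show "AE x in M. norm (f x * g x) \<le> norm ((f x)\<^sup>2 + (g x)\<^sup>2)"
    by (intro AE_I2) (simp add: abs_of_nonneg)
qed

lemma L2_rv_add:
  assumes f: "L2_rv M f" and g: "L2_rv M g"
  shows "L2_rv M (\<lambda>x. f x + g x)"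
proof -
  have "(f x + g x)\<^sup>2 = (f x)\<^sup>2 + (g x)\<^sup>2 + 2 * (f x * g x)" for x
    by (simp add: power2_eq_square algebra_simps)
  then show ?thesis
    using f g L2_rv_mult_integrable[OF f g] by (auto simp: L2_rv_def intro!: borel_measurable_add)
qed

lemma L2_rv_cmult: "L2_rv M f \<Longrightarrow> L2_rv M (\<lambda>x. c * f x)"
  by (auto simp: L2_rv_def power_mult_distrib intro!: borel_measurable_times)

lemma (in finite_measure) L2_rv_const: "L2_rv M (\<lambda>x. c)"
  by (simp add: L2_rv_def)

lemma (in finite_measure) L2_rv_sum: "(\<And>k. k \<in> S \<Longrightarrow> L2_rv M (f k)) \<Longrightarrow> L2_rv M (\<lambda>x. \<Sum>k\<in>S. f k x)"
  by (induction S rule: infinite_finite_induct) (auto intro: L2_rv_add L2_rv_const)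

lemma (in finite_measure) L2_rv_integrable: "L2_rv M f \<Longrightarrow> integrable M f"
  using L2_rv_mult_integrable[of M f "\<lambda>x. 1"] L2_rv_const[of 1] by simp

lemma L2_rv_cong_AE:
  assumes "AE x in M. f x = g x" "g \<in> borel_measurable M" "L2_rv M f"
  shows "L2_rv M g"
proof -
  have "integrable M (\<lambda>x. (g x)\<^sup>2)"
    by (rule integrable_cong_AE_imp[of M "\<lambda>x. (f x)\<^sup>2"])
      (use assms in \<open>auto simp: L2_rv_def elim!: eventually_mono\<close>)
  with assms(2) show ?thesis by (simp add: L2_rv_def)
qed

definition L2_vec :: "'a measure \<Rightarrow> nat \<Rightarrow> ('a \<Rightarrow> real vec) \<Rightarrow> bool" where
  "L2_vec M n X \<longleftrightarrow> (\<forall>x\<in>space M. X x \<in> carrier_vec n) \<and> (\<forall>r<n. L2_rv M (\<lambda>x. X x $ r))"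

lemma L2_vec_iff: "L2_vec M n X \<longleftrightarrow> X \<in> M \<rightarrow>\<^sub>M borel_vec n \<and> finite_second_moment M n X"
  by (auto simp: L2_vec_def L2_rv_def measurable_borel_vec_iff finite_second_moment_def)

lemma L2_vec_measurable: "L2_vec M n X \<Longrightarrow> X \<in> M \<rightarrow>\<^sub>M borel_vec n"
  by (simp add: L2_vec_iff)

lemma L2_vec_carrier: "L2_vec M n X \<Longrightarrow> x \<in> space M \<Longrightarrow> X x \<in> carrier_vec n"
  by (simp add: L2_vec_def)

lemma L2_vec_index: "L2_vec M n X \<Longrightarrow> r < n \<Longrightarrow> L2_rv M (\<lambda>x. X x $ r)"
  by (simp add: L2_vec_def)

lemma L2_rv_cong: "(\<And>x. x \<in> space M \<Longrightarrow> f x = g x) \<Longrightarrow> L2_rv M f \<longleftrightarrow> L2_rv M g"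
  unfolding L2_rv_def
  by (intro conj_cong measurable_cong Bochner_Integration.integrable_cong refl) auto

lemma L2_vec_cong:
  assumes eq: "\<And>x. x \<in> space M \<Longrightarrow> X x = Y x"
  shows "L2_vec M n X \<longleftrightarrow> L2_vec M n Y"
proof -
  have "L2_rv M (\<lambda>x. X x $ r) = L2_rv M (\<lambda>x. Y x $ r)" for r
    by (rule L2_rv_cong) (simp add: eq)
  with eq show ?thesis by (simp add: L2_vec_def)
qed

lemma L2_vec_cong_AE:
  assumes ae: "AE x in M. X x = Y x" and Y: "Y \<in> M \<rightarrow>\<^sub>M borel_vec n" and X: "L2_vec M n X"
  shows "L2_vec M n Y"
  unfolding L2_vec_def
proof (intro conjI allI impI ballI)
  fix r assume r: "r < n"
  show "L2_rv M (\<lambda>x. Y x $ r)"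
    by (rule L2_rv_cong_AE[OF _ borel_vec_index[OF Y r] L2_vec_index[OF X r]]) (use ae in auto)
qed (rule borel_vec_carrier[OF Y])

lemma L2_vec_add: "L2_vec M n X \<Longrightarrow> L2_vec M n Y \<Longrightarrow> L2_vec M n (\<lambda>x. X x + Y x)"
  unfolding L2_vec_def
proof (intro conjI allI impI ballI)
  assume X: "(\<forall>x\<in>space M. X x \<in> carrier_vec n) \<and> (\<forall>r<n. L2_rv M (\<lambda>x. X x $ r))"
    and Y: "(\<forall>x\<in>space M. Y x \<in> carrier_vec n) \<and> (\<forall>r<n. L2_rv M (\<lambda>x. Y x $ r))"
  fix r assume r: "r < n"
  have "L2_rv M (\<lambda>x. X x $ r + Y x $ r)" using X Y r by (intro L2_rv_add) auto
  moreover have "(X x + Y x) $ r = X x $ r + Y x $ r" if "x \<in> space M" for x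
    using Y that r by auto
  ultimately show "L2_rv M (\<lambda>x. (X x + Y x) $ r)" by (simp cong: L2_rv_cong)
qed auto

context finite_measure
begin

lemma L2_vec_const: "c \<in> carrier_vec n \<Longrightarrow> L2_vec M n (\<lambda>x. c)"
  by (simp add: L2_vec_def L2_rv_const)

lemma L2_vec_sum: "(\<And>k. k \<in> S \<Longrightarrow> L2_vec M n (f k)) \<Longrightarrow> L2_vec M n (\<lambda>x. vec_sum n (\<lambda>k. f k x) S)"
  unfolding L2_vec_def by (auto intro!: L2_rv_sum)

lemma L2_vec_mult_mat:
  assumes A: "A \<in> carrier_mat m n" and X: "L2_vec M n X"
  shows "L2_vec M m (\<lambda>x. A *\<^sub>v X x)"
  unfolding L2_vec_def
proof (intro conjI allI impI ballI)
  fix r assume r: "r < m"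
  have "L2_rv M (\<lambda>x. \<Sum>c<n. A $$ (r, c) * X x $ c)"
    using L2_vec_index[OF X] by (intro L2_rv_sum L2_rv_cmult) auto
  then show "L2_rv M (\<lambda>x. (A *\<^sub>v X x) $ r)"
    by (subst L2_rv_cong[OF mult_mat_vec_index_sum[OF A L2_vec_carrier[OF X] r]])
qed (use A L2_vec_carrier[OF X] in auto)

lemma L2_vec_smult: "L2_vec M n X \<Longrightarrow> L2_vec M n (\<lambda>x. c \<cdot>\<^sub>v X x)"
  unfolding L2_vec_def
proof (intro conjI allI impI ballI)
  assume X: "(\<forall>x\<in>space M. X x \<in> carrier_vec n) \<and> (\<forall>r<n. L2_rv M (\<lambda>x. X x $ r))"
  fix r assume r: "r < n"
  have "L2_rv M (\<lambda>x. c * X x $ r)" using X r by (intro L2_rv_cmult) auto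
  moreover have "(c \<cdot>\<^sub>v X x) $ r = c * X x $ r" if "x \<in> space M" for x
    using X that r by auto
  ultimately show "L2_rv M (\<lambda>x. (c \<cdot>\<^sub>v X x) $ r)" by (simp cong: L2_rv_cong)
qed auto

lemma L2_vec_uminus: "L2_vec M n X \<Longrightarrow> L2_vec M n (\<lambda>x. - X x)"
proof -
  assume X: "L2_vec M n X"
  have "- v = (-1) \<cdot>\<^sub>v v" for v :: "real vec" by (intro eq_vecI) auto
  then show ?thesis using L2_vec_smult[OF X, of "-1"] by simp
qed

lemma L2_vec_minus:
  assumes X: "L2_vec M n X" and Y: "L2_vec M n Y"
  shows "L2_vec M n (\<lambda>x. X x - Y x)"
proof -
  have "L2_vec M n (\<lambda>x. X x + - Y x)" by (intro L2_vec_add L2_vec_uminus X Y)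
  moreover have "X x + - Y x = X x - Y x" if "x \<in> space M" for x
    using L2_vec_carrier[OF X that] L2_vec_carrier[OF Y that] by auto
  ultimately show ?thesis by (simp cong: L2_vec_cong)
qed

lemma L2_vec_scalar_prod:
  assumes X: "L2_vec M n X" and Y: "L2_vec M n Y"
  shows "integrable M (\<lambda>x. X x \<bullet> Y x)"
proof -
  have "X x \<bullet> Y x = (\<Sum>r<n. X x $ r * Y x $ r)" if "x \<in> space M" for x
    using L2_vec_carrier[OF Y that] by (simp add: scalar_prod_def lessThan_atLeast0)
  moreover have "integrable M (\<lambda>x. \<Sum>r<n. X x $ r * Y x $ r)"
    by (intro Bochner_Integration.integrable_sum L2_rv_mult_integrable L2_vec_index[OF X] L2_vec_index[OF Y]) auto
  ultimately show ?thesis by (simp cong: Bochner_Integration.integrable_cong)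
qed

lemma L2_vec_quad: "Q \<in> carrier_mat n n \<Longrightarrow> L2_vec M n X \<Longrightarrow> integrable M (\<lambda>x. quad Q (X x))"
  unfolding quad_def by (intro L2_vec_scalar_prod[of n] L2_vec_mult_mat)

end

lemma L2_vec_unstack:
  assumes f: "L2_vec M (\<Sum>i<n. d i) (\<lambda>x. stack_vec n (\<lambda>i. f i x))"
    and c: "\<And>i x. i < n \<Longrightarrow> x \<in> space M \<Longrightarrow> f i x \<in> carrier_vec (d i)" and i: "i < n"
  shows "L2_vec M (d i) (f i)"
  unfolding L2_vec_def
proof (intro conjI allI impI ballI)
  fix k assume k: "k < d i"
  obtain r where r: "r < (\<Sum>i<n. d i)"
    "\<And>v. (\<forall>i<n. v i \<in> carrier_vec (d i)) \<Longrightarrow> stack_vec n v $ r = v i $ k"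
    using stack_vec_index_surj[of i n k d, OF i k] by blast
  have "stack_vec n (\<lambda>i. f i x) $ r = f i x $ k" if "x \<in> space M" for x
    using r(2)[of "\<lambda>i. f i x"] c that by auto
  then show "L2_rv M (\<lambda>x. f i x $ k)"
    using L2_vec_index[OF f r(1)] by (simp cong: L2_rv_cong)
qed (use c i in auto)

section \<open>Factorization, independence and projection\<close>

text \<open>Preimages under \<open>Y\<close> make up the whole \<open>\<sigma>\<close>-algebra, so the level sets of a simple function, and with
  them the function, factor through \<open>Y\<close>. For general \<open>f\<close> the factors of an approximating sequence
  converge on the range of \<open>Y\<close>; elsewhere \<open>lim\<close> supplies some measurable value.\<close>

lemma Doob_Dynkin_real:
  fixes f :: "'a \<Rightarrow> real"
  assumes f: "f \<in> borel_measurable (vimage_algebra X Y N)" and Y: "Y \<in> X \<rightarrow> space N"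
  shows "\<exists>h\<in>borel_measurable N. \<forall>x\<in>X. f x = h (Y x)"
proof -
  let ?V = "vimage_algebra X Y N"
  obtain F where F: "\<And>i. simple_function ?V (F i)" "\<And>x. x \<in> X \<Longrightarrow> (\<lambda>i. F i x) \<longlonglongrightarrow> f x"
    using borel_measurable_implies_sequence_metric[OF f, of 0] by auto
  have "\<exists>g\<in>borel_measurable N. \<forall>x\<in>X. F i x = g (Y x)" for i
  proof -
    have fin: "finite (F i ` X)" using simple_functionD(1)[OF F(1)] by simp
    have "\<exists>A\<in>sets N. F i -` {a} \<inter> X = Y -` A \<inter> X" for a
      using simple_functionD(2)[OF F(1), of i "{a}"] unfolding sets_vimage_algebra2[OF Y] by auto
    then obtain A where A: "\<And>a. A a \<in> sets N" "\<And>a. F i -` {a} \<inter> X = Y -` A a \<inter> X"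
      by metis
    define g where "g y = (\<Sum>a\<in>F i ` X. a * indicator (A a) y)" for y
    have "g \<in> borel_measurable N"
      unfolding g_def using A(1) by measurable
    moreover have "F i x = g (Y x)" if x: "x \<in> X" for x
    proof -
      have "indicator (A a) (Y x) = (if a = F i x then 1 else 0 :: real)" for a
        using A(2)[of a] x by (auto simp: indicator_def)
      then have "g (Y x) = (\<Sum>a\<in>F i ` X. if a = F i x then a else 0)"
        unfolding g_def by (intro sum.cong) auto
      then show ?thesis using fin x by simp
    qed
    ultimately show ?thesis by blast
  qed
  then obtain g where g: "\<And>i. g i \<in> borel_measurable N" "\<And>i x. x \<in> X \<Longrightarrow> F i x = g i (Y x)"
    by metis
  define h where "h y = lim (\<lambda>i. g i y)" for y
  have "h \<in> borel_measurable N"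
    unfolding h_def by (rule borel_measurable_lim_metric) (rule g(1))
  moreover have "f x = h (Y x)" if "x \<in> X" for x
    using limI[OF F(2)[OF that]] g(2)[OF that] by (simp add: h_def)
  ultimately show ?thesis by blast
qed

lemma Doob_Dynkin_vec:
  assumes f: "f \<in> vimage_algebra X Y N \<rightarrow>\<^sub>M borel_vec n" and Y: "Y \<in> X \<rightarrow> space N"
  shows "\<exists>h\<in>N \<rightarrow>\<^sub>M borel_vec n. \<forall>x\<in>X. f x = h (Y x)"
proof -
  have "\<exists>g\<in>borel_measurable N. \<forall>x\<in>X. f x $ r = g (Y x)" if "r < n" for r
    by (rule Doob_Dynkin_real[OF borel_vec_index[OF f that] Y])
  then obtain g where g: "\<And>r. r < n \<Longrightarrow> g r \<in> borel_measurable N"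
    "\<And>r x. r < n \<Longrightarrow> x \<in> X \<Longrightarrow> f x $ r = g r (Y x)"
    by metis
  have "(\<lambda>y. vec n (\<lambda>r. g r y)) \<in> N \<rightarrow>\<^sub>M borel_vec n"
    by (rule measurable_borel_vecI) (simp_all add: g(1))
  moreover have "f x = vec n (\<lambda>r. g r (Y x))" if "x \<in> X" for x
    using g(2)[OF _ that] carrier_vecD[OF borel_vec_carrier[OF f, of x]] that by (intro eq_vecI) simp_all
  ultimately show ?thesis by (intro bexI[of _ "\<lambda>y. vec n (\<lambda>r. g r y)"]) simp_all
qed

text \<open>By factorization \<open>f\<close> is a function of the other variables, and independence of
  two disjoint groups of variables applies.\<close>

lemma (in prob_space) expectation_mult_indep_rest:
  fixes f :: "'a \<Rightarrow> real"
  assumes ind: "indep_vars N V I" and p: "p \<in> I"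
    and f: "f \<in> borel_measurable (vimage_algebra (space M) (\<lambda>\<omega>. \<lambda>q\<in>I - {p}. V q \<omega>) (PiM (I - {p}) N))"
    and f_int: "integrable M f"
    and \<phi>: "\<phi> \<in> borel_measurable (N p)" and \<phi>_int: "integrable M (\<lambda>\<omega>. \<phi> (V p \<omega>))"
  shows "(\<integral>\<omega>. f \<omega> * \<phi> (V p \<omega>) \<partial>M) = (\<integral>\<omega>. f \<omega> \<partial>M) * (\<integral>\<omega>. \<phi> (V p \<omega>) \<partial>M)"
proof -
  let ?Y = "\<lambda>\<omega>. \<lambda>q\<in>I - {p}. V q \<omega>"
  have rv: "V q \<in> M \<rightarrow>\<^sub>M N q" if "q \<in> I" for q
    using ind that by (simp add: indep_vars_def2)
  have Y: "?Y \<in> space M \<rightarrow> space (PiM (I - {p}) N)"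
    using measurable_space[OF rv] by (auto simp: space_PiM)
  obtain h where h: "h \<in> borel_measurable (PiM (I - {p}) N)" "\<And>\<omega>. \<omega> \<in> space M \<Longrightarrow> f \<omega> = h (?Y \<omega>)"
    using Doob_Dynkin_real[OF f Y] by blast
  have "indep_var (PiM (I - {p}) N) ?Y (PiM {p} N) (\<lambda>\<omega>. \<lambda>q\<in>{p}. V q \<omega>)"
    by (rule indep_var_restrict[OF ind]) (use p in auto)
  then have "indep_var borel (h \<circ> ?Y) borel ((\<lambda>y. \<phi> (y p)) \<circ> (\<lambda>\<omega>. \<lambda>q\<in>{p}. V q \<omega>))"
    by (rule indep_var_compose)
      (use h \<phi> in \<open>auto intro!: measurable_compose[OF measurable_component_singleton]\<close>)
  then have iv: "indep_var borel (\<lambda>\<omega>. h (?Y \<omega>)) borel (\<lambda>\<omega>. \<phi> (V p \<omega>))"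
    by (simp add: comp_def)
  have "integrable M (\<lambda>\<omega>. h (?Y \<omega>))"
    using f_int h(2) by (simp cong: Bochner_Integration.integrable_cong)
  from indep_var_lebesgue_integral[OF iv this \<phi>_int] show ?thesis
    using h(2) by (simp cong: Bochner_Integration.integral_cong)
qed

lemma integrable_bounded_mult:
  fixes f g :: "'a \<Rightarrow> real"
  assumes "integrable M f" "g \<in> borel_measurable M" "\<And>x. x \<in> space M \<Longrightarrow> \<bar>g x\<bar> \<le> B"
  shows "integrable M (\<lambda>x. g x * f x)"
proof (rule Bochner_Integration.integrable_bound)
  show "integrable M (\<lambda>x. B * f x)" using assms(1) by simp
  show "(\<lambda>x. g x * f x) \<in> borel_measurable M"
    using assms(1,2) by (intro borel_measurable_times) auto
  show "AE x in M. norm (g x * f x) \<le> norm (B * f x)"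
  proof (rule AE_I2)
    fix x assume "x \<in> space M"
    then have "\<bar>g x\<bar> * \<bar>f x\<bar> \<le> \<bar>B\<bar> * \<bar>f x\<bar>"
      by (intro mult_right_mono order_trans[OF assms(3) abs_ge_self]) auto
    then show "norm (g x * f x) \<le> norm (B * f x)" by (simp add: abs_mult)
  qed
qed

text \<open>Pointwise in \<open>[0, \<infinity>]\<close> the sum of \<open>(h + N)\<^sup>+\<close> and \<open>h\<^sup>-\<close> equals the sum of \<open>(h + N)\<^sup>-\<close>, \<open>h\<^sup>+\<close> and
  \<open>N\<close>. After integration all terms but those of \<open>(h + N)\<^sup>+\<close> and \<open>N\<close> are known to be finite, so the balance
  can be solved for the difference even when the integral of \<open>N\<close> is infinite.\<close>

lemma ext_expectation_add_nonneg:
  assumes h: "integrable M h" and N: "N \<in> borel_measurable M"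
    and f: "\<And>x. x \<in> space M \<Longrightarrow> f x = ereal (h x) + enn2ereal (N x)"
  shows "ext_expectation M f = ereal (\<integral>x. h x \<partial>M) + enn2ereal (\<integral>\<^sup>+x. N x \<partial>M)"
proof -
  note [measurable] = N
  have hm [measurable]: "h \<in> borel_measurable M" using h by simp
  define f' where "f' x = ereal (h x) + enn2ereal (N x)" for x
  have [measurable]: "f' \<in> borel_measurable M" unfolding f'_def by measurable
  define a b c d n where "a = (\<integral>\<^sup>+x. e2ennreal (f' x) \<partial>M)" and "b = (\<integral>\<^sup>+x. ennreal (- h x) \<partial>M)"
    and "c = (\<integral>\<^sup>+x. e2ennreal (- f' x) \<partial>M)" and "d = (\<integral>\<^sup>+x. ennreal (h x) \<partial>M)"
    and "n = (\<integral>\<^sup>+x. N x \<partial>M)"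
  have ext: "ext_expectation M f = enn2ereal a - enn2ereal c"
    unfolding ext_expectation_def a_def c_def f'_def
    using f by (simp cong: nn_integral_cong)
  have pt: "e2ennreal (f' x) + ennreal (- h x) = e2ennreal (- f' x) + ennreal (h x) + N x" for x
  proof (cases "N x")
    case (real r)
    then have "f' x = ereal (h x + r)" by (simp add: f'_def)
    then have *: "e2ennreal (f' x) = ennreal (h x + r)" "e2ennreal (- f' x) = ennreal (- (h x + r))"
      by (simp_all add: ennreal.abs_eq e2ennreal_ereal)
    show ?thesis
    proof (cases "h x \<ge> 0")
      case True
      then show ?thesis using real unfolding * by (simp add: ennreal_neg ennreal_plus)
    next
      case neg: False
      show ?thesis
      proof (cases "h x + r \<ge> 0")
        case True
        then show ?thesis using real neg unfolding *
          by (simp add: ennreal_neg flip: ennreal_plus)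
      next
        case False
        then show ?thesis using real neg unfolding *
          by (simp add: ennreal_neg flip: ennreal_plus)
      qed
    qed
  next
    case top
    then show ?thesis by (simp add: f'_def)
  qed
  have "a + b = (\<integral>\<^sup>+x. e2ennreal (f' x) + ennreal (- h x) \<partial>M)"
    unfolding a_def b_def by (rule nn_integral_add[symmetric]) measurable
  also have "\<dots> = (\<integral>\<^sup>+x. e2ennreal (- f' x) + ennreal (h x) + N x \<partial>M)"
    by (simp add: pt)
  also have "\<dots> = c + d + n"
    unfolding c_def d_def n_def by (subst nn_integral_add, measurable, subst nn_integral_add, measurable)
  finally have bal: "a + b = c + d + n" .
  have fin: "b < \<infinity>" "d < \<infinity>"
    using h unfolding b_def d_def by (auto elim!: integrableE simp: less_top)
  have "c \<le> b"
    unfolding c_def b_def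
  proof (rule nn_integral_mono)
    fix x
    have "- f' x \<le> ereal (- h x)"
      unfolding f'_def by (cases "N x") auto
    then have "e2ennreal (- f' x) \<le> e2ennreal (ereal (- h x))" by (rule e2ennreal_mono)
    then show "e2ennreal (- f' x) \<le> ennreal (- h x)" by (simp add: ennreal.abs_eq e2ennreal_ereal)
  qed
  with fin have c: "c < \<infinity>" by auto
  have int: "(\<integral>x. h x \<partial>M) = enn2real d - enn2real b"
    unfolding d_def b_def by (rule real_lebesgue_integral_def[OF h])
  obtain b' where b': "b = ennreal b'" "b' \<ge> 0" using fin(1) by (cases b) auto
  obtain d' where d': "d = ennreal d'" "d' \<ge> 0" using fin(2) by (cases d) auto
  obtain c' where c': "c = ennreal c'" "c' \<ge> 0" using c by (cases c) auto
  have "enn2ereal a - enn2ereal c = ereal (d' - b') + enn2ereal n"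
  proof (cases n)
    case (real n')
    then have "a \<noteq> \<infinity>" using bal b' d' c' by (auto simp flip: ennreal_plus)
    then obtain a' where a': "a = ennreal a'" "a' \<ge> 0" by (cases a) auto
    have "ennreal (a' + b') = ennreal (c' + d' + n')"
      using bal a' b' c' d' real by (simp add: ennreal_plus)
    then have "a' + b' = c' + d' + n'"
      using a' b' c' d' real by (subst (asm) ennreal_inj) auto
    then show ?thesis using a' c' real by (simp add: enn2ereal_ennreal)
  next
    case top
    then have "a = \<infinity>" using bal b' by (auto simp: ennreal_add_eq_top)
    then show ?thesis using top c' by (simp add: enn2ereal_ennreal)
  qed
  then show ?thesis
    using ext int b' d' by (simp add: n_def)
qed

lemma ennreal_integral_le_nn_integral:
  assumes "integrable M k"
  shows "ennreal (\<integral>x. k x \<partial>M) \<le> (\<integral>\<^sup>+x. ennreal (k x) \<partial>M)"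
proof -
  have fin: "(\<integral>\<^sup>+x. ennreal (k x) \<partial>M) < \<infinity>"
    using assms by (auto elim!: integrableE simp: less_top)
  have "(\<integral>x. k x \<partial>M) \<le> enn2real (\<integral>\<^sup>+x. ennreal (k x) \<partial>M)"
    unfolding real_lebesgue_integral_def[OF assms] by simp
  then have "ennreal (\<integral>x. k x \<partial>M) \<le> ennreal (enn2real (\<integral>\<^sup>+x. ennreal (k x) \<partial>M))"
    by (rule ennreal_leI)
  also have "\<dots> = (\<integral>\<^sup>+x. ennreal (k x) \<partial>M)" using fin by simp
  finally show ?thesis .
qed

text \<open>If \<open>e\<close> is orthogonal to all bounded functions of \<open>\<pi>\<close>, adding a function of \<open>\<pi>\<close> cannot lower the
  expectation of the quadratic form. Integrability of \<open>h \<circ> \<pi>\<close> is circumvented by a truncation: on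
  the event that its components are at most \<open>n\<close>, the square is expanded and the cross term has mean
  zero; off that event the form is at least \<open>0\<close>. Then \<open>n\<close> tends to infinity.\<close>

lemma (in prob_space) quad_least_at_projection:
  assumes S: "S \<in> carrier_mat m m" "transpose_mat S = S" and psd: "\<And>v. v \<in> carrier_vec m \<Longrightarrow> 0 \<le> quad S v"
    and \<pi>: "\<pi> \<in> M \<rightarrow>\<^sub>M N" and h: "h \<in> N \<rightarrow>\<^sub>M borel_vec m" and e: "L2_vec M m e"
    and orth: "\<And>g B c. g \<in> borel_measurable N \<Longrightarrow> (\<And>y. \<bar>g y\<bar> \<le> B) \<Longrightarrow> c < m \<Longrightarrow>
      (\<integral>x. g (\<pi> x) * e x $ c \<partial>M) = (0 :: real)"
  shows "(\<integral>\<^sup>+x. ennreal (quad S (e x)) \<partial>M) \<le> (\<integral>\<^sup>+x. ennreal (quad S (h (\<pi> x) + e x)) \<partial>M)"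
proof -
  define U where "U n = {y \<in> space N. \<forall>r<m. \<bar>h y $ r\<bar> \<le> real n}" for n :: nat
  have U [measurable]: "U n \<in> sets N" for n
  proof -
    have "U n = space N \<inter> (\<Inter>r\<in>{..<m}. {y \<in> space N. \<bar>h y $ r\<bar> \<le> real n})"
      by (auto simp: U_def)
    moreover have "{y \<in> space N. \<bar>h y $ r\<bar> \<le> real n} \<in> sets N" if "r < m" for r
    proof -
      have [measurable]: "(\<lambda>y. h y $ r) \<in> borel_measurable N" by (rule borel_vec_index[OF h that])
      show ?thesis by measurable
    qed
    ultimately show ?thesis
      by (cases "m = 0") (auto intro!: sets.Int sets.finite_INT)
  qed
  have \<pi>_sp: "\<pi> x \<in> space N" if "x \<in> space M" for x using measurable_space[OF \<pi> that] .
  have ec: "e x \<in> carrier_vec m" if "x \<in> space M" for x by (rule L2_vec_carrier[OF e that])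
  have hc: "h (\<pi> x) \<in> carrier_vec m" if "x \<in> space M" for x
    by (rule borel_vec_carrier[OF h \<pi>_sp[OF that]])
  have e_int: "integrable M (\<lambda>x. e x $ c)" if "c < m" for c
    by (rule L2_rv_integrable[OF L2_vec_index[OF e that]])
  have qe_int: "integrable M (\<lambda>x. quad S (e x))" by (rule L2_vec_quad[OF S(1) e])
  let ?R = "\<integral>\<^sup>+x. ennreal (quad S (h (\<pi> x) + e x)) \<partial>M"
  have bound: "ennreal (\<integral>x. indicator (U n) (\<pi> x) * quad S (e x) \<partial>M) \<le> ?R" for n
  proof -
    define g where "g r y = indicator (U n) y * h y $ r" for r y
    have g_m: "g r \<in> borel_measurable N" if "r < m" for r
      unfolding g_def using borel_vec_index[OF h that] by (intro borel_measurable_times) auto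
    have g_b: "\<bar>g r y\<bar> \<le> real n" if "r < m" for r y
      using that by (auto simp: g_def U_def indicator_def)
    have ge_int: "integrable M (\<lambda>x. g r (\<pi> x) * e x $ c)" if "r < m" "c < m" for r c
      by (rule integrable_bounded_mult[OF e_int[OF that(2)] measurable_compose[OF \<pi> g_m[OF that(1)]] g_b[OF that(1)]])
    define cross where "cross x = (\<Sum>r<m. \<Sum>c<m. S $$ (r, c) * (g r (\<pi> x) * e x $ c))" for x
    have cross_int: "integrable M cross"
      unfolding cross_def
      by (intro Bochner_Integration.integrable_sum integrable_mult_right ge_int) auto
    have cross_0: "(\<integral>x. cross x \<partial>M) = 0"
    proof -
      have "(\<integral>x. cross x \<partial>M) = (\<Sum>r<m. \<Sum>c<m. S $$ (r, c) * (\<integral>x. g r (\<pi> x) * e x $ c \<partial>M))"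
      proof -
        have "(\<integral>x. cross x \<partial>M) = (\<Sum>r<m. \<integral>x. (\<Sum>c<m. S $$ (r, c) * (g r (\<pi> x) * e x $ c)) \<partial>M)"
          unfolding cross_def
          by (intro Bochner_Integration.integral_sum Bochner_Integration.integrable_sum
              integrable_mult_right ge_int) auto
        also have "\<dots> = (\<Sum>r<m. \<Sum>c<m. \<integral>x. S $$ (r, c) * (g r (\<pi> x) * e x $ c) \<partial>M)"
          by (intro sum.cong refl Bochner_Integration.integral_sum integrable_mult_right ge_int) auto
        finally show ?thesis by simp
      qed
      also have "\<dots> = 0" using orth[OF g_m g_b] by simp
      finally show ?thesis .
    qed
    have cross_eq: "cross x = indicator (U n) (\<pi> x) * (h (\<pi> x) \<bullet> (S *\<^sub>v e x))" if x: "x \<in> space M" for x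
    proof -
      have "h (\<pi> x) \<bullet> (S *\<^sub>v e x) = (\<Sum>r<m. h (\<pi> x) $ r * (S *\<^sub>v e x) $ r)"
        using S(1) by (simp add: scalar_prod_def lessThan_atLeast0)
      also have "\<dots> = (\<Sum>r<m. h (\<pi> x) $ r * (\<Sum>c<m. S $$ (r, c) * e x $ c))"
        using mult_mat_vec_index_sum[OF S(1) ec[OF x]] by simp
      finally show ?thesis
        unfolding cross_def g_def by (simp add: sum_distrib_left mult_ac)
    qed
    define k where "k x = indicator (U n) (\<pi> x) * quad S (e x) + 2 * cross x" for x
    have iq_int: "integrable M (\<lambda>x. indicator (U n) (\<pi> x) * quad S (e x))"
      by (rule integrable_bounded_mult[OF qe_int, where B = 1])
        (auto intro!: measurable_compose[OF \<pi>] simp: indicator_def)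
    have k_int: "integrable M k" unfolding k_def using iq_int cross_int by simp
    have "(\<integral>x. k x \<partial>M) = (\<integral>x. indicator (U n) (\<pi> x) * quad S (e x) \<partial>M)"
      unfolding k_def using iq_int cross_int cross_0 by simp
    moreover have "ennreal (\<integral>x. k x \<partial>M) \<le> (\<integral>\<^sup>+x. ennreal (k x) \<partial>M)"
      by (rule ennreal_integral_le_nn_integral[OF k_int])
    moreover have "(\<integral>\<^sup>+x. ennreal (k x) \<partial>M) \<le> ?R"
    proof (rule nn_integral_mono)
      fix x assume x: "x \<in> space M"
      have "quad S (h (\<pi> x) + e x) = quad S (h (\<pi> x)) + quad S (e x) + 2 * (h (\<pi> x) \<bullet> (S *\<^sub>v e x))"
        by (rule quad_add[OF S hc[OF x] ec[OF x]])
      then have "k x \<le> quad S (h (\<pi> x) + e x)"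
        using psd[OF hc[OF x]] psd[OF add_carrier_vec[OF hc[OF x] ec[OF x]]] cross_eq[OF x]
        by (auto simp: k_def indicator_def)
      then show "ennreal (k x) \<le> ennreal (quad S (h (\<pi> x) + e x))" by (rule ennreal_leI)
    qed
    ultimately show ?thesis by simp
  qed
  have "(\<lambda>n. \<integral>x. indicator (U n) (\<pi> x) * quad S (e x) \<partial>M) \<longlonglongrightarrow> (\<integral>x. quad S (e x) \<partial>M)"
  proof (rule integral_dominated_convergence[where w = "\<lambda>x. quad S (e x)"])
    show "(\<lambda>x. indicator (U n) (\<pi> x) * quad S (e x)) \<in> borel_measurable M" for n
      using qe_int by (intro borel_measurable_times measurable_compose[OF \<pi>]) auto
    show "AE x in M. (\<lambda>n. indicator (U n) (\<pi> x) * quad S (e x)) \<longlonglongrightarrow> quad S (e x)"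
    proof (rule AE_I2)
      fix x assume x: "x \<in> space M"
      obtain n0 :: nat where n0: "(\<Sum>r<m. \<bar>h (\<pi> x) $ r\<bar>) \<le> real n0" using real_arch_simple by blast
      have "\<pi> x \<in> U n" if "n \<ge> n0" for n
      proof -
        have "\<bar>h (\<pi> x) $ r\<bar> \<le> real n" if "r < m" for r
          using member_le_sum[of r "{..<m}" "\<lambda>r. \<bar>h (\<pi> x) $ r\<bar>"] that n0 \<open>n \<ge> n0\<close> by simp
        then show ?thesis using \<pi>_sp[OF x] by (simp add: U_def)
      qed
      then have "eventually (\<lambda>n. indicator (U n) (\<pi> x) * quad S (e x) = quad S (e x)) sequentially"
        by (auto simp: eventually_sequentially intro!: exI[of _ n0])
      then show "(\<lambda>n. indicator (U n) (\<pi> x) * quad S (e x)) \<longlonglongrightarrow> quad S (e x)"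
        by (rule tendsto_eventually)
    qed
    show "AE x in M. norm (indicator (U n) (\<pi> x) * quad S (e x)) \<le> quad S (e x)" for n
      using psd[OF ec] by (intro AE_I2) (auto simp: indicator_def)
  qed (use qe_int in auto)
  then have "(\<lambda>n. ennreal (\<integral>x. indicator (U n) (\<pi> x) * quad S (e x) \<partial>M)) \<longlonglongrightarrow> ennreal (\<integral>x. quad S (e x) \<partial>M)"
    by (rule tendsto_ennrealI)
  then have "ennreal (\<integral>x. quad S (e x) \<partial>M) \<le> ?R"
    by (rule LIMSEQ_le_const2) (use bound in auto)
  moreover have "(\<integral>\<^sup>+x. ennreal (quad S (e x)) \<partial>M) = ennreal (\<integral>x. quad S (e x) \<partial>M)"
    by (rule nn_integral_eq_integral[OF qe_int]) (use psd[OF ec] in auto)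
  ultimately show ?thesis by simp
qed

section \<open>One decision maker facing an exogenous sequence\<close>

locale decision_maker =
  fixes G :: "'w lq_game" and i :: nat
  assumes valid: "valid_game G" and dm: "i \<in> DM G"
begin

abbreviation "T \<equiv> horizon G"
abbreviation "nx \<equiv> dim_x G i"
abbreviation "nu \<equiv> dim_u G i"
abbreviation "ny \<equiv> dim_y G"
abbreviation "\<beta> \<equiv> disc G i"
abbreviation "A \<equiv> Am G i"
abbreviation "B \<equiv> Bm G i"
abbreviation "C \<equiv> Cm G i"
abbreviation "Q \<equiv> Qm G i"
abbreviation "R \<equiv> Rm G i"
abbreviation "K \<equiv> Km G i"
abbreviation "L \<equiv> Lm G i"
abbreviation "M \<equiv> M_mat G i"
abbreviation "S \<equiv> S_mat G i"
abbreviation "F \<equiv> F_mat G i"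

lemma i_le: "i \<le> num_dm G" using dm by (simp add: DM_def)

lemma data_carrier:
  assumes "t < T"
  shows "A t \<in> carrier_mat nx nx" "B t \<in> carrier_mat nx nu" "C t \<in> carrier_mat nx ny"
    "K t \<in> carrier_mat ny nu" "L t \<in> carrier_mat ny nx"
    "pos_definite nx (Q t)" "pos_definite nu (R t)"
    "Q t \<in> carrier_mat nx nx" "R t \<in> carrier_mat nu nu"
  using valid dm i_le assms unfolding valid_game_def pos_definite_def by auto

lemma terminal_pos_definite: "pos_definite nx (Q T)" and discount_nonneg: "0 \<le> \<beta>"
  using valid dm unfolding valid_game_def by auto

lemma M_terminal: "M T = Q T" by (simp add: M_mat.simps)

lemma M_step:
  "k < T \<Longrightarrow> M k = Q k + \<beta> \<cdot>\<^sub>m (transpose_mat (A k) * (M (Suc k) - \<beta> \<cdot>\<^sub>m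
     (M (Suc k) * B k * mat_inv (S k) * transpose_mat (B k) * M (Suc k))) * A k)"
  by (subst M_mat.simps) (simp add: Let_def S_mat_def)

lemma S_step: "S k = R k + \<beta> \<cdot>\<^sub>m (transpose_mat (B k) * M (Suc k) * B k)"
  by (simp add: S_mat_def S_of_def)

lemma S_pos_definite_of_M:
  assumes k: "k < T" and M: "M (Suc k) \<in> carrier_mat nx nx" "transpose_mat (M (Suc k)) = M (Suc k)"
    and psd: "\<And>v. v \<in> carrier_vec nx \<Longrightarrow> 0 \<le> quad (M (Suc k)) v"
  shows "pos_definite nu (S k)"
proof -
  note c = data_carrier[OF k]
  let ?P = "transpose_mat (B k) * M (Suc k) * B k"
  have Bt: "transpose_mat (B k) \<in> carrier_mat nu nx" using c by simp
  have BtM: "transpose_mat (B k) * M (Suc k) \<in> carrier_mat nu nx" by (rule mult_carrier_mat[OF Bt M(1)])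
  have P: "?P \<in> carrier_mat nu nu" by (rule mult_carrier_mat[OF BtM c(2)])
  have Pt: "transpose_mat ?P = ?P"
    unfolding transpose_mult[OF BtM c(2)] transpose_mult[OF Bt M(1)] M(2) transpose_transpose
    by (rule assoc_mult_mat[symmetric, OF Bt M(1) c(2)])
  have Rt: "transpose_mat (R k) = R k" using c(7) by (simp add: pos_definite_def)
  have sym: "transpose_mat (S k) = S k"
  proof -
    have "transpose_mat (\<beta> \<cdot>\<^sub>m ?P) = \<beta> \<cdot>\<^sub>m transpose_mat ?P" using P by (intro eq_matI) auto
    then show ?thesis
      unfolding S_step using transpose_add[OF c(9) smult_carrier_mat[OF P]] Rt Pt by simp
  qed
  have "0 < v \<bullet> (S k *\<^sub>v v)" if v: "v \<in> carrier_vec nu" "v \<noteq> 0\<^sub>v nu" for v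
  proof -
    have Bv: "B k *\<^sub>v v \<in> carrier_vec nx" using c v by simp
    have MBv: "M (Suc k) *\<^sub>v (B k *\<^sub>v v) \<in> carrier_vec nx" using M Bv by simp
    have "?P *\<^sub>v v = transpose_mat (B k) *\<^sub>v (M (Suc k) *\<^sub>v (B k *\<^sub>v v))"
      unfolding assoc_mult_mat_vec[OF BtM c(2) v(1)] by (rule assoc_mult_mat_vec[OF Bt M(1) Bv])
    then have "S k *\<^sub>v v = R k *\<^sub>v v + \<beta> \<cdot>\<^sub>v (transpose_mat (B k) *\<^sub>v (M (Suc k) *\<^sub>v (B k *\<^sub>v v)))"
      unfolding S_step add_mult_distrib_mat_vec[OF c(9) smult_carrier_mat[OF P] v(1)]
        smult_mat_mult_vec[OF P v(1)] by simp
    moreover have "v \<bullet> (transpose_mat (B k) *\<^sub>v (M (Suc k) *\<^sub>v (B k *\<^sub>v v))) = quad (M (Suc k)) (B k *\<^sub>v v)"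
      unfolding quad_def by (rule scalar_prod_transpose[OF c(2) v(1) MBv])
    ultimately have "v \<bullet> (S k *\<^sub>v v) = v \<bullet> (R k *\<^sub>v v) + \<beta> * quad (M (Suc k)) (B k *\<^sub>v v)"
      using scalar_prod_add_distrib[OF v(1), of "R k *\<^sub>v v" "\<beta> \<cdot>\<^sub>v (transpose_mat (B k) *\<^sub>v (M (Suc k) *\<^sub>v (B k *\<^sub>v v)))"]
        c(9) v(1) Bt MBv by simp
    moreover have "0 < v \<bullet> (R k *\<^sub>v v)" using c(7) v unfolding pos_definite_def by blast
    moreover have "0 \<le> \<beta> * quad (M (Suc k)) (B k *\<^sub>v v)" using discount_nonneg psd[OF Bv] by simp
    ultimately show ?thesis by linarith
  qed
  moreover have "S k \<in> carrier_mat nu nu" unfolding S_step using c(9) P by simp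
  ultimately show ?thesis using sym unfolding pos_definite_def by blast
qed

text \<open>The three properties are carried backward together: \<open>M\<^sub>k\<^sub>+\<^sub>1\<close> nonnegative makes \<open>S\<^sub>k\<close> positive
  definite, hence invertible, which is what the Riccati step needs.\<close>

lemma value_matrix:
  assumes "k \<le> T"
  shows "M k \<in> carrier_mat nx nx \<and> transpose_mat (M k) = M k \<and> (\<forall>v\<in>carrier_vec nx. 0 \<le> quad (M k) v)"
  using assms
proof (induction k rule: inc_induct)
  case base
  show ?case using terminal_pos_definite pos_definite_quad_nonneg[OF terminal_pos_definite]
    unfolding M_terminal by (simp add: pos_definite_def)
next
  case (step k)
  then have k: "k < T" by simp
  note c = data_carrier[OF k]
  have M: "M (Suc k) \<in> carrier_mat nx nx" "transpose_mat (M (Suc k)) = M (Suc k)"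
    and psd: "\<And>v. v \<in> carrier_vec nx \<Longrightarrow> 0 \<le> quad (M (Suc k)) v"
    using step.IH by auto
  have S: "pos_definite nu (S k)" by (rule S_pos_definite_of_M[OF k M psd])
  have S': "S k \<in> carrier_mat nu nu" "transpose_mat (S k) = S k" using S by (auto simp: pos_definite_def)
  let ?I = "mat_inv (S k)"
  note I = pos_definite_mat_inv[OF S]
  have It: "transpose_mat ?I = ?I"
  proof -
    have c1: "transpose_mat ?I \<in> carrier_mat nu nu" using I by simp
    have "transpose_mat ?I * S k = 1\<^sub>m nu"
      using transpose_mult[OF S'(1) I(1)] unfolding I(2) S'(2) by (simp add: transpose_one)
    then have "transpose_mat ?I = transpose_mat ?I * (S k * ?I)"
      unfolding I(2) using c1 by simp
    also have "\<dots> = (transpose_mat ?I * S k) * ?I"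
      by (rule assoc_mult_mat[symmetric, OF c1 S'(1) I(1)])
    also have "\<dots> = ?I" using \<open>transpose_mat ?I * S k = 1\<^sub>m nu\<close> I(1) by simp
    finally show ?thesis .
  qed
  have Bt: "transpose_mat (B k) \<in> carrier_mat nu nx" and At: "transpose_mat (A k) \<in> carrier_mat nx nx"
    using c by auto
  note MB = mult_carrier_mat[OF M(1) c(2)]
  note MBI = mult_carrier_mat[OF MB I(1)]
  note MBIB = mult_carrier_mat[OF MBI Bt]
  note P = mult_carrier_mat[OF MBIB M(1)]
  let ?P = "M (Suc k) * B k * ?I * transpose_mat (B k) * M (Suc k)"
  let ?N = "M (Suc k) - \<beta> \<cdot>\<^sub>m ?P"
  have Pt: "transpose_mat ?P = ?P"
  proof -
    note BtM = mult_carrier_mat[OF Bt M(1)]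
    have "transpose_mat ?P = M (Suc k) * (B k * (?I * (transpose_mat (B k) * M (Suc k))))"
      unfolding transpose_mult[OF MBIB M(1)] transpose_mult[OF MBI Bt] transpose_mult[OF MB I(1)]
        transpose_mult[OF M(1) c(2)] M(2) It transpose_transpose ..
    also have "\<dots> = ?P"
      unfolding assoc_mult_mat[OF MBI Bt M(1)] assoc_mult_mat[OF MB I(1) BtM]
        assoc_mult_mat[OF M(1) c(2) mult_carrier_mat[OF I(1) BtM]] ..
    finally show ?thesis .
  qed
  have N: "?N \<in> carrier_mat nx nx" by (intro minus_carrier_mat smult_carrier_mat P)
  have Nt: "transpose_mat ?N = ?N"
  proof (rule eq_matI)
    fix a b assume ab: "a < dim_row ?N" "b < dim_col ?N"
    then have ab': "a < nx" "b < nx" using N by auto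
    have swap: "X $$ (b, a) = X $$ (a, b)" if "transpose_mat X = X" "X \<in> carrier_mat nx nx" for X
      using index_transpose_mat(1)[of a X b] that ab' by auto
    show "transpose_mat ?N $$ (a, b) = ?N $$ (a, b)"
      using ab' N P M(1) swap[OF M(2) M(1)] swap[OF Pt P] by simp
  qed (use N M(1) in auto)
  note AN = mult_carrier_mat[OF At N]
  note ANA = mult_carrier_mat[OF AN c(1)]
  have ANAt: "transpose_mat (transpose_mat (A k) * ?N * A k) = transpose_mat (A k) * ?N * A k"
    unfolding transpose_mult[OF AN c(1)] transpose_mult[OF At N] transpose_transpose Nt
    by (rule assoc_mult_mat[symmetric, OF At N c(1)])
  have Mk: "M k \<in> carrier_mat nx nx"
    unfolding M_step[OF k] by (intro add_carrier_mat smult_carrier_mat ANA)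
  have Qt: "transpose_mat (Q k) = Q k" using c(6) by (simp add: pos_definite_def)
  have "transpose_mat (M k) = M k"
  proof -
    have "transpose_mat (\<beta> \<cdot>\<^sub>m (transpose_mat (A k) * ?N * A k)) = \<beta> \<cdot>\<^sub>m transpose_mat (transpose_mat (A k) * ?N * A k)"
      using ANA by (intro eq_matI) auto
    then show ?thesis
      unfolding M_step[OF k] transpose_add[OF c(8) smult_carrier_mat[OF ANA]] ANAt Qt by simp
  qed
  moreover have "0 \<le> quad (M k) v" if v: "v \<in> carrier_vec nx" for v
  proof -
    have "quad (M k) v = quad (Q k) v + quad (R k) (F k *\<^sub>v v)
        + \<beta> * quad (M (Suc k)) (A k *\<^sub>v v + B k *\<^sub>v (F k *\<^sub>v v))"
      by (rule riccati_step_quad[OF c(1,2,8,9) M S' S_step I _ M_step[OF k] v]) (simp add: F_mat_def)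
    moreover have Fc: "F k \<in> carrier_mat nu nx"
      unfolding F_mat_def
      by (rule smult_carrier_mat[OF mult_carrier_mat[OF mult_carrier_mat[OF mult_carrier_mat[OF I(1) Bt] M(1)] c(1)]])
    moreover have "F k *\<^sub>v v \<in> carrier_vec nu" using Fc v by simp
    moreover have "A k *\<^sub>v v + B k *\<^sub>v (F k *\<^sub>v v) \<in> carrier_vec nx" using c Fc v by simp
    ultimately show ?thesis
      using pos_definite_quad_nonneg[OF c(6) v] pos_definite_quad_nonneg[OF c(7)] psd discount_nonneg
      by simp
  qed
  ultimately show ?case using Mk by blast
qed

lemma M_carrier: "k \<le> T \<Longrightarrow> M k \<in> carrier_mat nx nx" and M_sym: "k \<le> T \<Longrightarrow> transpose_mat (M k) = M k"
  using value_matrix by auto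

lemma S_pos_definite: "k < T \<Longrightarrow> pos_definite nu (S k)"
  using S_pos_definite_of_M[of k] value_matrix[of "Suc k"] by auto

lemma S_carrier: "k < T \<Longrightarrow> S k \<in> carrier_mat nu nu" and S_sym: "k < T \<Longrightarrow> transpose_mat (S k) = S k"
  using S_pos_definite by (auto simp: pos_definite_def)

lemma S_inv: "k < T \<Longrightarrow> mat_inv (S k) \<in> carrier_mat nu nu" "k < T \<Longrightarrow> S k * mat_inv (S k) = 1\<^sub>m nu"
  using pos_definite_mat_inv[OF S_pos_definite] by auto

lemma F_carrier: assumes k: "k < T" shows "F k \<in> carrier_mat nu nx"
proof -
  have Bt: "transpose_mat (B k) \<in> carrier_mat nu nx" using data_carrier[OF k] by simp
  have M: "M (Suc k) \<in> carrier_mat nx nx" using k by (intro M_carrier) simp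
  show ?thesis
    unfolding F_mat_def
    by (rule smult_carrier_mat[OF mult_carrier_mat[OF mult_carrier_mat[OF mult_carrier_mat[OF S_inv(1)[OF k] Bt] M] data_carrier(1)[OF k]]])
qed

end

context decision_maker
begin

abbreviation "PhiM t k \<equiv> Phi G i t k * M (Suc k)"
abbreviation "NK k \<equiv> transpose_mat (F k) * transpose_mat (K k) + transpose_mat (L k)"
abbreviation "closed_loop k \<equiv> \<beta> \<cdot>\<^sub>m transpose_mat (A k + B k * F k)"
abbreviation "innovation k \<omega> \<equiv> vec_expectation (\<Omega> G) nx (wdist G i k) - wdist G i k \<omega>"

lemma Phi_refl [simp]: "Phi G i t t = 1\<^sub>m nx"
  by (simp add: Phi_def)

lemma Phi_rec:
  "t < k \<Longrightarrow> Phi G i t k = closed_loop (Suc t) * Phi G i (Suc t) k"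
  unfolding Phi_def by (subst upt_conv_Cons) simp_all

lemma closed_loop_carrier:
  "t < T \<Longrightarrow> closed_loop t \<in> carrier_mat nx nx"
  using data_carrier[of t] F_carrier[of t] by simp

lemma Phi_carrier: "t \<le> k \<Longrightarrow> k < T \<Longrightarrow> Phi G i t k \<in> carrier_mat nx nx"
proof (induction t rule: inc_induct)
  case (step t)
  then show ?case
    using Phi_rec[of t k] mult_carrier_mat[OF closed_loop_carrier[of "Suc t"]] by simp
qed simp

subsection \<open>Clairvoyant control\<close>

text \<open>Half the gradient, at the origin, of the minimal cost to go of a decision maker who knows
  the sequences \<open>z\<close> and \<open>w\<close> in advance.\<close>

function costate :: "(nat \<Rightarrow> real vec) \<Rightarrow> (nat \<Rightarrow> real vec) \<Rightarrow> nat \<Rightarrow> real vec" where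
  "costate z w k =
     (if k < T then
        NK k *\<^sub>v z k
        + \<beta> \<cdot>\<^sub>v (transpose_mat (A k + B k * F k) *\<^sub>v
            (M (Suc k) *\<^sub>v (C k *\<^sub>v z k + w k) + costate z w (Suc k)))
      else 0\<^sub>v nx)"
  by pat_completeness auto
termination
  by (relation "Wellfounded.measure (\<lambda>(z, w, k). T - k)") auto

declare costate.simps [simp del]

text \<open>The part of the control, besides the state feedback, that such a clairvoyant decision maker uses.\<close>

definition feedforward :: "(nat \<Rightarrow> real vec) \<Rightarrow> (nat \<Rightarrow> real vec) \<Rightarrow> nat \<Rightarrow> real vec" where
  "feedforward z w t = - (mat_inv (S t) *\<^sub>v (transpose_mat (K t) *\<^sub>v z t
     + \<beta> \<cdot>\<^sub>v (transpose_mat (B t) *\<^sub>v (M (Suc t) *\<^sub>v (C t *\<^sub>v z t + w t) + costate z w (Suc t)))))"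

text \<open>The cost of the clairvoyant optimum. It is a polynomial of degree two in the initial state and the
  two sequences, hence integrable for square integrable data.\<close>

definition unavoidable_cost :: "real vec \<Rightarrow> (nat \<Rightarrow> real vec) \<Rightarrow> (nat \<Rightarrow> real vec) \<Rightarrow> real" where
  "unavoidable_cost x0 z w = quad (M 0) x0 + 2 * (costate z w 0 \<bullet> x0)
     + (\<Sum>t<T. \<beta> ^ t * (\<beta> * (quad (M (Suc t)) (C t *\<^sub>v z t + w t)
                             + 2 * (costate z w (Suc t) \<bullet> (C t *\<^sub>v z t + w t)))
                       - quad (S t) (feedforward z w t)))"

lemma costate_carrier: "costate z w k \<in> carrier_vec nx"
proof (cases "k < T")
  case True
  then show ?thesis
    using data_carrier[OF True] F_carrier[OF True]
    by (subst costate.simps) (auto intro!: carrier_vecI)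
qed (simp add: costate.simps)

lemma feedforward_carrier: "t < T \<Longrightarrow> feedforward z w t \<in> carrier_vec nu"
  using S_inv[of t] unfolding feedforward_def by (auto intro!: carrier_vecI)

text \<open>The one-step identity telescopes along the trajectory of an arbitrary control sequence.\<close>

lemma cost_completed_square:
  assumes z: "\<And>t. t < T \<Longrightarrow> z t \<in> carrier_vec ny" and w: "\<And>t. t < T \<Longrightarrow> w t \<in> carrier_vec nx"
    and u: "\<And>t. t < T \<Longrightarrow> u t \<in> carrier_vec nu" and x0: "x 0 \<in> carrier_vec nx"
    and x_Suc: "\<And>t. t < T \<Longrightarrow> x (Suc t) = A t *\<^sub>v x t + B t *\<^sub>v u t + C t *\<^sub>v z t + w t"
  shows "(\<Sum>t<T. \<beta> ^ t * stage_cost G i t (x t) (u t) (z t)) + \<beta> ^ T * quad (Q T) (x T)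
    = unavoidable_cost (x 0) z w
      + (\<Sum>t<T. \<beta> ^ t * quad (S t) (u t - (F t *\<^sub>v x t + feedforward z w t)))"
proof -
  have x: "t \<le> T \<Longrightarrow> x t \<in> carrier_vec nx" for t
  proof (induction t)
    case (Suc t)
    then show ?case using w[of t] x_Suc[of t] by (auto intro!: carrier_vecI)
  qed (simp add: x0)
  define V where "V t = quad (M t) (x t) + 2 * (costate z w t \<bullet> x t)" for t
  define r where "r t = \<beta> * (quad (M (Suc t)) (C t *\<^sub>v z t + w t)
      + 2 * (costate z w (Suc t) \<bullet> (C t *\<^sub>v z t + w t))) - quad (S t) (feedforward z w t)" for t
  define e where "e t = quad (S t) (u t - (F t *\<^sub>v x t + feedforward z w t))" for t
  have step: "stage_cost G i t (x t) (u t) (z t) + \<beta> * V (Suc t) = V t + e t + r t" if t: "t < T" for t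
  proof -
    note c = data_carrier[OF t]
    have M: "M (Suc t) \<in> carrier_mat nx nx" "transpose_mat (M (Suc t)) = M (Suc t)"
      using M_carrier[of "Suc t"] M_sym[of "Suc t"] t by auto
    have d: "C t *\<^sub>v z t + w t \<in> carrier_vec nx" using c z w t by simp
    have x': "x (Suc t) = A t *\<^sub>v x t + B t *\<^sub>v u t + (C t *\<^sub>v z t + w t)"
      using c x[of t] u[OF t] z[OF t] w[OF t] t x_Suc[OF t] by (intro eq_vecI) auto
    have p': "costate z w t = (transpose_mat (F t) * transpose_mat (K t) + transpose_mat (L t)) *\<^sub>v z t
        + \<beta> \<cdot>\<^sub>v (transpose_mat (A t + B t * F t) *\<^sub>v
            (M (Suc t) *\<^sub>v (C t *\<^sub>v z t + w t) + costate z w (Suc t)))"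
      using t by (subst costate.simps) simp
    show ?thesis
      using complete_square_step[OF c(1,2,8,9,4,5) M S_carrier[OF t] S_sym[OF t] S_step S_inv[OF t] F_mat_def
          M_step[OF t] x u[OF t] z[OF t] d costate_carrier refl feedforward_def p' x'] t
      by (simp add: stage_cost_def V_def r_def e_def)
  qed
  have "(\<Sum>t<k. \<beta> ^ t * stage_cost G i t (x t) (u t) (z t)) + \<beta> ^ k * V k
      = V 0 + (\<Sum>t<k. \<beta> ^ t * r t) + (\<Sum>t<k. \<beta> ^ t * e t)" if "k \<le> T" for k
    using that
  proof (induction k)
    case (Suc k)
    then have "\<beta> ^ k * (stage_cost G i k (x k) (u k) (z k) + \<beta> * V (Suc k)) = \<beta> ^ k * (V k + e k + r k)"
      using step[of k] by simp
    with Suc show ?case by (simp add: algebra_simps)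
  qed simp
  from this[of T] show ?thesis
    using x[of T] by (simp add: V_def M_terminal costate.simps[of z w T] unavoidable_cost_def r_def e_def)
qed

text \<open>Contribution of \<open>z\<^sub>k\<close> to the vector \<open>M d + p\<close> at time \<open>t\<close>, that is, to the linear part of the cost
  to go. At \<open>k = t\<close> the present \<open>z\<^sub>t\<close> acts through the dynamics only; its effect through the stage cost
  enters \<open>feedforward\<close> separately.\<close>

definition lag :: "(nat \<Rightarrow> real vec) \<Rightarrow> nat \<Rightarrow> nat \<Rightarrow> real vec" where
  "lag z t k = Phi G i t k *\<^sub>v (M (Suc k) *\<^sub>v (C k *\<^sub>v z k))
     + (if k = t then 0\<^sub>v nx
        else Phi G i t (k - 1) *\<^sub>v (NK k *\<^sub>v z k))"

lemma lag_carrier: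
  assumes "t \<le> k" "k < T"
  shows "lag z t k \<in> carrier_vec nx"
proof (cases "k = t")
  case True
  then show ?thesis
    using Phi_carrier[OF assms] unfolding lag_def by (auto intro!: carrier_vecI)
next
  case False
  then have "Phi G i t (k - 1) \<in> carrier_mat nx nx"
    using assms by (intro Phi_carrier) auto
  with False show ?thesis
    using Phi_carrier[OF assms] unfolding lag_def by (auto intro!: carrier_vecI)
qed

lemma NK_carrier:
  "k < T \<Longrightarrow> NK k \<in> carrier_mat nx ny"
  using data_carrier[of k] F_carrier[of k] by simp

lemma lag_step:
  assumes tk: "Suc t < k" and k: "k < T" and z: "z k \<in> carrier_vec ny"
  shows "lag z t k = closed_loop (Suc t) *\<^sub>v lag z (Suc t) k"
proof -
  let ?c = "closed_loop (Suc t)"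
  have cl: "?c \<in> carrier_mat nx nx" using closed_loop_carrier[of "Suc t"] tk k by simp
  have P: "Phi G i (Suc t) k \<in> carrier_mat nx nx" "Phi G i (Suc t) (k - 1) \<in> carrier_mat nx nx"
    using tk k by (auto intro!: Phi_carrier)
  have y1: "M (Suc k) *\<^sub>v (C k *\<^sub>v z k) \<in> carrier_vec nx"
    using M_carrier[of "Suc k"] k by (auto intro!: carrier_vecI)
  have y2: "NK k *\<^sub>v z k \<in> carrier_vec nx"
    using NK_carrier[OF k] z by (rule mult_mat_vec_carrier)
  have "lag z t k = ?c *\<^sub>v (Phi G i (Suc t) k *\<^sub>v (M (Suc k) *\<^sub>v (C k *\<^sub>v z k)))
      + ?c *\<^sub>v (Phi G i (Suc t) (k - 1) *\<^sub>v (NK k *\<^sub>v z k))"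
    unfolding lag_def
    using tk Phi_rec[of t k] Phi_rec[of t "k - 1"] assoc_mult_mat_vec[OF cl P(1) y1] assoc_mult_mat_vec[OF cl P(2) y2]
    by simp
  also have "\<dots> = ?c *\<^sub>v lag z (Suc t) k"
    unfolding lag_def using mult_add_distrib_mat_vec[OF cl mult_mat_vec_carrier[OF P(1) y1] mult_mat_vec_carrier[OF P(2) y2]] tk
    by simp
  finally show ?thesis .
qed

lemma lag_refl: "t < T \<Longrightarrow> lag z t t = M (Suc t) *\<^sub>v (C t *\<^sub>v z t)"
proof -
  assume "t < T"
  then have "M (Suc t) *\<^sub>v (C t *\<^sub>v z t) \<in> carrier_vec nx"
    using M_carrier[of "Suc t"] by (auto intro!: carrier_vecI)
  then show ?thesis unfolding lag_def by simp
qed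

lemma lag_Suc:
  assumes t: "Suc t < T" and z: "z (Suc t) \<in> carrier_vec ny"
  shows "lag z t (Suc t) = closed_loop (Suc t) *\<^sub>v lag z (Suc t) (Suc t)
    + NK (Suc t) *\<^sub>v z (Suc t)"
proof -
  have cl: "closed_loop (Suc t) \<in> carrier_mat nx nx"
    by (rule closed_loop_carrier[OF t])
  have "Phi G i t (Suc t) = closed_loop (Suc t)"
    using Phi_rec[of t "Suc t"] right_mult_one_mat[OF cl] by simp
  then show ?thesis
    unfolding lag_refl[OF t] unfolding lag_def using mult_mat_vec_carrier[OF NK_carrier[OF t] z] by simp
qed

text \<open>The backward recursion of the costate unrolled. The matrices \<open>\<Phi>\<close> accumulate
  the factors \<open>\<beta>(A + BF)'\<close> picked up on the way from \<open>k\<close> back to \<open>t\<close>.\<close>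

lemma costate_explicit:
  assumes t: "t < T" and z: "\<And>k. k < T \<Longrightarrow> z k \<in> carrier_vec ny" and w: "\<And>k. k < T \<Longrightarrow> w k \<in> carrier_vec nx"
  shows "M (Suc t) *\<^sub>v (C t *\<^sub>v z t + w t) + costate z w (Suc t)
    = vec_sum nx (\<lambda>k. lag z t k + PhiM t k *\<^sub>v w k) {t..<T}"
proof -
  have "t \<le> T - 1" using t by simp
  then show ?thesis
  proof (induction t rule: inc_induct)
    case base
    let ?t = "T - 1"
    have T: "?t < T" "Suc ?t = T" using t by auto
    have M: "M T \<in> carrier_mat nx nx" by (rule M_carrier) simp
    have c: "C ?t *\<^sub>v z ?t \<in> carrier_vec nx" "w ?t \<in> carrier_vec nx"
      using data_carrier[OF T(1)] z[OF T(1)] w[OF T(1)] by auto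
    have T': "Suc (T - Suc 0) = T" using T by simp
    have M1: "1\<^sub>m nx * M T = M T" by (rule left_mult_one_mat[OF M])
    have "{?t..<T} = {?t}" using T by auto
    then have "vec_sum nx (\<lambda>k. lag z ?t k + (Phi G i ?t k * M (Suc k)) *\<^sub>v w k) {?t..<T}
        = lag z ?t ?t + M T *\<^sub>v w ?t"
      using M c lag_carrier[OF order_refl T(1), of z] by (intro eq_vecI) (auto simp: T' M1)
    also have "\<dots> = M T *\<^sub>v (C ?t *\<^sub>v z ?t + w ?t)"
      unfolding lag_refl[OF T(1)] T(2) by (rule mult_add_distrib_mat_vec[symmetric, OF M c])
    finally show ?case
      using M c by (simp add: T' costate.simps[of z w T])
  next
    case (step t)
    then have t: "t < T" "Suc t < T" by auto
    let ?c = "closed_loop (Suc t)"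
    let ?N = "NK (Suc t)"
    let ?f = "\<lambda>t k. lag z t k + PhiM t k *\<^sub>v w k"
    have cl: "?c \<in> carrier_mat nx nx" by (rule closed_loop_carrier[OF t(2)])
    have f: "?f t k \<in> carrier_vec nx" if "t \<le> k" "k < T" for t k
      using lag_carrier[OF that, of z] Phi_carrier[OF that] M_carrier[of "Suc k"] that
      by (auto intro!: carrier_vecI)
    have M: "M (Suc t) \<in> carrier_mat nx nx" by (rule M_carrier) (use t in simp)
    have M': "M (Suc (Suc t)) \<in> carrier_mat nx nx" by (rule M_carrier) (use t in simp)
    have c: "C t *\<^sub>v z t \<in> carrier_vec nx" "w t \<in> carrier_vec nx"
      using data_carrier[OF t(1)] z[OF t(1)] w[OF t(1)] by auto
    have Nz: "?N *\<^sub>v z (Suc t) \<in> carrier_vec nx" by (rule mult_mat_vec_carrier[OF NK_carrier[OF t(2)] z[OF t(2)]])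
    have Phi_w: "PhiM t k *\<^sub>v w k = ?c *\<^sub>v ((Phi G i (Suc t) k * M (Suc k)) *\<^sub>v w k)"
      if k: "Suc t \<le> k" "k < T" for k
    proof -
      have Mk: "M (Suc k) \<in> carrier_mat nx nx" by (rule M_carrier) (use k in simp)
      note PM = mult_carrier_mat[OF Phi_carrier[OF k] Mk]
      have "Phi G i t k * M (Suc k) = ?c * (Phi G i (Suc t) k * M (Suc k))"
        unfolding Phi_rec[of t k, OF Suc_le_lessD[OF k(1)]]
        by (rule assoc_mult_mat[OF cl Phi_carrier[OF k] Mk])
      then show ?thesis using assoc_mult_mat_vec[OF cl PM w[OF k(2)]] by simp
    qed
    have PMw: "(Phi G i (Suc t) k * M (Suc k)) *\<^sub>v w k \<in> carrier_vec nx" if k: "Suc t \<le> k" "k < T" for k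
      using mult_carrier_mat[OF Phi_carrier[OF k] M_carrier[of "Suc k"]] w[OF k(2)] k
      by (intro mult_mat_vec_carrier[of _ nx nx]) auto
    have f_step: "?f t k = ?c *\<^sub>v ?f (Suc t) k" if k: "Suc t < k" "k < T" for k
      using lag_step[where z = z, OF k z[OF k(2)]] Phi_w[of k] k
        mult_add_distrib_mat_vec[OF cl lag_carrier[of "Suc t" k z] PMw[of k]] by simp
    have f_Suc: "?f t (Suc t) = ?c *\<^sub>v ?f (Suc t) (Suc t) + ?N *\<^sub>v z (Suc t)"
    proof -
      have l: "lag z (Suc t) (Suc t) \<in> carrier_vec nx" by (rule lag_carrier[OF order_refl t(2)])
      have p: "(Phi G i (Suc t) (Suc t) * M (Suc (Suc t))) *\<^sub>v w (Suc t) \<in> carrier_vec nx"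
        by (rule PMw[OF order_refl t(2)])
      show ?thesis
        unfolding lag_Suc[where z = z, OF t(2) z[OF t(2)]] Phi_w[OF order_refl t(2)] mult_add_distrib_mat_vec[OF cl l p]
        by (rule vec_add_right_swap[OF mult_mat_vec_carrier[OF cl l] Nz mult_mat_vec_carrier[OF cl p]])
    qed
    have tail: "vec_sum nx (?f t) {Suc t..<T} = ?N *\<^sub>v z (Suc t) + ?c *\<^sub>v vec_sum nx (?f (Suc t)) {Suc t..<T}"
    proof -
      have "vec_sum nx (?f t) {Suc (Suc t)..<T} = ?c *\<^sub>v vec_sum nx (?f (Suc t)) {Suc (Suc t)..<T}"
        using f by (subst mult_mat_vec_sum[OF cl]) (auto intro!: vec_sum_cong f_step)
      then show ?thesis
        unfolding vec_sum_head[OF t(2), of "?f t" nx, OF f[of t "Suc t", OF _ t(2), simplified]]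
          vec_sum_head[OF t(2), of "?f (Suc t)" nx, OF f[OF order_refl t(2)]] f_Suc
          mult_add_distrib_mat_vec[OF cl f[OF order_refl t(2)] vec_sum_carrier]
        by (simp only:) (rule vec_add_middle_first[OF mult_mat_vec_carrier[OF cl f[OF order_refl t(2)]] Nz
            mult_mat_vec_carrier[OF cl vec_sum_carrier]])
    qed
    have cl': "transpose_mat (A (Suc t) + B (Suc t) * F (Suc t)) \<in> carrier_mat nx nx"
      using data_carrier[OF t(2)] F_carrier[OF t(2)] by simp
    have "costate z w (Suc t) = vec_sum nx (?f t) {Suc t..<T}"
      unfolding tail costate.simps[of z w "Suc t"] step.IH smult_mat_mult_vec[OF cl' vec_sum_carrier]
      using t by simp
    moreover have "?f t t = M (Suc t) *\<^sub>v (C t *\<^sub>v z t + w t)"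
      using M c unfolding lag_refl[OF t(1)] mult_add_distrib_mat_vec[OF M c] by simp
    ultimately show ?case
      unfolding vec_sum_head[OF t(1), of "?f t" nx, OF f[OF order_refl t(1)]] by simp
  qed
qed

definition gain :: "nat \<Rightarrow> real mat" where
  "gain t = - \<beta> \<cdot>\<^sub>m (mat_inv (S t) * transpose_mat (B t))"

lemma gain_carrier: "t < T \<Longrightarrow> gain t \<in> carrier_mat nu nx"
  using S_inv[of t] data_carrier[of t] unfolding gain_def
  by (intro smult_carrier_mat mult_carrier_mat[of _ nu nu]) auto

lemma gain_mult_vec:
  assumes t: "t < T" and y: "y \<in> carrier_vec nx"
  shows "gain t *\<^sub>v y = - (mat_inv (S t) *\<^sub>v (\<beta> \<cdot>\<^sub>v (transpose_mat (B t) *\<^sub>v y)))"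
proof -
  note I = S_inv(1)[OF t]
  have Bt: "transpose_mat (B t) \<in> carrier_mat nu nx" using data_carrier[OF t] by simp
  note By = mult_mat_vec_carrier[OF Bt y]
  show ?thesis
    unfolding gain_def smult_mat_mult_vec[OF mult_carrier_mat[OF I Bt] y] assoc_mult_mat_vec[OF I Bt y]
      mult_mat_vec[OF I By] by (intro eq_vecI) auto
qed

lemma feedforward_split:
  assumes t: "t < T" and z: "z t \<in> carrier_vec ny"
    and q: "M (Suc t) *\<^sub>v (C t *\<^sub>v z t + w t) + costate z w (Suc t) = q" "q \<in> carrier_vec nx"
  shows "feedforward z w t = - (mat_inv (S t) *\<^sub>v (transpose_mat (K t) *\<^sub>v z t)) + gain t *\<^sub>v q"
proof -
  note I = S_inv(1)[OF t]
  have Bt: "transpose_mat (B t) \<in> carrier_mat nu nx" and Kt: "transpose_mat (K t) \<in> carrier_mat nu ny"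
    using data_carrier[OF t] by auto
  have Kz: "transpose_mat (K t) *\<^sub>v z t \<in> carrier_vec nu" by (rule mult_mat_vec_carrier[OF Kt z])
  have Bq: "\<beta> \<cdot>\<^sub>v (transpose_mat (B t) *\<^sub>v q) \<in> carrier_vec nu"
    using mult_mat_vec_carrier[OF Bt q(2)] by simp
  show ?thesis
    unfolding feedforward_def q(1) gain_mult_vec[OF t q(2)] mult_add_distrib_mat_vec[OF I Kz Bq]
    using mult_mat_vec_carrier[OF I Kz] mult_mat_vec_carrier[OF I Bq] by (intro eq_vecI) auto
qed

lemma G_mat_diag_mult_vec:
  assumes t: "t < T" and z: "z t \<in> carrier_vec ny"
  shows "G_mat G i t t *\<^sub>v z t = - (mat_inv (S t) *\<^sub>v (transpose_mat (K t) *\<^sub>v z t)) + gain t *\<^sub>v lag z t t"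
proof -
  note I = S_inv(1)[OF t] and c = data_carrier[OF t]
  have M: "M (Suc t) \<in> carrier_mat nx nx" by (rule M_carrier) (use t in simp)
  have Bt: "transpose_mat (B t) \<in> carrier_mat nu nx" and Kt: "transpose_mat (K t) \<in> carrier_mat nu ny"
    using c by auto
  note BM = mult_carrier_mat[OF Bt M]
  note BMC = mult_carrier_mat[OF BM c(3)]
  have Kz: "transpose_mat (K t) *\<^sub>v z t \<in> carrier_vec nu" by (rule mult_mat_vec_carrier[OF Kt z])
  have Cz: "C t *\<^sub>v z t \<in> carrier_vec nx" by (rule mult_mat_vec_carrier[OF c(3) z])
  have MCz: "M (Suc t) *\<^sub>v (C t *\<^sub>v z t) \<in> carrier_vec nx" by (rule mult_mat_vec_carrier[OF M Cz])
  have b: "\<beta> \<cdot>\<^sub>v (transpose_mat (B t) *\<^sub>v (M (Suc t) *\<^sub>v (C t *\<^sub>v z t))) \<in> carrier_vec nu"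
    using mult_mat_vec_carrier[OF Bt MCz] by simp
  let ?X = "transpose_mat (K t) + \<beta> \<cdot>\<^sub>m (transpose_mat (B t) * M (Suc t) * C t)"
  have X: "?X \<in> carrier_mat nu ny" using Kt BMC by simp
  have Xz: "?X *\<^sub>v z t = transpose_mat (K t) *\<^sub>v z t + \<beta> \<cdot>\<^sub>v (transpose_mat (B t) *\<^sub>v (M (Suc t) *\<^sub>v (C t *\<^sub>v z t)))"
    unfolding add_mult_distrib_mat_vec[OF Kt smult_carrier_mat[OF BMC] z] smult_mat_mult_vec[OF BMC z]
      assoc_mult_mat_vec[OF BM c(3) z] assoc_mult_mat_vec[OF Bt M Cz] ..
  have "G_mat G i t t = - (mat_inv (S t) * ?X)" by (simp add: G_mat_def)
  then have "G_mat G i t t *\<^sub>v z t = - (mat_inv (S t) *\<^sub>v (?X *\<^sub>v z t))"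
    using uminus_mult_mat_vec[of "z t" "mat_inv (S t) * ?X"] assoc_mult_mat_vec[OF I X z]
      carrier_matD[OF mult_carrier_mat[OF I X]] carrier_vecD[OF z] by simp
  then show ?thesis
    unfolding Xz lag_refl[OF t] gain_mult_vec[OF t MCz] mult_add_distrib_mat_vec[OF I Kz b]
    using mult_mat_vec_carrier[OF I Kz] mult_mat_vec_carrier[OF I b]
    by (simp, intro eq_vecI) auto
qed

lemma G_mat_off_diag_mult_vec:
  assumes tk: "t < k" and k: "k < T" and z: "z k \<in> carrier_vec ny"
  shows "G_mat G i t k *\<^sub>v z k = gain t *\<^sub>v lag z t k"
proof -
  have t: "t < T" using tk k by simp
  note I = S_inv(1)[OF t] and c = data_carrier[OF k]
  have Bt: "transpose_mat (B t) \<in> carrier_mat nu nx" using data_carrier[OF t] by simp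
  have M: "M (Suc k) \<in> carrier_mat nx nx" by (rule M_carrier) (use k in simp)
  have P: "Phi G i t k \<in> carrier_mat nx nx" "Phi G i t (k - 1) \<in> carrier_mat nx nx"
    using tk k by (auto intro!: Phi_carrier)
  note PM = mult_carrier_mat[OF P(1) M]
  note PMC = mult_carrier_mat[OF PM c(3)]
  note PN = mult_carrier_mat[OF P(2) NK_carrier[OF k]]
  note IB = mult_carrier_mat[OF I Bt]
  let ?N = "NK k"
  let ?X = "Phi G i t k * M (Suc k) * C k + Phi G i t (k - 1) * ?N"
  have X: "?X \<in> carrier_mat nx ny" by (rule add_carrier_mat[OF PN])
  have "?X *\<^sub>v z k = lag z t k"
    unfolding add_mult_distrib_mat_vec[OF PMC PN z] lag_def assoc_mult_mat_vec[OF PM c(3) z]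
      assoc_mult_mat_vec[OF P(1) M mult_mat_vec_carrier[OF c(3) z]] assoc_mult_mat_vec[OF P(2) NK_carrier[OF k] z]
    using tk by simp
  moreover have "G_mat G i t k *\<^sub>v z k = gain t *\<^sub>v (?X *\<^sub>v z k)"
  proof -
    have "G_mat G i t k = - \<beta> \<cdot>\<^sub>m (mat_inv (S t) * transpose_mat (B t) * ?X)"
      using tk by (simp only: G_mat_def less_imp_neq[symmetric] if_False)
    then have "G_mat G i t k *\<^sub>v z k = - \<beta> \<cdot>\<^sub>v (mat_inv (S t) * transpose_mat (B t) *\<^sub>v (?X *\<^sub>v z k))"
      by (simp only: smult_mat_mult_vec[OF mult_carrier_mat[OF IB X] z] assoc_mult_mat_vec[OF IB X z])
    then show ?thesis
      by (simp only: gain_def smult_mat_mult_vec[OF IB mult_mat_vec_carrier[OF X z]])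
  qed
  ultimately show ?thesis by simp
qed

lemma G_mat_carrier: "t \<le> k \<Longrightarrow> k < T \<Longrightarrow> G_mat G i t k \<in> carrier_mat nu ny"
proof -
  assume tk: "t \<le> k" "k < T"
  then have t: "t < T" by simp
  have Bt: "transpose_mat (B t) \<in> carrier_mat nu nx" using data_carrier[OF t] by simp
  show ?thesis
    using S_inv(1)[OF t] mult_carrier_mat[OF S_inv(1)[OF t] Bt] NK_carrier[OF tk(2)] data_carrier[OF t] data_carrier[OF tk(2)]
    unfolding G_mat_def by (auto intro!: carrier_matI)
qed

text \<open>The clairvoyant control has the coefficients of the equilibrium strategy: replacing \<open>z\<^sub>k\<close> by
  forecasts and \<open>w\<^sub>k\<close> by means gives the control of a decision maker who knows the past
  only. This is certainty equivalence.\<close>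

lemma feedforward_explicit:
  assumes t: "t < T" and z: "\<And>k. k < T \<Longrightarrow> z k \<in> carrier_vec ny" and w: "\<And>k. k < T \<Longrightarrow> w k \<in> carrier_vec nx"
  shows "feedforward z w t = vec_sum nu (\<lambda>k. G_mat G i t k *\<^sub>v z k) {t..<T}
    + gain t *\<^sub>v vec_sum nx (\<lambda>k. PhiM t k *\<^sub>v w k) {t..<T}"
proof -
  let ?W = "vec_sum nx (\<lambda>k. PhiM t k *\<^sub>v w k) {t..<T}"
  let ?Z = "vec_sum nx (lag z t) {t..<T}"
  let ?Kz = "- (mat_inv (S t) *\<^sub>v (transpose_mat (K t) *\<^sub>v z t))"
  note g = gain_carrier[OF t]
  have PMw: "PhiM t k *\<^sub>v w k \<in> carrier_vec nx" if k: "t \<le> k" "k < T" for k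
    using mult_carrier_mat[OF Phi_carrier[OF k] M_carrier[of "Suc k"]] w[OF k(2)] k
    by (intro mult_mat_vec_carrier[of _ nx nx]) auto
  have l: "lag z t k \<in> carrier_vec nx" if "t \<le> k" "k < T" for k by (rule lag_carrier[OF that])
  have q: "M (Suc t) *\<^sub>v (C t *\<^sub>v z t + w t) + costate z w (Suc t) = ?Z + ?W"
  proof -
    have "vec_sum nx (\<lambda>k. lag z t k + PhiM t k *\<^sub>v w k) {t..<T} = ?Z + ?W"
      by (rule vec_sum_add) (use l PMw in auto)
    with costate_explicit[of t z w, OF t z w] show ?thesis by simp
  qed
  have Kz: "?Kz \<in> carrier_vec nu"
    using S_inv(1)[OF t] by (auto intro!: carrier_vecI)
  have "gain t *\<^sub>v ?Z = gain t *\<^sub>v lag z t t + gain t *\<^sub>v vec_sum nx (lag z t) {Suc t..<T}"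
    unfolding vec_sum_head[where f = "lag z t", OF t l[OF order_refl t]]
    by (rule mult_add_distrib_mat_vec[OF g l[OF order_refl t] vec_sum_carrier])
  also have "gain t *\<^sub>v vec_sum nx (lag z t) {Suc t..<T} = vec_sum nu (\<lambda>k. G_mat G i t k *\<^sub>v z k) {Suc t..<T}"
    using l z G_mat_off_diag_mult_vec[where z = z] by (subst mult_mat_vec_sum[OF g]) (auto intro!: vec_sum_cong)
  finally have gZ: "?Kz + gain t *\<^sub>v ?Z
      = G_mat G i t t *\<^sub>v z t + vec_sum nu (\<lambda>k. G_mat G i t k *\<^sub>v z k) {Suc t..<T}"
    unfolding G_mat_diag_mult_vec[of t z, OF t z[OF t]] using Kz mult_mat_vec_carrier[OF g l[OF order_refl t]]
    by (intro eq_vecI) auto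
  have "feedforward z w t = ?Kz + gain t *\<^sub>v (?Z + ?W)"
    by (rule feedforward_split[where z = z, OF t z[OF t] q]) simp
  also have "\<dots> = (?Kz + gain t *\<^sub>v ?Z) + gain t *\<^sub>v ?W"
    unfolding mult_add_distrib_mat_vec[OF g vec_sum_carrier vec_sum_carrier]
    using Kz mult_mat_vec_carrier[OF g, of ?Z] mult_mat_vec_carrier[OF g, of ?W] by (intro eq_vecI) auto
  also have "?Kz + gain t *\<^sub>v ?Z = vec_sum nu (\<lambda>k. G_mat G i t k *\<^sub>v z k) {t..<T}"
    unfolding gZ using mult_mat_vec_carrier[OF G_mat_carrier[OF order_refl t] z[OF t]]
    by (intro vec_sum_head[symmetric, OF t])
  finally show ?thesis .
qed

lemma H_vec_explicit:
  assumes t: "t < T"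
  shows "H_vec G i t = gain t *\<^sub>v vec_sum nx
     (\<lambda>k. PhiM t k *\<^sub>v vec_expectation (\<Omega> G) nx (wdist G i k)) {t..<T}"
  unfolding H_vec_def gain_def
  by (rule smult_mat_mult_vec[symmetric, OF mult_carrier_mat[OF S_inv(1)[OF t]]])
    (use data_carrier[OF t] in auto)

end

section \<open>Weighted means and product measures\<close>

text \<open>Averages against a bounded weight that depends on the observations take the place of
  conditional expectations: they are vectors rather than random variables, and they turn linear
  recursions between random vectors into linear recursions between numbers.\<close>

definition weighted_mean :: "'a measure \<Rightarrow> ('a \<Rightarrow> real) \<Rightarrow> nat \<Rightarrow> ('a \<Rightarrow> real vec) \<Rightarrow> real vec" where
  "weighted_mean M g n X = vec n (\<lambda>r. \<integral>x. g x * X x $ r \<partial>M)"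

lemma weighted_mean_carrier [simp]: "weighted_mean M g n X \<in> carrier_vec n"
  and dim_weighted_mean [simp]: "dim_vec (weighted_mean M g n X) = n"
  and index_weighted_mean [simp]: "r < n \<Longrightarrow> weighted_mean M g n X $ r = (\<integral>x. g x * X x $ r \<partial>M)"
  by (simp_all add: weighted_mean_def)

lemma weighted_mean_cong:
  "(\<And>x. x \<in> space M \<Longrightarrow> X x = Y x) \<Longrightarrow> weighted_mean M g n X = weighted_mean M g n Y"
  unfolding weighted_mean_def by (intro arg_cong[of _ _ "vec n"] ext Bochner_Integration.integral_cong) auto

locale bounded_weight = finite_measure M for M :: "'a measure" +
  fixes g :: "'a \<Rightarrow> real" and bound :: real
  assumes g_meas: "g \<in> borel_measurable M" and g_bounded: "\<And>x. x \<in> space M \<Longrightarrow> \<bar>g x\<bar> \<le> bound"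
begin

lemma weighted_integrable: "L2_vec M n X \<Longrightarrow> r < n \<Longrightarrow> integrable M (\<lambda>x. g x * X x $ r)"
  by (rule integrable_bounded_mult[OF L2_rv_integrable[OF L2_vec_index] g_meas g_bounded])

lemma weighted_mean_add:
  assumes X: "L2_vec M n X" and Y: "L2_vec M n Y"
  shows "weighted_mean M g n (\<lambda>x. X x + Y x) = weighted_mean M g n X + weighted_mean M g n Y"
proof (rule eq_vecI)
  fix r assume "r < dim_vec (weighted_mean M g n X + weighted_mean M g n Y)"
  then have r: "r < n" by simp
  have "(\<integral>x. g x * (X x + Y x) $ r \<partial>M) = (\<integral>x. g x * X x $ r + g x * Y x $ r \<partial>M)"
    using r carrier_vecD[OF L2_vec_carrier[OF Y]]
    by (intro Bochner_Integration.integral_cong) (simp_all add: distrib_left)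
  then show "weighted_mean M g n (\<lambda>x. X x + Y x) $ r = (weighted_mean M g n X + weighted_mean M g n Y) $ r"
    using r weighted_integrable[OF X r] weighted_integrable[OF Y r] by simp
qed simp

lemma weighted_mean_minus:
  assumes X: "L2_vec M n X" and Y: "L2_vec M n Y"
  shows "weighted_mean M g n (\<lambda>x. X x - Y x) = weighted_mean M g n X - weighted_mean M g n Y"
proof (rule eq_vecI)
  fix r assume "r < dim_vec (weighted_mean M g n X - weighted_mean M g n Y)"
  then have r: "r < n" by simp
  have "(\<integral>x. g x * (X x - Y x) $ r \<partial>M) = (\<integral>x. g x * X x $ r - g x * Y x $ r \<partial>M)"
    using r carrier_vecD[OF L2_vec_carrier[OF Y]]
    by (intro Bochner_Integration.integral_cong) (simp_all add: right_diff_distrib)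
  then show "weighted_mean M g n (\<lambda>x. X x - Y x) $ r = (weighted_mean M g n X - weighted_mean M g n Y) $ r"
    using r weighted_integrable[OF X r] weighted_integrable[OF Y r] by simp
qed simp

lemma weighted_mean_sum:
  assumes X: "\<And>k. k \<in> S \<Longrightarrow> L2_vec M n (X k)"
  shows "weighted_mean M g n (\<lambda>x. vec_sum n (\<lambda>k. X k x) S) = vec_sum n (\<lambda>k. weighted_mean M g n (X k)) S"
proof (rule eq_vecI)
  fix r assume "r < dim_vec (vec_sum n (\<lambda>k. weighted_mean M g n (X k)) S)"
  then have r: "r < n" by simp
  have "(\<integral>x. g x * vec_sum n (\<lambda>k. X k x) S $ r \<partial>M) = (\<integral>x. (\<Sum>k\<in>S. g x * X k x $ r) \<partial>M)"
    using r by (intro Bochner_Integration.integral_cong) (simp_all add: sum_distrib_left)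
  also have "\<dots> = (\<Sum>k\<in>S. \<integral>x. g x * X k x $ r \<partial>M)"
    by (rule Bochner_Integration.integral_sum) (rule weighted_integrable[OF X r])
  finally show "weighted_mean M g n (\<lambda>x. vec_sum n (\<lambda>k. X k x) S) $ r
      = vec_sum n (\<lambda>k. weighted_mean M g n (X k)) S $ r"
    using r by simp
qed simp

lemma weighted_mean_mult_mat:
  assumes A: "A \<in> carrier_mat m n" and X: "L2_vec M n X"
  shows "weighted_mean M g m (\<lambda>x. A *\<^sub>v X x) = A *\<^sub>v weighted_mean M g n X"
proof (rule eq_vecI)
  fix r assume "r < dim_vec (A *\<^sub>v weighted_mean M g n X)"
  then have r: "r < m" using A by simp
  have "(\<integral>x. g x * (A *\<^sub>v X x) $ r \<partial>M) = (\<integral>x. (\<Sum>c<n. A $$ (r, c) * (g x * X x $ c)) \<partial>M)"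
    using mult_mat_vec_index_sum[OF A L2_vec_carrier[OF X] r]
    by (intro Bochner_Integration.integral_cong) (simp_all add: sum_distrib_left mult_ac)
  also have "\<dots> = (\<Sum>c<n. \<integral>x. A $$ (r, c) * (g x * X x $ c) \<partial>M)"
    by (rule Bochner_Integration.integral_sum) (auto intro!: weighted_integrable[OF X])
  also have "\<dots> = (A *\<^sub>v weighted_mean M g n X) $ r"
    unfolding mult_mat_vec_index_sum[OF A weighted_mean_carrier r] by simp
  finally show "weighted_mean M g m (\<lambda>x. A *\<^sub>v X x) $ r = (A *\<^sub>v weighted_mean M g n X) $ r"
    using r by simp
qed (use A in simp)

lemma weighted_mean_const:
  assumes c: "c \<in> carrier_vec n"
  shows "weighted_mean M g n (\<lambda>x. c) = (\<integral>x. g x \<partial>M) \<cdot>\<^sub>v c"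
  using c by (intro eq_vecI) auto

end

lemma (in prob_space) distr_pair_snd: "sigma_finite_measure N \<Longrightarrow> distr (M \<Otimes>\<^sub>M N) N snd = N"
proof (rule measure_eqI)
  assume "sigma_finite_measure N"
  then interpret N: sigma_finite_measure N .
  fix X assume X: "X \<in> sets (distr (M \<Otimes>\<^sub>M N) N snd)"
  then have "emeasure (distr (M \<Otimes>\<^sub>M N) N snd) X = emeasure (M \<Otimes>\<^sub>M N) (space M \<times> X)"
    by (auto simp: emeasure_distr space_pair_measure dest: sets.sets_into_space intro!: arg_cong2[where f=emeasure])
  with X show "emeasure (distr (M \<Otimes>\<^sub>M N) N snd) X = emeasure N X"
    by (simp add: N.emeasure_pair_measure_Times emeasure_space_1)
qed simp

lemma L2_rv_distr:
  assumes \<pi>: "\<pi> \<in> M \<rightarrow>\<^sub>M N" and f: "L2_rv (distr M N \<pi>) f"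
  shows "L2_rv M (\<lambda>x. f (\<pi> x))"
  using f measurable_compose[OF \<pi>, of f borel] unfolding L2_rv_def
  by (auto simp: integrable_distr_eq[OF \<pi>] borel_measurable_power)

lemma L2_vec_distr:
  assumes \<pi>: "\<pi> \<in> M \<rightarrow>\<^sub>M N" and X: "L2_vec (distr M N \<pi>) n X"
  shows "L2_vec M n (\<lambda>x. X (\<pi> x))"
  using X measurable_space[OF \<pi>] L2_rv_distr[OF \<pi>] unfolding L2_vec_def by auto

lemma L2_vec_distrI:
  assumes \<pi>: "\<pi> \<in> M \<rightarrow>\<^sub>M N" and X: "X \<in> N \<rightarrow>\<^sub>M borel_vec n" and L2: "L2_vec M n (\<lambda>x. X (\<pi> x))"
  shows "L2_vec (distr M N \<pi>) n X"
  unfolding L2_vec_def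
proof (intro conjI allI impI ballI)
  fix x assume "x \<in> space (distr M N \<pi>)"
  then show "X x \<in> carrier_vec n" using borel_vec_carrier[OF X] by simp
next
  fix r assume r: "r < n"
  have m: "(\<lambda>x. X x $ r) \<in> borel_measurable N" by (rule borel_vec_index[OF X r])
  have "(\<lambda>x. (X x $ r)\<^sup>2) \<in> borel_measurable N" using m by (rule borel_measurable_power)
  from integrable_distr_eq[OF \<pi> this] L2_vec_index[OF L2 r] m
  show "L2_rv (distr M N \<pi>) (\<lambda>x. X x $ r)" by (simp add: L2_rv_def)
qed

lemma L2_vec_fst:
  assumes "prob_space M2" "L2_vec M1 n X"
  shows "L2_vec (M1 \<Otimes>\<^sub>M M2) n (\<lambda>p. X (fst p))"
  using L2_vec_distr[OF measurable_fst, of M1 M2 n X] prob_space.distr_pair_fst[OF assms(1), of M1] assms(2)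
  by simp

lemma L2_vec_snd:
  assumes "prob_space M1" "sigma_finite_measure M2" "L2_vec M2 n X"
  shows "L2_vec (M1 \<Otimes>\<^sub>M M2) n (\<lambda>p. X (snd p))"
  using L2_vec_distr[OF measurable_snd, of M1 M2 n X] prob_space.distr_pair_snd[OF assms(1,2)] assms(3)
  by simp

declare subj_x.simps [simp del] subj_u.simps [simp del]

context decision_maker
begin

text \<open>A strategy at time \<open>k\<close> reads the exogenous sequence before \<open>k\<close> only. This makes states and controls
  functions of the information available at time \<open>t\<close>.\<close>

lemma subj_restrict:
  "k \<le> t \<Longrightarrow> subj_x G i s (restrict z {..<t}) \<omega> k = subj_x G i s z \<omega> k \<and>
     subj_u G i s (restrict z {..<t}) \<omega> k = subj_u G i s z \<omega> k"
proof (induction k rule: less_induct)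
  case (less k)
  have IH: "subj_x G i s (restrict z {..<t}) \<omega> j = subj_x G i s z \<omega> j"
    "subj_u G i s (restrict z {..<t}) \<omega> j = subj_u G i s z \<omega> j" if "j < k" for j
    using less.IH[OF that less_imp_le[OF less_le_trans[OF that less.prems]]] by (rule conjunct1, rule conjunct2)
  have x: "subj_x G i s (restrict z {..<t}) \<omega> k = subj_x G i s z \<omega> k"
    using IH less.prems by (cases k) (simp_all add: subj_x.simps)
  have "(\<lambda>j\<in>{..k}. subj_x G i s (restrict z {..<t}) \<omega> j) = (\<lambda>j\<in>{..k}. subj_x G i s z \<omega> j)"
    using IH x by (intro restrict_ext) (auto simp: le_less)
  moreover have "(\<lambda>j\<in>{..<k}. subj_u G i s (restrict z {..<t}) \<omega> j) = (\<lambda>j\<in>{..<k}. subj_u G i s z \<omega> j)"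
    using IH by (intro restrict_ext) auto
  moreover have "(\<lambda>j\<in>{..<k}. restrict z {..<t} j) = (\<lambda>j\<in>{..<k}. z j)"
    using less.prems by (intro restrict_ext) auto
  ultimately have "subj_u G i s (restrict z {..<t}) \<omega> k = subj_u G i s z \<omega> k"
    by (subst (1 2) subj_u.simps) (simp only:)
  with x show ?case ..
qed

lemma measurable_Y_component: "k < t \<Longrightarrow> (\<lambda>p. fst p k) \<in> Y_seqs G t \<Otimes>\<^sub>M N \<rightarrow>\<^sub>M borel_vec ny"
  unfolding Y_seqs_def
  by (rule measurable_compose[OF measurable_fst measurable_component_singleton]) simp

text \<open>The \<open>\<sigma>\<close>-algebra \<open>N\<close> is arbitrary. With the full one on \<open>\<Omega>\<close> the lemma makes expected costs well-behaved;
  with the one generated by the disturbances before \<open>t\<close> it says that controls are adapted.\<close>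

lemma measurable_subj:
  assumes s: "s \<in> pure_strategies G i" and t: "t \<le> T"
    and init: "init G i \<in> N \<rightarrow>\<^sub>M borel_vec nx" and dist: "\<And>k. k < t \<Longrightarrow> wdist G i k \<in> N \<rightarrow>\<^sub>M borel_vec nx"
  shows "k \<le> t \<Longrightarrow>
    (\<lambda>p. subj_x G i s (fst p) (snd p) k) \<in> Y_seqs G t \<Otimes>\<^sub>M N \<rightarrow>\<^sub>M borel_vec nx \<and>
    (k < T \<longrightarrow> (\<lambda>p. subj_u G i s (fst p) (snd p) k) \<in> Y_seqs G t \<Otimes>\<^sub>M N \<rightarrow>\<^sub>M borel_vec nu)"
proof (induction k rule: less_induct)
  case (less k)
  let ?N = "Y_seqs G t \<Otimes>\<^sub>M N"
  have IHx: "(\<lambda>p. subj_x G i s (fst p) (snd p) j) \<in> ?N \<rightarrow>\<^sub>M borel_vec nx" if "j < k" for j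
    using less that by auto
  have IHu: "(\<lambda>p. subj_u G i s (fst p) (snd p) j) \<in> ?N \<rightarrow>\<^sub>M borel_vec nu" if "j < k" for j
    using less that t by auto
  have x: "(\<lambda>p. subj_x G i s (fst p) (snd p) k) \<in> ?N \<rightarrow>\<^sub>M borel_vec nx"
  proof (cases k)
    case 0
    then show ?thesis
      using measurable_compose[OF measurable_snd init] by (simp add: subj_x.simps)
  next
    case (Suc j)
    then have j: "j < t" "j < T" "j < k" using less.prems t by auto
    note c = data_carrier[OF j(2)]
    show ?thesis
      unfolding Suc subj_x.simps
      by (intro borel_vec_add borel_vec_mult_mat[OF c(1)] borel_vec_mult_mat[OF c(2)] borel_vec_mult_mat[OF c(3)]
          IHx IHu measurable_Y_component measurable_compose[OF measurable_snd dist] j)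
  qed
  have "(\<lambda>p. subj_u G i s (fst p) (snd p) k) \<in> ?N \<rightarrow>\<^sub>M borel_vec nu" if "k < T"
  proof -
    have sk: "s k \<in> ((\<Pi>\<^sub>M k\<in>{..k}. X_space G i) \<Otimes>\<^sub>M (\<Pi>\<^sub>M k\<in>{..<k}. U_space G i)) \<Otimes>\<^sub>M Y_seqs G k
              \<rightarrow>\<^sub>M borel_vec nu"
      using s that unfolding pure_strategies_def U_space_def by auto
    have "(\<lambda>p. ((\<lambda>j\<in>{..k}. subj_x G i s (fst p) (snd p) j, \<lambda>j\<in>{..<k}. subj_u G i s (fst p) (snd p) j),
        \<lambda>j\<in>{..<k}. fst p j)) \<in> ?N \<rightarrow>\<^sub>M ((\<Pi>\<^sub>M k\<in>{..k}. X_space G i) \<Otimes>\<^sub>M (\<Pi>\<^sub>M k\<in>{..<k}. U_space G i)) \<Otimes>\<^sub>M Y_seqs G k"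
      unfolding X_space_def U_space_def Y_seqs_def[of G k]
      using IHx IHu x less.prems
      by (intro measurable_Pair measurable_restrict measurable_Y_component) (auto simp: le_less)
    from measurable_compose[OF this sk] show ?thesis by (subst subj_u.simps)
  qed
  with x show ?case by simp
qed

lemma subj_x_carrier:
  assumes s: "s \<in> pure_strategies G i" and z: "z \<in> space (Y_seqs G T)" and \<omega>: "\<omega> \<in> space (\<Omega> G)"
  shows "k \<le> T \<Longrightarrow> subj_x G i s z \<omega> k \<in> carrier_vec nx" "k < T \<Longrightarrow> subj_u G i s z \<omega> k \<in> carrier_vec nu"
proof -
  have "init G i \<in> \<Omega> G \<rightarrow>\<^sub>M borel_vec nx" "\<And>k. k < T \<Longrightarrow> wdist G i k \<in> \<Omega> G \<rightarrow>\<^sub>M borel_vec nx"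
    using valid i_le unfolding valid_game_def by auto
  from measurable_subj[OF s order_refl this] have
    m: "k \<le> T \<Longrightarrow> (\<lambda>p. subj_x G i s (fst p) (snd p) k) \<in> Y_seqs G T \<Otimes>\<^sub>M \<Omega> G \<rightarrow>\<^sub>M borel_vec nx"
    "k < T \<Longrightarrow> (\<lambda>p. subj_u G i s (fst p) (snd p) k) \<in> Y_seqs G T \<Otimes>\<^sub>M \<Omega> G \<rightarrow>\<^sub>M borel_vec nu" for k
    by auto
  have "(z, \<omega>) \<in> space (Y_seqs G T \<Otimes>\<^sub>M \<Omega> G)" using z \<omega> by (simp add: space_pair_measure)
  with borel_vec_carrier[OF m(1)] borel_vec_carrier[OF m(2)]
  show "k \<le> T \<Longrightarrow> subj_x G i s z \<omega> k \<in> carrier_vec nx" "k < T \<Longrightarrow> subj_u G i s z \<omega> k \<in> carrier_vec nu"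
    by fastforce+
qed

lemma prob_space_\<Omega>: "prob_space (\<Omega> G)" using valid by (simp add: valid_game_def)

lemma init_measurable: "init G i \<in> \<Omega> G \<rightarrow>\<^sub>M borel_vec nx"
  and wdist_measurable: "k < T \<Longrightarrow> wdist G i k \<in> \<Omega> G \<rightarrow>\<^sub>M borel_vec nx"
  using valid i_le unfolding valid_game_def by auto

lemma Y_seqs_carrier: "z \<in> space (Y_seqs G t) \<Longrightarrow> k < t \<Longrightarrow> z k \<in> carrier_vec ny"
  by (auto simp: Y_seqs_def space_PiM PiE_def)

lemma L2_costate:
  assumes "finite_measure N" and Z: "\<And>k. k < T \<Longrightarrow> L2_vec N ny (Z k)" and W: "\<And>k. k < T \<Longrightarrow> L2_vec N nx (W k)"
  shows "k \<le> T \<Longrightarrow> L2_vec N nx (\<lambda>x. costate (\<lambda>k. Z k x) (\<lambda>k. W k x) k)"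
proof (induction k rule: inc_induct)
  interpret finite_measure N by fact
  case base
  show ?case by (subst costate.simps) (simp add: L2_vec_const)
next
  interpret finite_measure N by fact
  case (step k)
  then have k: "k < T" by simp
  note c = data_carrier[OF k]
  have ABF: "transpose_mat (A k + B k * F k) \<in> carrier_mat nx nx" using c F_carrier[OF k] by simp
  have M: "M (Suc k) \<in> carrier_mat nx nx" by (rule M_carrier) (use k in simp)
  show ?case
    using k
    by (subst costate.simps) (auto intro!: L2_vec_add L2_vec_smult L2_vec_mult_mat[OF NK_carrier[OF k]] L2_vec_mult_mat[OF ABF]
        L2_vec_mult_mat[OF M] L2_vec_mult_mat[OF c(3)] Z W step.IH)
qed

lemma L2_feedforward:
  assumes "finite_measure N" and Z: "\<And>k. k < T \<Longrightarrow> L2_vec N ny (Z k)" and W: "\<And>k. k < T \<Longrightarrow> L2_vec N nx (W k)"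
    and k: "k < T"
  shows "L2_vec N nu (\<lambda>x. feedforward (\<lambda>k. Z k x) (\<lambda>k. W k x) k)"
proof -
  interpret finite_measure N by fact
  note c = data_carrier[OF k]
  have M: "M (Suc k) \<in> carrier_mat nx nx" by (rule M_carrier) (use k in simp)
  have Kt: "transpose_mat (K k) \<in> carrier_mat nu ny" and Bt: "transpose_mat (B k) \<in> carrier_mat nu nx"
    using c by auto
  have p: "L2_vec N nx (\<lambda>x. costate (\<lambda>k. Z k x) (\<lambda>k. W k x) (Suc k))"
    by (rule L2_costate[OF assms(1) Z W]) (use k in auto)
  show ?thesis
    unfolding feedforward_def
    by (intro L2_vec_uminus L2_vec_add L2_vec_smult L2_vec_mult_mat[OF S_inv(1)[OF k]] L2_vec_mult_mat[OF Kt]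
        L2_vec_mult_mat[OF Bt] L2_vec_mult_mat[OF M] L2_vec_mult_mat[OF c(3)] Z W p k)
qed

lemma integrable_unavoidable_cost:
  assumes "finite_measure N" and X: "L2_vec N nx X0"
    and Z: "\<And>k. k < T \<Longrightarrow> L2_vec N ny (Z k)" and W: "\<And>k. k < T \<Longrightarrow> L2_vec N nx (W k)"
  shows "integrable N (\<lambda>x. unavoidable_cost (X0 x) (\<lambda>k. Z k x) (\<lambda>k. W k x))"
proof -
  interpret finite_measure N by fact
  have M: "M k \<in> carrier_mat nx nx" if "k \<le> T" for k by (rule M_carrier[OF that])
  have d: "L2_vec N nx (\<lambda>x. C t *\<^sub>v Z t x + W t x)" if t: "t < T" for t
    by (intro L2_vec_add L2_vec_mult_mat[OF data_carrier(3)[OF t]] Z W t)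
  note p = L2_costate[OF assms(1) Z W]
  show ?thesis
    unfolding unavoidable_cost_def
    by (intro Bochner_Integration.integrable_add Bochner_Integration.integrable_diff integrable_mult_right
        Bochner_Integration.integrable_sum L2_vec_quad[OF M] L2_vec_quad[OF S_carrier] L2_vec_scalar_prod[of nx] p X d
        L2_feedforward[OF assms(1) Z W]) auto
qed

text \<open>The only part of the stage cost at time \<open>t\<close> that the strategy influences, after completion of the
  square.\<close>

definition excess_cost :: "strategy \<Rightarrow> nat \<Rightarrow> (nat \<Rightarrow> real vec) \<times> 'w \<Rightarrow> real" where
  "excess_cost s t = (\<lambda>(z, \<omega>). quad (S t) (subj_u G i s z \<omega> t
     - (F t *\<^sub>v subj_x G i s z \<omega> t + feedforward z (\<lambda>k. wdist G i k \<omega>) t)))"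

end

section \<open>The optimal response to an exogenous sequence\<close>

context decision_maker
begin

text \<open>The feedforward part of a strategy that replaces future environment variables by the forecasts
  \<open>pred\<close> and disturbances by their means.\<close>

definition response :: "(nat \<Rightarrow> nat \<Rightarrow> (nat \<Rightarrow> real vec) \<Rightarrow> real vec) \<Rightarrow> nat \<Rightarrow> (nat \<Rightarrow> real vec) \<Rightarrow> real vec" where
  "response pred t y = vec_sum nu (\<lambda>k. G_mat G i t k *\<^sub>v pred t k y) {t..<T} + H_vec G i t"

lemma H_vec_carrier: "t < T \<Longrightarrow> H_vec G i t \<in> carrier_vec nu"
  unfolding H_vec_explicit by (rule mult_mat_vec_carrier[OF gain_carrier]) auto

lemma response_carrier: "t < T \<Longrightarrow> response pred t y \<in> carrier_vec nu"
  unfolding response_def using H_vec_carrier by simp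

lemma response_error:
  assumes t: "t < T" and y: "\<And>k. t \<le> k \<Longrightarrow> k < T \<Longrightarrow> pred t k y \<in> carrier_vec ny"
    and z: "\<And>k. k < T \<Longrightarrow> z k \<in> carrier_vec ny" and w: "\<And>k. k < T \<Longrightarrow> w k \<in> carrier_vec nx"
  shows "response pred t y - feedforward z w t
    = vec_sum nu (\<lambda>k. G_mat G i t k *\<^sub>v (pred t k y - z k)) {t..<T}
      + gain t *\<^sub>v vec_sum nx (\<lambda>k. PhiM t k *\<^sub>v
          (vec_expectation (\<Omega> G) nx (wdist G i k) - w k)) {t..<T}"
proof -
  let ?Ew = "\<lambda>k. vec_expectation (\<Omega> G) nx (wdist G i k)"
  let ?PM = "\<lambda>k. Phi G i t k * M (Suc k)"
  have Ew: "?Ew k \<in> carrier_vec nx" for k by (simp add: vec_expectation_def)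
  have PM: "?PM k \<in> carrier_mat nx nx" if "t \<le> k" "k < T" for k
    by (rule mult_carrier_mat[OF Phi_carrier[OF that] M_carrier]) (use that in simp)
  note g = gain_carrier[OF t]
  have 1: "vec_sum nu (\<lambda>k. G_mat G i t k *\<^sub>v (pred t k y - z k)) {t..<T}
      = vec_sum nu (\<lambda>k. G_mat G i t k *\<^sub>v pred t k y) {t..<T} - vec_sum nu (\<lambda>k. G_mat G i t k *\<^sub>v z k) {t..<T}"
  proof -
    have "vec_sum nu (\<lambda>k. G_mat G i t k *\<^sub>v (pred t k y - z k)) {t..<T}
        = vec_sum nu (\<lambda>k. G_mat G i t k *\<^sub>v pred t k y - G_mat G i t k *\<^sub>v z k) {t..<T}"
      using y z by (intro vec_sum_cong refl mult_minus_distrib_mat_vec[OF G_mat_carrier]) auto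
    also have "\<dots> = vec_sum nu (\<lambda>k. G_mat G i t k *\<^sub>v pred t k y) {t..<T} - vec_sum nu (\<lambda>k. G_mat G i t k *\<^sub>v z k) {t..<T}"
      using y z by (intro vec_sum_minus mult_mat_vec_carrier[OF G_mat_carrier]) auto
    finally show ?thesis .
  qed
  have 2: "gain t *\<^sub>v vec_sum nx (\<lambda>k. ?PM k *\<^sub>v (?Ew k - w k)) {t..<T}
      = gain t *\<^sub>v vec_sum nx (\<lambda>k. ?PM k *\<^sub>v ?Ew k) {t..<T} - gain t *\<^sub>v vec_sum nx (\<lambda>k. ?PM k *\<^sub>v w k) {t..<T}"
  proof -
    have "vec_sum nx (\<lambda>k. ?PM k *\<^sub>v (?Ew k - w k)) {t..<T} = vec_sum nx (\<lambda>k. ?PM k *\<^sub>v ?Ew k - ?PM k *\<^sub>v w k) {t..<T}"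
      using Ew w by (intro vec_sum_cong refl mult_minus_distrib_mat_vec[OF PM]) auto
    also have "\<dots> = vec_sum nx (\<lambda>k. ?PM k *\<^sub>v ?Ew k) {t..<T} - vec_sum nx (\<lambda>k. ?PM k *\<^sub>v w k) {t..<T}"
      using Ew w by (intro vec_sum_minus mult_mat_vec_carrier[OF PM]) auto
    finally show ?thesis by (simp add: mult_minus_distrib_mat_vec[OF g])
  qed
  have c: "gain t *\<^sub>v v \<in> carrier_vec nu" if "v \<in> carrier_vec nx" for v
    by (rule mult_mat_vec_carrier[OF g that])
  have arrange: "(a + b) - (c + d) = (a - c) + (b - d)"
    if "a \<in> carrier_vec nu" "b \<in> carrier_vec nu" "c \<in> carrier_vec nu" "d \<in> carrier_vec nu" for a b c d :: "real vec"
    using that by (intro eq_vecI) auto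
  have 3: "feedforward z w t = vec_sum nu (\<lambda>k. G_mat G i t k *\<^sub>v z k) {t..<T}
    + gain t *\<^sub>v vec_sum nx (\<lambda>k. ?PM k *\<^sub>v w k) {t..<T}"
    by (rule feedforward_explicit[OF t]) (use z w in auto)
  show ?thesis
    unfolding 1 2 3 response_def H_vec_explicit[OF t] by (rule arrange) (auto intro!: c)
qed

end

text \<open>One decision maker with a belief about the exogenous sequence. The sequence is independent of
  the primitive random variables, so everything lives on the product space \<open>P\<close>.\<close>

locale exogenous_belief = decision_maker G i for G :: "'w lq_game" and i :: nat +
  fixes \<zeta> :: "(nat \<Rightarrow> real vec) measure"
  assumes belief: "\<zeta> \<in> beliefs G"
    and belief_L2: "\<And>k. k < T \<Longrightarrow> L2_vec \<zeta> ny (\<lambda>z. z k)"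
    and init_L2: "L2_vec (\<Omega> G) nx (init G i)"
    and wdist_L2: "\<And>k. k < T \<Longrightarrow> L2_vec (\<Omega> G) nx (wdist G i k)"
begin

lemma prob_space_\<zeta>: "prob_space \<zeta>" and sets_\<zeta>: "sets \<zeta> = sets (Y_seqs G T)"
  using belief by (auto simp: beliefs_def)

lemma space_\<zeta>: "space \<zeta> = space (Y_seqs G T)"
  by (rule sets_eq_imp_space_eq[OF sets_\<zeta>])

sublocale Om: prob_space "\<Omega> G" by (rule prob_space_\<Omega>)
sublocale Ze: prob_space \<zeta> by (rule prob_space_\<zeta>)
sublocale PP: pair_prob_space \<zeta> "\<Omega> G" ..

abbreviation "P \<equiv> \<zeta> \<Otimes>\<^sub>M \<Omega> G"

lemma sets_P: "sets P = sets (Y_seqs G T \<Otimes>\<^sub>M \<Omega> G)"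
  by (rule sets_pair_measure_cong[OF sets_\<zeta> refl])

lemma Z_L2: "k < T \<Longrightarrow> L2_vec P ny (\<lambda>p. fst p k)"
  using L2_vec_fst[OF prob_space_\<Omega> belief_L2] .

lemma W_L2: "k < T \<Longrightarrow> L2_vec P nx (\<lambda>p. wdist G i k (snd p))"
  using L2_vec_snd[OF prob_space_\<zeta> Om.sigma_finite_measure_axioms wdist_L2] .

lemma X0_L2: "L2_vec P nx (\<lambda>p. init G i (snd p))"
  using L2_vec_snd[OF prob_space_\<zeta> Om.sigma_finite_measure_axioms init_L2] .

lemma feedforward_L2: "t < T \<Longrightarrow> L2_vec P nu (\<lambda>p. feedforward (fst p) (\<lambda>k. wdist G i k (snd p)) t)"
  using L2_feedforward[OF PP.P.finite_measure_axioms Z_L2 W_L2] by simp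

lemma subj_measurable_P:
  assumes s: "s \<in> pure_strategies G i"
  shows "k \<le> T \<Longrightarrow> (\<lambda>p. subj_x G i s (fst p) (snd p) k) \<in> P \<rightarrow>\<^sub>M borel_vec nx"
    and "k < T \<Longrightarrow> (\<lambda>p. subj_u G i s (fst p) (snd p) k) \<in> P \<rightarrow>\<^sub>M borel_vec nu"
  using measurable_subj[OF s order_refl init_measurable wdist_measurable]
  unfolding measurable_cong_sets[OF sets_P refl] by auto

lemma excess_cost_measurable:
  assumes s: "s \<in> pure_strategies G i" and t: "t < T"
  shows "excess_cost s t \<in> borel_measurable P"
  unfolding excess_cost_def split_beta'
  using t by (intro borel_measurable_quad[OF S_carrier[OF t]] borel_vec_minus borel_vec_add
      borel_vec_mult_mat[OF F_carrier[OF t]] subj_measurable_P[OF s] L2_vec_measurable[OF feedforward_L2]) auto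

lemma excess_cost_nonneg:
  assumes s: "s \<in> pure_strategies G i" and t: "t < T" and p: "p \<in> space P"
  shows "0 \<le> excess_cost s t p"
proof -
  have "fst p \<in> space (Y_seqs G T)" "snd p \<in> space (\<Omega> G)"
    using p by (auto simp: space_pair_measure space_\<zeta>)
  then have "subj_u G i s (fst p) (snd p) t - (F t *\<^sub>v subj_x G i s (fst p) (snd p) t
      + feedforward (fst p) (\<lambda>k. wdist G i k (snd p)) t) \<in> carrier_vec nu"
    using subj_x_carrier[OF s, of "fst p" "snd p" t] F_carrier[OF t] feedforward_carrier[OF t] t by auto
  then show ?thesis
    unfolding excess_cost_def split_beta' by (rule pos_definite_quad_nonneg[OF S_pos_definite[OF t]])
qed

text \<open>For a fixed exogenous sequence the cost is an integrable random variable, common to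
  all strategies, plus nonnegative terms; hence it is never \<open>- \<infinity>\<close> and the order of
  integration does not matter later on.\<close>

lemma subj_cost_decomposition:
  assumes s: "s \<in> pure_strategies G i" and z: "z \<in> space \<zeta>"
  shows "subj_cost G i s z
    = ereal (\<integral>\<omega>. unavoidable_cost (init G i \<omega>) z (\<lambda>k. wdist G i k \<omega>) \<partial>\<Omega> G)
      + enn2ereal (\<integral>\<^sup>+\<omega>. (\<Sum>t<T. ennreal (\<beta> ^ t) * ennreal (excess_cost s t (z, \<omega>))) \<partial>\<Omega> G)"
  unfolding subj_cost_def
proof (rule ext_expectation_add_nonneg)
  have zc: "z k \<in> carrier_vec ny" if "k < T" for k
    using Y_seqs_carrier[of z T k] z that by (simp add: space_\<zeta>)
  show "integrable (\<Omega> G) (\<lambda>\<omega>. unavoidable_cost (init G i \<omega>) z (\<lambda>k. wdist G i k \<omega>))"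
    by (rule integrable_unavoidable_cost[OF Om.finite_measure_axioms init_L2 Om.L2_vec_const wdist_L2])
      (use zc in auto)
  have "(\<lambda>\<omega>. excess_cost s t (z, \<omega>)) \<in> borel_measurable (\<Omega> G)" if "t < T" for t
    using measurable_compose[OF measurable_Pair1'[OF z] excess_cost_measurable[OF s that]] .
  then show "(\<lambda>\<omega>. \<Sum>t<T. ennreal (\<beta> ^ t) * ennreal (excess_cost s t (z, \<omega>))) \<in> borel_measurable (\<Omega> G)"
    by (intro borel_measurable_sum borel_measurable_times) auto
  fix \<omega> assume \<omega>: "\<omega> \<in> space (\<Omega> G)"
  have zY: "z \<in> space (Y_seqs G T)" using z by (simp add: space_\<zeta>)
  have p: "(z, \<omega>) \<in> space P" using z \<omega> by (simp add: space_pair_measure)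
  have ex: "0 \<le> \<beta> ^ t * excess_cost s t (z, \<omega>)" if "t < T" for t
    using excess_cost_nonneg[OF s that p] discount_nonneg by simp
  have x0: "subj_x G i s z \<omega> 0 = init G i \<omega>" by (simp add: subj_x.simps)
  have "(\<Sum>t<T. \<beta> ^ t * stage_cost G i t (subj_x G i s z \<omega> t) (subj_u G i s z \<omega> t) (z t))
       + \<beta> ^ T * quad (Q T) (subj_x G i s z \<omega> T)
     = unavoidable_cost (subj_x G i s z \<omega> 0) z (\<lambda>k. wdist G i k \<omega>)
       + (\<Sum>t<T. \<beta> ^ t * quad (S t) (subj_u G i s z \<omega> t
            - (F t *\<^sub>v subj_x G i s z \<omega> t + feedforward z (\<lambda>k. wdist G i k \<omega>) t)))"
    by (rule cost_completed_square)
      (use zc subj_x_carrier[OF s zY \<omega>] borel_vec_carrier[OF wdist_measurable _] \<omega> in \<open>auto simp: subj_x.simps(2)\<close>)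
  also have "(\<Sum>t<T. \<beta> ^ t * quad (S t) (subj_u G i s z \<omega> t
            - (F t *\<^sub>v subj_x G i s z \<omega> t + feedforward z (\<lambda>k. wdist G i k \<omega>) t)))
      = (\<Sum>t<T. \<beta> ^ t * excess_cost s t (z, \<omega>))"
    by (simp add: excess_cost_def)
  finally have eq: "(\<Sum>t<T. \<beta> ^ t * stage_cost G i t (subj_x G i s z \<omega> t) (subj_u G i s z \<omega> t) (z t))
       + \<beta> ^ T * quad (Q T) (subj_x G i s z \<omega> T)
     = unavoidable_cost (init G i \<omega>) z (\<lambda>k. wdist G i k \<omega>) + (\<Sum>t<T. \<beta> ^ t * excess_cost s t (z, \<omega>))"
    unfolding x0 .
  have "(\<Sum>t<T. ennreal (\<beta> ^ t) * ennreal (excess_cost s t (z, \<omega>)))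
      = ennreal (\<Sum>t<T. \<beta> ^ t * excess_cost s t (z, \<omega>))"
    using ex discount_nonneg by (subst sum_ennreal[symmetric]) (auto simp: ennreal_mult')
  then show "ereal ((\<Sum>t<T. \<beta> ^ t * stage_cost G i t (subj_x G i s z \<omega> t) (subj_u G i s z \<omega> t) (z t))
       + \<beta> ^ T * quad (Q T) (subj_x G i s z \<omega> T))
     = ereal (unavoidable_cost (init G i \<omega>) z (\<lambda>k. wdist G i k \<omega>))
       + enn2ereal (\<Sum>t<T. ennreal (\<beta> ^ t) * ennreal (excess_cost s t (z, \<omega>)))"
    unfolding eq using enn2ereal_ennreal[OF sum_nonneg[of "{..<T}" "\<lambda>t. \<beta> ^ t * excess_cost s t (z, \<omega>)"]] ex
    by simp
qed

lemma expected_cost_decomposition: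
  assumes s: "s \<in> pure_strategies G i"
  shows "ext_expectation \<zeta> (subj_cost G i s)
    = ereal (\<integral>z. \<integral>\<omega>. unavoidable_cost (init G i \<omega>) z (\<lambda>k. wdist G i k \<omega>) \<partial>\<Omega> G \<partial>\<zeta>)
      + enn2ereal (\<Sum>t<T. ennreal (\<beta> ^ t) * (\<integral>\<^sup>+p. ennreal (excess_cost s t p) \<partial>P))"
proof -
  let ?N = "\<lambda>p. \<Sum>t<T. ennreal (\<beta> ^ t) * ennreal (excess_cost s t p)"
  have N: "?N \<in> borel_measurable P"
    using excess_cost_measurable[OF s] by (intro borel_measurable_sum borel_measurable_times) auto
  have "integrable P (\<lambda>p. unavoidable_cost (init G i (snd p)) (\<lambda>k. fst p k) (\<lambda>k. wdist G i k (snd p)))"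
    by (rule integrable_unavoidable_cost[OF PP.P.finite_measure_axioms X0_L2 Z_L2 W_L2])
  then have int: "integrable \<zeta> (\<lambda>z. \<integral>\<omega>. unavoidable_cost (init G i \<omega>) z (\<lambda>k. wdist G i k \<omega>) \<partial>\<Omega> G)"
    using PP.integrable_fst'[of "\<lambda>p. unavoidable_cost (init G i (snd p)) (fst p) (\<lambda>k. wdist G i k (snd p))"] by simp
  have "ext_expectation \<zeta> (subj_cost G i s)
    = ereal (\<integral>z. \<integral>\<omega>. unavoidable_cost (init G i \<omega>) z (\<lambda>k. wdist G i k \<omega>) \<partial>\<Omega> G \<partial>\<zeta>)
      + enn2ereal (\<integral>\<^sup>+z. (\<integral>\<^sup>+\<omega>. ?N (z, \<omega>) \<partial>\<Omega> G) \<partial>\<zeta>)"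
    by (rule ext_expectation_add_nonneg[OF int Om.borel_measurable_nn_integral_fst[OF N]])
      (rule subj_cost_decomposition[OF s])
  also have "(\<integral>\<^sup>+z. (\<integral>\<^sup>+\<omega>. ?N (z, \<omega>) \<partial>\<Omega> G) \<partial>\<zeta>) = (\<integral>\<^sup>+p. ?N p \<partial>P)"
    by (rule Om.nn_integral_fst[OF N])
  also have "\<dots> = (\<Sum>t<T. \<integral>\<^sup>+p. ennreal (\<beta> ^ t) * ennreal (excess_cost s t p) \<partial>P)"
    using excess_cost_measurable[OF s] by (intro nn_integral_sum borel_measurable_times) auto
  also have "\<dots> = (\<Sum>t<T. ennreal (\<beta> ^ t) * (\<integral>\<^sup>+p. ennreal (excess_cost s t p) \<partial>P))"
    using excess_cost_measurable[OF s] by (intro sum.cong refl nn_integral_cmult) auto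
  finally show ?thesis .
qed

text \<open>The \<open>\<sigma>\<close>-algebra \<open>\<F> t\<close> represents what the past of the disturbances reveals before \<open>w\<^sub>t\<close>; \<open>innovation\<close>
  and \<open>pred_orthogonal\<close> say that means and forecasts are conditional expectations, in the form of
  orthogonality to bounded test functions. For each \<open>t\<close> the excess cost of a rival strategy is the
  quadratic form at \<open>h + e\<close>, where \<open>e\<close> is the excess of \<open>s\<close> and \<open>h\<close> the difference of the two
  strategies as a function of the information, and \<open>e\<close> is orthogonal to functions of the
  information.\<close>

theorem optimal_response:
  assumes filtration: "\<And>t. t < T \<Longrightarrow> subalgebra (\<Omega> G) (\<F> t)"
    and init_\<F>: "\<And>t. t < T \<Longrightarrow> init G i \<in> \<F> t \<rightarrow>\<^sub>M borel_vec nx"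
    and wdist_\<F>: "\<And>t k. k < t \<Longrightarrow> t < T \<Longrightarrow> wdist G i k \<in> \<F> t \<rightarrow>\<^sub>M borel_vec nx"
    and innovation: "\<And>t k g B. t \<le> k \<Longrightarrow> k < T \<Longrightarrow> g \<in> borel_measurable (\<F> t) \<Longrightarrow> (\<And>\<omega>. \<bar>g \<omega>\<bar> \<le> B) \<Longrightarrow>
      weighted_mean (\<Omega> G) g nx (\<lambda>\<omega>. innovation k \<omega>) = 0\<^sub>v nx"
    and pred_measurable: "\<And>t k. t \<le> k \<Longrightarrow> k < T \<Longrightarrow> pred t k \<in> Y_seqs G t \<rightarrow>\<^sub>M borel_vec ny"
    and pred_L2: "\<And>t k. t \<le> k \<Longrightarrow> k < T \<Longrightarrow> L2_vec \<zeta> ny (\<lambda>z. pred t k (restrict z {..<t}))"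
    and pred_orthogonal: "\<And>t k g B. t \<le> k \<Longrightarrow> k < T \<Longrightarrow> g \<in> borel_measurable (Y_seqs G t) \<Longrightarrow> (\<And>y. \<bar>g y\<bar> \<le> B) \<Longrightarrow>
      weighted_mean \<zeta> (\<lambda>z. g (restrict z {..<t})) ny (\<lambda>z. pred t k (restrict z {..<t}) - z k) = 0\<^sub>v ny"
    and s_def: "\<And>t x u y. t < T \<Longrightarrow> y \<in> space (Y_seqs G t) \<Longrightarrow> s t ((x, u), y) = F t *\<^sub>v x t + response pred t y"
    and s: "s \<in> pure_strategies G i" and s': "s' \<in> pure_strategies G i"
  shows "ext_expectation \<zeta> (subj_cost G i s) \<le> ext_expectation \<zeta> (subj_cost G i s')"
proof -
  have main: "(\<integral>\<^sup>+p. ennreal (excess_cost s t p) \<partial>P) \<le> (\<integral>\<^sup>+p. ennreal (excess_cost s' t p) \<partial>P)" if t: "t < T" for t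
  proof -
    define N where "N = Y_seqs G t \<Otimes>\<^sub>M \<F> t"
    define \<pi> :: "(nat \<Rightarrow> real vec) \<times> 'w \<Rightarrow> (nat \<Rightarrow> real vec) \<times> 'w" where "\<pi> p = (restrict (fst p) {..<t}, snd p)" for p
    define e where "e p = response pred t (restrict (fst p) {..<t})
        - feedforward (fst p) (\<lambda>k. wdist G i k (snd p)) t" for p :: "(nat \<Rightarrow> real vec) \<times> 'w"
    \<comment> \<open>How far a rival strategy is from the response, as a function of the information.\<close>
  define h where "h q = subj_u G i s' (fst q) (snd q) t
        - (F t *\<^sub>v subj_x G i s' (fst q) (snd q) t + response pred t (fst q))" for q
    have restr: "(\<lambda>z. restrict z {..<t}) \<in> \<zeta> \<rightarrow>\<^sub>M Y_seqs G t"
      unfolding measurable_cong_sets[OF sets_\<zeta> refl] Y_seqs_def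
      using t by (intro measurable_restrict_subset) auto
    have id\<F>: "(\<lambda>\<omega>. \<omega>) \<in> \<Omega> G \<rightarrow>\<^sub>M \<F> t"
      using filtration[OF t] unfolding subalgebra_def by (auto simp: measurable_def)
    have \<pi>: "\<pi> \<in> P \<rightarrow>\<^sub>M N"
      unfolding \<pi>_def N_def
      by (intro measurable_Pair measurable_compose[OF measurable_fst restr] measurable_compose[OF measurable_snd id\<F>])
    have resp_m: "response pred t \<in> Y_seqs G t \<rightarrow>\<^sub>M borel_vec nu"
      unfolding response_def
      by (intro borel_vec_add borel_vec_vec_sum borel_vec_mult_mat[OF G_mat_carrier] pred_measurable
          borel_vec_const H_vec_carrier t) auto
    have subj_N: "(\<lambda>p. subj_x G i s' (fst p) (snd p) t) \<in> N \<rightarrow>\<^sub>M borel_vec nx"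
       "(\<lambda>p. subj_u G i s' (fst p) (snd p) t) \<in> N \<rightarrow>\<^sub>M borel_vec nu"
      using measurable_subj[OF s' less_imp_le[OF t] init_\<F>[OF t] wdist_\<F>[OF _ t], of t] t by (auto simp: N_def)
    have h: "h \<in> N \<rightarrow>\<^sub>M borel_vec nu"
      unfolding h_def
      by (intro borel_vec_minus borel_vec_add borel_vec_mult_mat[OF F_carrier[OF t]] subj_N)
        (simp add: N_def measurable_compose[OF measurable_fst resp_m])
    have pc: "pred t k (restrict (fst p) {..<t}) \<in> carrier_vec ny" if "p \<in> space P" "t \<le> k" "k < T" for p k
      using L2_vec_carrier[OF pred_L2[OF that(2,3)], of "fst p"] that(1) by (auto simp: space_pair_measure)
    have zc: "fst p k \<in> carrier_vec ny" if "p \<in> space P" "k < T" for p k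
      using L2_vec_carrier[OF Z_L2[OF that(2)] that(1)] .
    have wc: "wdist G i k (snd p) \<in> carrier_vec nx" if "p \<in> space P" "k < T" for p k
      using L2_vec_carrier[OF W_L2[OF that(2)] that(1)] .
    have pred_L2': "L2_vec P ny (\<lambda>p. pred t k (restrict (fst p) {..<t}) - fst p k)" if "t \<le> k" "k < T" for k
      using PP.P.L2_vec_minus[OF L2_vec_fst[OF prob_space_\<Omega> pred_L2[OF that]] Z_L2[OF that(2)]] .
    have inn_L2: "L2_vec (\<Omega> G) nx (\<lambda>\<omega>. innovation k \<omega>)" if "k < T" for k
      by (intro Om.L2_vec_minus Om.L2_vec_const wdist_L2[OF that]) (simp add: vec_expectation_def)
    have inn_L2': "L2_vec P nx (\<lambda>p. innovation k (snd p))" if "k < T" for k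
      using L2_vec_snd[OF prob_space_\<zeta> Om.sigma_finite_measure_axioms inn_L2[OF that]] .
    have e_eq: "e p = vec_sum nu (\<lambda>k. G_mat G i t k *\<^sub>v (pred t k (restrict (fst p) {..<t}) - fst p k)) {t..<T}
      + gain t *\<^sub>v vec_sum nx (\<lambda>k. PhiM t k *\<^sub>v
          innovation k (snd p)) {t..<T}" if p: "p \<in> space P" for p
      unfolding e_def by (rule response_error[OF t]) (use pc[OF p] zc[OF p] wc[OF p] in auto)
    have PM: "PhiM t k \<in> carrier_mat nx nx" if "t \<le> k" "k < T" for k
      by (rule mult_carrier_mat[OF Phi_carrier[OF that] M_carrier]) (use that in simp)
    have L2_1: "L2_vec P nu (\<lambda>p. G_mat G i t k *\<^sub>v (pred t k (restrict (fst p) {..<t}) - fst p k))" if "t \<le> k" "k < T" for k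
      by (rule PP.P.L2_vec_mult_mat[OF G_mat_carrier[OF that] pred_L2'[OF that]])
    have L2_2: "L2_vec P nx (\<lambda>p. PhiM t k *\<^sub>v innovation k (snd p))"
      if "t \<le> k" "k < T" for k
      by (rule PP.P.L2_vec_mult_mat[OF PM[OF that] inn_L2'[OF that(2)]])
    have L2_1s: "L2_vec P nu (\<lambda>p. vec_sum nu (\<lambda>k. G_mat G i t k *\<^sub>v (pred t k (restrict (fst p) {..<t}) - fst p k)) {t..<T})"
      by (intro PP.P.L2_vec_sum L2_1) auto
    have L2_2s: "L2_vec P nx (\<lambda>p. vec_sum nx (\<lambda>k. PhiM t k *\<^sub>v
          innovation k (snd p)) {t..<T})"
      by (intro PP.P.L2_vec_sum L2_2) auto
    have e_L2: "L2_vec P nu e"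
      using L2_vec_add[OF L2_1s PP.P.L2_vec_mult_mat[OF gain_carrier[OF t] L2_2s]] by (simp add: e_eq cong: L2_vec_cong)
    have orth: "(\<integral>p. g (\<pi> p) * e p $ c \<partial>P) = 0"
      if g: "g \<in> borel_measurable N" "\<And>y. \<bar>g y\<bar> \<le> B" and c: "c < nu" for g B c
    proof -
      have g\<pi>: "(\<lambda>p. g (\<pi> p)) \<in> borel_measurable P" by (rule measurable_compose[OF \<pi> g(1)])
      interpret bounded_weight P "\<lambda>p. g (\<pi> p)" B
        by unfold_locales (use g\<pi> g(2) in auto)
      \<comment> \<open>With the disturbances fixed, the weight is a bounded function of the past of the sequence.\<close>
      have wm_1: "weighted_mean P (\<lambda>p. g (\<pi> p)) ny (\<lambda>p. pred t k (restrict (fst p) {..<t}) - fst p k) = 0\<^sub>v ny"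
        if k: "t \<le> k" "k < T" for k
      proof (rule eq_vecI)
        fix r assume "r < dim_vec (0\<^sub>v ny :: real vec)"
        then have r: "r < ny" by simp
        let ?f = "\<lambda>z \<omega>. g (restrict z {..<t}, \<omega>) * (pred t k (restrict z {..<t}) - z k) $ r"
        have "integrable P (case_prod ?f)"
          using weighted_integrable[OF pred_L2'[OF k] r] by (simp add: \<pi>_def split_beta')
        from PP.integral_snd[OF this]
        have "(\<integral>p. case_prod ?f p \<partial>P) = (\<integral>\<omega>. (\<integral>z. ?f z \<omega> \<partial>\<zeta>) \<partial>\<Omega> G)" by simp
        also have "\<dots> = (\<integral>\<omega>. 0 \<partial>\<Omega> G)"
        proof (rule Bochner_Integration.integral_cong[OF refl])
          fix \<omega> assume "\<omega> \<in> space (\<Omega> G)"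
          then have "\<omega> \<in> space (\<F> t)" using measurable_space[OF id\<F>] by simp
          then have "(\<lambda>y. g (y, \<omega>)) \<in> borel_measurable (Y_seqs G t)"
            using measurable_compose[OF measurable_Pair2' g(1)[unfolded N_def]] by simp
          from pred_orthogonal[OF k this g(2)]
          have "weighted_mean \<zeta> (\<lambda>z. g (restrict z {..<t}, \<omega>)) ny (\<lambda>z. pred t k (restrict z {..<t}) - z k) $ r = 0"
            using r by simp
          then show "(\<integral>z. ?f z \<omega> \<partial>\<zeta>) = 0" using r by simp
        qed
        finally show "weighted_mean P (\<lambda>p. g (\<pi> p)) ny (\<lambda>p. pred t k (restrict (fst p) {..<t}) - fst p k) $ r = 0\<^sub>v ny $ r"
          using r by (simp add: \<pi>_def split_beta')
      qed simp
      \<comment> \<open>With the sequence fixed, the weight is a bounded function of the past of the disturbances.\<close>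
      have wm_2: "weighted_mean P (\<lambda>p. g (\<pi> p)) nx (\<lambda>p. innovation k (snd p)) = 0\<^sub>v nx"
        if k: "t \<le> k" "k < T" for k
      proof (rule eq_vecI)
        fix r assume "r < dim_vec (0\<^sub>v nx :: real vec)"
        then have r: "r < nx" by simp
        let ?f = "\<lambda>z \<omega>. g (restrict z {..<t}, \<omega>) * innovation k \<omega> $ r"
        have "integrable P (\<lambda>p. ?f (fst p) (snd p))"
          using weighted_integrable[OF inn_L2'[OF k(2)] r] by (simp add: \<pi>_def)
        from PP.integral_fst'[OF this]
        have "(\<integral>p. ?f (fst p) (snd p) \<partial>P) = (\<integral>z. (\<integral>\<omega>. ?f z \<omega> \<partial>\<Omega> G) \<partial>\<zeta>)" by simp
        also have "\<dots> = (\<integral>z. 0 \<partial>\<zeta>)"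
        proof (rule Bochner_Integration.integral_cong[OF refl])
          fix z assume "z \<in> space \<zeta>"
          then have "restrict z {..<t} \<in> space (Y_seqs G t)" using measurable_space[OF restr] by simp
          then have "(\<lambda>\<omega>. g (restrict z {..<t}, \<omega>)) \<in> borel_measurable (\<F> t)"
            using measurable_compose[OF measurable_Pair1' g(1)[unfolded N_def]] by simp
          from innovation[OF k this g(2)]
          have "weighted_mean (\<Omega> G) (\<lambda>\<omega>. g (restrict z {..<t}, \<omega>)) nx
              (\<lambda>\<omega>. innovation k \<omega>) $ r = 0"
            using r by simp
          then show "(\<integral>\<omega>. ?f z \<omega> \<partial>\<Omega> G) = 0" using r by simp
        qed
        finally show "weighted_mean P (\<lambda>p. g (\<pi> p)) nx
            (\<lambda>p. innovation k (snd p)) $ r = 0\<^sub>v nx $ r"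
          using r by (simp add: \<pi>_def)
      qed simp
      have zero: "vec_sum n (\<lambda>k. X k *\<^sub>v 0\<^sub>v m) {t..<T} = 0\<^sub>v n"
        if "\<And>k. t \<le> k \<Longrightarrow> k < T \<Longrightarrow> X k \<in> carrier_mat n m" for n m and X :: "nat \<Rightarrow> real mat"
        using that by (intro eq_vecI) (auto simp: mult_mat_zero_vec[OF that] intro!: sum.neutral)
      have "weighted_mean P (\<lambda>p. g (\<pi> p)) nu e
        = vec_sum nu (\<lambda>k. G_mat G i t k *\<^sub>v 0\<^sub>v ny) {t..<T}
          + gain t *\<^sub>v vec_sum nx (\<lambda>k. PhiM t k *\<^sub>v 0\<^sub>v nx) {t..<T}"
      proof -
        have "weighted_mean P (\<lambda>p. g (\<pi> p)) nu (\<lambda>p. vec_sum nu (\<lambda>k. G_mat G i t k *\<^sub>v (pred t k (restrict (fst p) {..<t}) - fst p k)) {t..<T})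
            = vec_sum nu (\<lambda>k. G_mat G i t k *\<^sub>v 0\<^sub>v ny) {t..<T}"
          by (subst weighted_mean_sum[OF L2_1])
            (auto intro!: vec_sum_cong simp: weighted_mean_mult_mat[OF G_mat_carrier pred_L2'] wm_1)
        moreover have "weighted_mean P (\<lambda>p. g (\<pi> p)) nx (\<lambda>p. vec_sum nx (\<lambda>k. PhiM t k *\<^sub>v
              innovation k (snd p)) {t..<T})
            = vec_sum nx (\<lambda>k. PhiM t k *\<^sub>v 0\<^sub>v nx) {t..<T}"
          by (subst weighted_mean_sum[OF L2_2])
            (auto intro!: vec_sum_cong simp: weighted_mean_mult_mat[OF PM inn_L2'] wm_2)
        moreover have "weighted_mean P (\<lambda>p. g (\<pi> p)) nu e = weighted_mean P (\<lambda>p. g (\<pi> p)) nu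
            (\<lambda>p. vec_sum nu (\<lambda>k. G_mat G i t k *\<^sub>v (pred t k (restrict (fst p) {..<t}) - fst p k)) {t..<T}
              + gain t *\<^sub>v vec_sum nx (\<lambda>k. PhiM t k *\<^sub>v
                innovation k (snd p)) {t..<T})"
          by (rule weighted_mean_cong) (rule e_eq)
        ultimately show ?thesis
          by (simp only: weighted_mean_add[OF L2_1s PP.P.L2_vec_mult_mat[OF gain_carrier[OF t] L2_2s]]
              weighted_mean_mult_mat[OF gain_carrier[OF t] L2_2s])
      qed
      also have "\<dots> = 0\<^sub>v nu"
        by (simp add: zero G_mat_carrier PM mult_mat_zero_vec[OF gain_carrier[OF t]])
      finally have "weighted_mean P (\<lambda>p. g (\<pi> p)) nu e $ c = 0" using c by simp
      then show ?thesis using c by simp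
    qed
    have "(\<integral>\<^sup>+p. ennreal (quad (S t) (e p)) \<partial>P) \<le> (\<integral>\<^sup>+p. ennreal (quad (S t) (h (\<pi> p) + e p)) \<partial>P)"
      by (rule PP.P.quad_least_at_projection[OF S_carrier[OF t] S_sym[OF t]
            pos_definite_quad_nonneg[OF S_pos_definite[OF t]] \<pi> h e_L2 orth])
    moreover have "excess_cost s t p = quad (S t) (e p)" and "excess_cost s' t p = quad (S t) (h (\<pi> p) + e p)"
      if p: "p \<in> space P" for p
    proof -
      have sp: "fst p \<in> space (Y_seqs G T)" "snd p \<in> space (\<Omega> G)"
        using p by (auto simp: space_pair_measure space_\<zeta>)
      define x u x' u' v r where "x = F t *\<^sub>v subj_x G i s (fst p) (snd p) t" and "u = subj_u G i s (fst p) (snd p) t"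
        and "x' = F t *\<^sub>v subj_x G i s' (fst p) (snd p) t" and "u' = subj_u G i s' (fst p) (snd p) t"
        and "v = feedforward (fst p) (\<lambda>k. wdist G i k (snd p)) t" and "r = response pred t (restrict (fst p) {..<t})"
      have c: "x \<in> carrier_vec nu" "x' \<in> carrier_vec nu" "u' \<in> carrier_vec nu" "v \<in> carrier_vec nu" "r \<in> carrier_vec nu"
        using subj_x_carrier[OF s sp, of t] subj_x_carrier[OF s' sp, of t] t F_carrier[OF t]
          feedforward_carrier[OF t] response_carrier[OF t]
        by (auto simp: x_def x'_def u'_def v_def r_def)
      have ysp: "restrict (fst p) {..<t} \<in> space (Y_seqs G t)"
        using measurable_space[OF restr, of "fst p"] sp(1) by (simp add: space_\<zeta>)
      have u: "u = x + r"
        unfolding u_def x_def r_def by (subst subj_u.simps, subst s_def[OF t ysp]) simp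
      have "u - (x + v) = r - v" unfolding u using c by (intro eq_vecI) auto
      then show "excess_cost s t p = quad (S t) (e p)"
        by (simp add: excess_cost_def split_beta' u_def x_def v_def r_def e_def)
      have "u' - (x' + v) = (u' - (x' + r)) + (r - v)" using c by (intro eq_vecI) auto
      then show "excess_cost s' t p = quad (S t) (h (\<pi> p) + e p)"
        using subj_restrict[OF order_refl, of s' "fst p" t "snd p"]
        by (simp add: excess_cost_def split_beta' u'_def x'_def v_def r_def e_def h_def \<pi>_def)
    qed
    ultimately show ?thesis by (simp cong: nn_integral_cong)
  qed
  show ?thesis
    unfolding expected_cost_decomposition[OF s] expected_cost_decomposition[OF s']
    by (intro add_left_mono) (auto intro!: sum_mono mult_left_mono main simp: less_eq_ennreal.rep_eq[symmetric])
qed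

end

section \<open>Conditional expectations of vectors\<close>

text \<open>Square integrability survives conditioning by Jensen's inequality; the reference recursion feeds
  estimates back into the state, so this keeps all its variables square integrable.\<close>

lemma (in prob_space) vec_cond_exp_properties:
  assumes sub: "subalgebra M \<F>" and X: "L2_vec M n X"
  shows "vec_cond_exp M \<F> n X \<in> \<F> \<rightarrow>\<^sub>M borel_vec n"
    and "L2_vec M n (vec_cond_exp M \<F> n X)"
    and "g \<in> borel_measurable \<F> \<Longrightarrow> (\<And>x. \<bar>g x\<bar> \<le> B) \<Longrightarrow>
      weighted_mean M g n (vec_cond_exp M \<F> n X) = weighted_mean M g n X"
proof -
  interpret finite_measure_subalgebra M \<F>
    by unfold_locales (rule sub)
  have int: "integrable M (\<lambda>x. X x $ r)" if "r < n" for r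
    by (rule L2_rv_integrable[OF L2_vec_index[OF X that]])
  have idx: "vec_cond_exp M \<F> n X x $ r = real_cond_exp M \<F> (\<lambda>x. X x $ r) x" if "r < n" for r x
    using that by (simp add: vec_cond_exp_def)
  have c: "vec_cond_exp M \<F> n X x \<in> carrier_vec n" for x
    by (simp add: vec_cond_exp_def)
  show "vec_cond_exp M \<F> n X \<in> \<F> \<rightarrow>\<^sub>M borel_vec n"
    by (rule measurable_borel_vecI) (auto simp: idx c intro!: borel_measurable_cond_exp)
  have "L2_rv M (real_cond_exp M \<F> (\<lambda>x. X x $ r))" if r: "r < n" for r
  proof -
    have conv: "convex_on UNIV (\<lambda>x::real. x\<^sup>2)"
      using convex_power_even[of 2] by simp
    have "integrable M (\<lambda>x. (real_cond_exp M \<F> (\<lambda>x. X x $ r) x)\<^sup>2)"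
      by (rule integrable_convex_cond_exp[where I = UNIV and q = "\<lambda>x. x\<^sup>2", OF int[OF r]])
        (use L2_vec_index[OF X r] conv in \<open>auto simp: L2_rv_def\<close>)
    then show ?thesis
      unfolding L2_rv_def by (intro conjI borel_measurable_cond_exp2)
  qed
  then show "L2_vec M n (vec_cond_exp M \<F> n X)"
    unfolding L2_vec_def by (simp add: idx c)
  assume g: "g \<in> borel_measurable \<F>" "\<And>x. \<bar>g x\<bar> \<le> B"
  have gM: "g \<in> borel_measurable M" by (rule measurable_from_subalg[OF sub g(1)])
  show "weighted_mean M g n (vec_cond_exp M \<F> n X) = weighted_mean M g n X"
  proof (rule eq_vecI)
    fix r assume "r < dim_vec (weighted_mean M g n X)"
    then have r: "r < n" by simp
    have "integrable M (\<lambda>x. g x * X x $ r)"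
      by (rule integrable_bounded_mult[OF int[OF r] gM g(2)])
    from real_cond_exp_intg(2)[OF this g(1)] int[OF r]
    show "weighted_mean M g n (vec_cond_exp M \<F> n X) $ r = weighted_mean M g n X $ r"
      using r by (simp add: idx)
  qed simp
qed

lemma subalgebra_trans: "subalgebra M N \<Longrightarrow> subalgebra N K \<Longrightarrow> subalgebra M K"
  by (auto simp: subalgebra_def)

lemma subalgebra_vimage:
  assumes f: "f \<in> M \<rightarrow>\<^sub>M N"
  shows "subalgebra M (vimage_algebra (space M) f N)"
proof -
  have "f \<in> space M \<rightarrow> space N" using measurable_space[OF f] by auto
  then show ?thesis
    using measurable_sets[OF f] by (auto simp: subalgebra_def sets_vimage_algebra2)
qed

section \<open>The primitive random variables\<close>

definition primitive_algebra :: "'w lq_game \<Rightarrow> primitive set \<Rightarrow> 'w measure" where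
  "primitive_algebra G J = vimage_algebra (space (\<Omega> G)) (\<lambda>\<omega>. \<lambda>p\<in>J. primitive_rv G p \<omega>)
     (\<Pi>\<^sub>M p\<in>J. borel_vec (primitive_dim G p))"

text \<open>The primitive random variables that determine the reference state at time \<open>t\<close> and the
  observations before it. Neither \<open>w\<^sub>t\<close> nor \<open>\<xi>\<^sub>t\<close> is among them.\<close>

definition past :: "nat \<Rightarrow> primitive set" where
  "past t = {Initial} \<union> Disturb ` {..<t} \<union> Noise ` {..<t}"

locale noisy_game =
  fixes G :: "'w lq_game"
  assumes valid: "valid_game G" and independent: "independent_primitives G"
begin

abbreviation "T \<equiv> horizon G"
abbreviation "nX \<equiv> dim_X G"
abbreviation "ny \<equiv> dim_y G"

lemma dim_X_eq: "nX = (\<Sum>i<Suc (num_dm G). dim_x G i)"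
  by (simp add: dim_X_def lessThan_Suc_atMost)

sublocale Om: prob_space "\<Omega> G" using valid by (simp add: valid_game_def)

lemma init_carrier: "i \<le> num_dm G \<Longrightarrow> \<omega> \<in> space (\<Omega> G) \<Longrightarrow> init G i \<omega> \<in> carrier_vec (dim_x G i)"
  and wdist_carrier: "i \<le> num_dm G \<Longrightarrow> t < T \<Longrightarrow> \<omega> \<in> space (\<Omega> G) \<Longrightarrow> wdist G i t \<omega> \<in> carrier_vec (dim_x G i)"
  using valid borel_vec_carrier[of "init G i" "\<Omega> G" "dim_x G i" \<omega>]
    borel_vec_carrier[of "wdist G i t" "\<Omega> G" "dim_x G i" \<omega>]
  unfolding valid_game_def by auto

lemma primitive_indep:
  "Om.indep_vars (\<lambda>p. borel_vec (primitive_dim G p)) (primitive_rv G) (primitives G)"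
  using independent by (simp add: independent_primitives_def)

lemma primitive_measurable: "p \<in> primitives G \<Longrightarrow> primitive_rv G p \<in> \<Omega> G \<rightarrow>\<^sub>M borel_vec (primitive_dim G p)"
  using primitive_indep by (simp add: Om.indep_vars_def2)

lemma primitive_L2: "p \<in> primitives G \<Longrightarrow> L2_vec (\<Omega> G) (primitive_dim G p) (primitive_rv G p)"
  using primitive_measurable independent by (simp add: L2_vec_iff independent_primitives_def)

lemma primitive_map_space:
  "J \<subseteq> primitives G \<Longrightarrow> (\<lambda>\<omega>. \<lambda>p\<in>J. primitive_rv G p \<omega>) \<in> space (\<Omega> G) \<rightarrow> space (\<Pi>\<^sub>M p\<in>J. borel_vec (primitive_dim G p))"
  using measurable_space[OF primitive_measurable] by (auto simp: space_PiM)

lemma space_primitive_algebra [simp]: "space (primitive_algebra G J) = space (\<Omega> G)"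
  by (simp add: primitive_algebra_def)

lemma primitive_in_algebra:
  assumes J: "J \<subseteq> primitives G" and p: "p \<in> J"
  shows "primitive_rv G p \<in> primitive_algebra G J \<rightarrow>\<^sub>M borel_vec (primitive_dim G p)"
proof -
  have "(\<lambda>\<omega>. (\<lambda>p\<in>J. primitive_rv G p \<omega>) p) \<in> primitive_algebra G J \<rightarrow>\<^sub>M borel_vec (primitive_dim G p)"
    unfolding primitive_algebra_def
    by (rule measurable_compose[OF measurable_vimage_algebra1[OF primitive_map_space[OF J]]
          measurable_component_singleton[OF p]])
  with p show ?thesis by simp
qed

lemma subalgebra_primitive_algebra:
  assumes N: "space N = space (\<Omega> G)" and rv: "\<And>p. p \<in> J \<Longrightarrow> primitive_rv G p \<in> N \<rightarrow>\<^sub>M borel_vec (primitive_dim G p)"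
  shows "subalgebra N (primitive_algebra G J)"
  unfolding primitive_algebra_def N[symmetric] by (intro subalgebra_vimage measurable_restrict rv)

lemma primitive_algebra_subalgebra: "J \<subseteq> primitives G \<Longrightarrow> subalgebra (\<Omega> G) (primitive_algebra G J)"
  by (rule subalgebra_primitive_algebra) (auto intro: primitive_measurable)

lemma primitive_algebra_mono:
  "J \<subseteq> J' \<Longrightarrow> J' \<subseteq> primitives G \<Longrightarrow> subalgebra (primitive_algebra G J') (primitive_algebra G J)"
  by (rule subalgebra_primitive_algebra) (auto intro: primitive_in_algebra)

lemma past_subset: "t \<le> T \<Longrightarrow> past t \<subseteq> primitives G"
  by (auto simp: past_def primitives_def)

lemma init_in_algebra:
  assumes J: "J \<subseteq> primitives G" and p: "Initial \<in> J" and i: "i \<le> num_dm G"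
  shows "init G i \<in> primitive_algebra G J \<rightarrow>\<^sub>M borel_vec (dim_x G i)"
  using borel_vec_unstack[of "Suc (num_dm G)" "init G" "primitive_algebra G J" "dim_x G" i]
    primitive_in_algebra[OF J p] i init_carrier
  by (simp add: X_init_def[abs_def] dim_X_eq less_Suc_eq_le)

lemma wdist_in_algebra:
  assumes J: "J \<subseteq> primitives G" and p: "Disturb t \<in> J" and t: "t < T" and i: "i \<le> num_dm G"
  shows "wdist G i t \<in> primitive_algebra G J \<rightarrow>\<^sub>M borel_vec (dim_x G i)"
  using borel_vec_unstack[of "Suc (num_dm G)" "\<lambda>i. wdist G i t" "primitive_algebra G J" "dim_x G" i]
    primitive_in_algebra[OF J p] i wdist_carrier t
  by (simp add: W_dist_def[abs_def] dim_X_eq less_Suc_eq_le)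

lemma init_L2: "i \<le> num_dm G \<Longrightarrow> L2_vec (\<Omega> G) (dim_x G i) (init G i)"
  using L2_vec_unstack[of "\<Omega> G" "dim_x G" "Suc (num_dm G)" "init G" i] primitive_L2[of Initial] init_carrier
  by (simp add: X_init_def[abs_def] dim_X_eq less_Suc_eq_le primitives_def)

lemma wdist_L2: "i \<le> num_dm G \<Longrightarrow> t < T \<Longrightarrow> L2_vec (\<Omega> G) (dim_x G i) (wdist G i t)"
  using L2_vec_unstack[of "\<Omega> G" "dim_x G" "Suc (num_dm G)" "\<lambda>i. wdist G i t" i] primitive_L2[of "Disturb t"] wdist_carrier
  by (simp add: W_dist_def[abs_def] dim_X_eq less_Suc_eq_le primitives_def)

text \<open>A primitive is independent of all others jointly, hence of every function of a set \<open>J\<close> of others.\<close>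

lemma primitive_weighted_integral:
  assumes p: "p \<in> primitives G" and J: "J \<subseteq> primitives G" "p \<notin> J" and r: "r < primitive_dim G p"
    and g: "g \<in> borel_measurable (primitive_algebra G J)" "\<And>\<omega>. \<bar>g \<omega>\<bar> \<le> B"
  shows "(\<integral>\<omega>. g \<omega> * primitive_rv G p \<omega> $ r \<partial>\<Omega> G) = (\<integral>\<omega>. g \<omega> \<partial>\<Omega> G) * (\<integral>\<omega>. primitive_rv G p \<omega> $ r \<partial>\<Omega> G)"
proof -
  have gM: "g \<in> borel_measurable (\<Omega> G)"
    by (rule measurable_from_subalg[OF primitive_algebra_subalgebra[OF J(1)] g(1)])
  have "g \<in> borel_measurable (primitive_algebra G (primitives G - {p}))"
    by (rule measurable_from_subalg[OF primitive_algebra_mono g(1)]) (use J in auto)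
  moreover have "integrable (\<Omega> G) g"
    using integrable_bounded_mult[of "\<Omega> G" "\<lambda>_. 1" g B] gM g(2) by simp
  moreover have "(\<lambda>v. v $ r) \<in> borel_measurable (borel_vec (primitive_dim G p))"
    using borel_vec_index[OF measurable_ident r] by simp
  ultimately show ?thesis
    using Om.expectation_mult_indep_rest[OF primitive_indep p, of g "\<lambda>v. v $ r"]
      Om.L2_rv_integrable[OF L2_vec_index[OF primitive_L2[OF p] r]]
    by (simp add: primitive_algebra_def)
qed

lemma primitive_weighted_mean:
  assumes p: "p \<in> primitives G" and J: "J \<subseteq> primitives G" "p \<notin> J"
    and g: "g \<in> borel_measurable (primitive_algebra G J)" "\<And>\<omega>. \<bar>g \<omega>\<bar> \<le> B"
  shows "weighted_mean (\<Omega> G) g (primitive_dim G p) (primitive_rv G p)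
    = (\<integral>\<omega>. g \<omega> \<partial>\<Omega> G) \<cdot>\<^sub>v vec_expectation (\<Omega> G) (primitive_dim G p) (primitive_rv G p)"
  using primitive_weighted_integral[OF p J _ g] by (intro eq_vecI) (auto simp: vec_expectation_def)

text \<open>The disturbance of one agent is a block of the stacked disturbance, whose components inherit
  independence of the past.\<close>

lemma wdist_innovation:
  assumes i: "i \<le> num_dm G" and t: "t < T" and J: "J \<subseteq> primitives G" "Disturb t \<notin> J"
    and g: "g \<in> borel_measurable (primitive_algebra G J)" "\<And>\<omega>. \<bar>g \<omega>\<bar> \<le> B"
  shows "weighted_mean (\<Omega> G) g (dim_x G i)
    (\<lambda>\<omega>. vec_expectation (\<Omega> G) (dim_x G i) (wdist G i t) - wdist G i t \<omega>) = 0\<^sub>v (dim_x G i)"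
proof (rule eq_vecI)
  fix c assume "c < dim_vec (0\<^sub>v (dim_x G i) :: real vec)"
  then have c: "c < dim_x G i" by simp
  have p: "Disturb t \<in> primitives G" using t by (simp add: primitives_def)
  have gM: "g \<in> borel_measurable (\<Omega> G)"
    by (rule measurable_from_subalg[OF primitive_algebra_subalgebra[OF J(1)] g(1)])
  obtain r where r: "r < nX"
    "\<And>v. (\<forall>i<Suc (num_dm G). v i \<in> carrier_vec (dim_x G i)) \<Longrightarrow> stack_vec (Suc (num_dm G)) v $ r = v i $ c"
    using stack_vec_index_surj[of i "Suc (num_dm G)" c "dim_x G"] i c unfolding dim_X_eq by auto
  have W: "primitive_rv G (Disturb t) \<omega> $ r = wdist G i t \<omega> $ c" if "\<omega> \<in> space (\<Omega> G)" for \<omega>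
    unfolding primitive_rv.simps W_dist_def by (rule r(2)) (use wdist_carrier t that in auto)
  have "(\<integral>\<omega>. g \<omega> * primitive_rv G (Disturb t) \<omega> $ r \<partial>\<Omega> G)
      = (\<integral>\<omega>. g \<omega> \<partial>\<Omega> G) * (\<integral>\<omega>. primitive_rv G (Disturb t) \<omega> $ r \<partial>\<Omega> G)"
    by (rule primitive_weighted_integral[OF p J _ g]) (use r in simp)
  then have eq: "(\<integral>\<omega>. g \<omega> * wdist G i t \<omega> $ c \<partial>\<Omega> G) = (\<integral>\<omega>. g \<omega> \<partial>\<Omega> G) * (\<integral>\<omega>. wdist G i t \<omega> $ c \<partial>\<Omega> G)"
    using W by (simp cong: Bochner_Integration.integral_cong del: primitive_rv.simps)
  let ?E = "\<integral>\<omega>. wdist G i t \<omega> $ c \<partial>\<Omega> G"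
  have wi: "integrable (\<Omega> G) (\<lambda>\<omega>. wdist G i t \<omega> $ c)"
    by (rule Om.L2_rv_integrable[OF L2_vec_index[OF wdist_L2[OF i t] c]])
  have gw: "integrable (\<Omega> G) (\<lambda>\<omega>. g \<omega> * wdist G i t \<omega> $ c)"
    by (rule integrable_bounded_mult[OF wi gM g(2)])
  have gi: "integrable (\<Omega> G) g"
    using integrable_bounded_mult[of "\<Omega> G" "\<lambda>_. 1" g B] gM g(2) by simp
  have "(\<integral>\<omega>. g \<omega> * (vec_expectation (\<Omega> G) (dim_x G i) (wdist G i t) - wdist G i t \<omega>) $ c \<partial>\<Omega> G)
      = (\<integral>\<omega>. g \<omega> * ?E - g \<omega> * wdist G i t \<omega> $ c \<partial>\<Omega> G)"
    using c carrier_vecD[OF wdist_carrier[OF i t]]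
    by (intro Bochner_Integration.integral_cong) (simp_all add: vec_expectation_def right_diff_distrib)
  also have "\<dots> = 0" using gw gi eq by simp
  finally show "weighted_mean (\<Omega> G) g (dim_x G i)
    (\<lambda>\<omega>. vec_expectation (\<Omega> G) (dim_x G i) (wdist G i t) - wdist G i t \<omega>) $ c = 0\<^sub>v (dim_x G i) $ c"
    using c by simp
qed simp

lemma decision_makerI: "j \<in> DM G \<Longrightarrow> decision_maker G j"
  using valid by unfold_locales

lemma DM_index: "0 < j \<Longrightarrow> j < Suc (num_dm G) \<Longrightarrow> j \<in> DM G" by (simp add: DM_def)

lemma game_matrix_carrier:
  assumes "t < T" "j \<in> DM G"
  shows "B1 G j t \<in> carrier_mat (dim_x G 0) (dim_u G j)" "B2 G j t \<in> carrier_mat (dim_x G 0) (dim_x G j)"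
    "E1 G j t \<in> carrier_mat ny (dim_u G j)" "E2 G j t \<in> carrier_mat ny (dim_x G j)"
    "Bm G j t \<in> carrier_mat (dim_x G j) (dim_u G j)" "Cm G j t \<in> carrier_mat (dim_x G j) ny"
    "Am G j t \<in> carrier_mat (dim_x G j) (dim_x G j)"
    "F_mat G j t \<in> carrier_mat (dim_u G j) (dim_x G j)"
  using valid assms decision_maker.F_carrier[OF decision_makerI[OF assms(2)] assms(1)]
  unfolding valid_game_def DM_def by auto

lemma environment_carrier:
  assumes "t < T"
  shows "Dm G t \<in> carrier_mat ny (dim_x G 0)" "Am G 0 t \<in> carrier_mat (dim_x G 0) (dim_x G 0)"
  using valid assms unfolding valid_game_def by auto

lemma D_agg_block_carrier:
  "t < T \<Longrightarrow> j < Suc (num_dm G) \<Longrightarrow>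
   (if j = 0 then Dm G t else E1 G j t * F_mat G j t + E2 G j t) \<in> carrier_mat ny (dim_x G j)"
  using environment_carrier[of t] game_matrix_carrier[of t j] DM_index[of j] by auto

lemma D_agg_carrier: "t < T \<Longrightarrow> D_agg G t \<in> carrier_mat ny nX"
  unfolding D_agg_def dim_X_eq by (rule stack_cols_carrier) (rule D_agg_block_carrier)

lemma A_agg_block_carrier:
  "t < T \<Longrightarrow> i < Suc (num_dm G) \<Longrightarrow> j < Suc (num_dm G) \<Longrightarrow>
   (if i = 0 then (if j = 0 then Am G 0 t else B1 G j t * F_mat G j t + B2 G j t)
    else (if j = i then Am G i t + Bm G i t * F_mat G i t else 0\<^sub>m (dim_x G i) (dim_x G j)))
   \<in> carrier_mat (dim_x G i) (dim_x G j)"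
  using environment_carrier[of t] game_matrix_carrier[of t j] DM_index[of j] by auto

lemma A_agg_row_carrier:
  "t < T \<Longrightarrow> i < Suc (num_dm G) \<Longrightarrow> stack_cols (dim_x G i) (Suc (num_dm G))
        (\<lambda>j. if i = 0
             then (if j = 0 then Am G 0 t else B1 G j t * F_mat G j t + B2 G j t)
             else (if j = i then Am G i t + Bm G i t * F_mat G i t
                   else 0\<^sub>m (dim_x G i) (dim_x G j))) \<in> carrier_mat (dim_x G i) nX"
  unfolding dim_X_eq by (rule stack_cols_carrier) (rule A_agg_block_carrier)

lemma A_agg_carrier:
  assumes t: "t < T"
  shows "A_agg G t \<in> carrier_mat nX nX"
proof -
  have "A_agg G t \<in> carrier_mat (\<Sum>i<Suc (num_dm G). dim_x G i) nX"
    unfolding A_agg_def by (rule stack_rows_carrier) (rule A_agg_row_carrier[OF t])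
  then show ?thesis unfolding dim_X_eq[symmetric] .
qed

lemma GX_agg_block_carrier:
  "t \<le> k \<Longrightarrow> k < T \<Longrightarrow> i < Suc (num_dm G) \<Longrightarrow>
   (if i = 0 then mat_sum (dim_x G 0) ny (\<lambda>j. B1 G j t * G_mat G j t k) (DM G)
          else Bm G i t * G_mat G i t k) \<in> carrier_mat (dim_x G i) ny"
  using game_matrix_carrier[of t i] DM_index[of i] decision_maker.G_mat_carrier[OF decision_makerI, of i t k] by auto

lemma GX_agg_carrier: "t \<le> k \<Longrightarrow> k < T \<Longrightarrow> GX_agg G t k \<in> carrier_mat nX ny"
  unfolding GX_agg_def dim_X_eq by (rule stack_rows_carrier) (rule GX_agg_block_carrier)

lemma Gp_agg_carrier: "Gp_agg G t k \<in> carrier_mat ny ny"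
  and Hp_agg_carrier: "Hp_agg G t \<in> carrier_vec ny"
  by (simp_all add: Gp_agg_def Hp_agg_def)

lemma HX_agg_block_carrier:
  "t < T \<Longrightarrow> i < Suc (num_dm G) \<Longrightarrow>
   (if i = 0 then vec_sum (dim_x G 0) (\<lambda>j. B1 G j t *\<^sub>v H_vec G j t) (DM G)
          else Bm G i t *\<^sub>v H_vec G i t) \<in> carrier_vec (dim_x G i)"
  using game_matrix_carrier[of t i] DM_index[of i] by (auto intro!: carrier_vecI)

lemma HX_agg_carrier: "t < T \<Longrightarrow> HX_agg G t \<in> carrier_vec nX"
  unfolding HX_agg_def dim_X_eq by (rule stack_vec_carrier) (rule HX_agg_block_carrier)

lemma C_agg_block_carrier:
  "t < T \<Longrightarrow> i < Suc (num_dm G) \<Longrightarrow>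
   (if i = 0 then 0\<^sub>m (dim_x G 0) ny else Cm G i t) \<in> carrier_mat (dim_x G i) ny"
  using game_matrix_carrier[of t i] DM_index[of i] by auto

lemma C_agg_carrier: "t < T \<Longrightarrow> C_agg G t \<in> carrier_mat nX ny"
  unfolding C_agg_def dim_X_eq by (rule stack_rows_carrier) (rule C_agg_block_carrier)

end

declare bar_X.simps [simp del] bar_hat.simps [simp del] bar_y.simps [simp del]

section \<open>Predictions\<close>

context noisy_game
begin

lemma xi_L2: "t < T \<Longrightarrow> L2_vec (\<Omega> G) ny (xi G t)"
  using primitive_L2[of "Noise t"] by (simp add: primitives_def)

lemma W_L2: "t < T \<Longrightarrow> L2_vec (\<Omega> G) nX (W_dist G t)"
  using primitive_L2[of "Disturb t"] by (simp add: primitives_def)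

lemma vec_expectation_carrier [simp]: "vec_expectation M n X \<in> carrier_vec n"
  by (simp add: vec_expectation_def)

lemma prediction_carrier:
  assumes "prediction G k x (y, X)"
  shows "k \<le> t \<Longrightarrow> t < T \<Longrightarrow> y t \<in> carrier_vec ny" "k \<le> t \<Longrightarrow> t \<le> T \<Longrightarrow> X t \<in> carrier_vec nX"
proof -
  have "y \<in> {k..<T} \<rightarrow>\<^sub>E carrier_vec ny" "X \<in> {k..T} \<rightarrow>\<^sub>E carrier_vec nX"
    using assms unfolding prediction_def by simp_all
  then show "k \<le> t \<Longrightarrow> t < T \<Longrightarrow> y t \<in> carrier_vec ny" "k \<le> t \<Longrightarrow> t \<le> T \<Longrightarrow> X t \<in> carrier_vec nX"
    by (auto dest: PiE_mem)
qed

lemma prediction_eqs: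
  assumes "prediction G k x (y, X)"
  shows "X k = x"
    and "k \<le> t \<Longrightarrow> t < T \<Longrightarrow> y t = D_agg G t *\<^sub>v X t
              + vec_sum ny (\<lambda>n. Gp_agg G t n *\<^sub>v y n) {t..<T}
              + Hp_agg G t + vec_expectation (\<Omega> G) ny (xi G t)"
    and "k \<le> t \<Longrightarrow> t < T \<Longrightarrow> X (Suc t) = A_agg G t *\<^sub>v X t
              + vec_sum nX (\<lambda>n. GX_agg G t n *\<^sub>v y n) {t..<T}
              + HX_agg G t + C_agg G t *\<^sub>v y t + vec_expectation (\<Omega> G) nX (W_dist G t)"
  using assms by (auto simp: prediction_def)

text \<open>Time consistency: seen from a later time \<open>t\<close> and from the state predicted for it, the rest of a
  prediction solves the prediction equations of time \<open>t\<close>.\<close>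

lemma prediction_restrict:
  assumes p: "prediction G k x (y, X)" and t: "k \<le> t" "t < T"
  shows "prediction G t (X t) (restrict y {t..<T}, restrict X {t..T})"
proof -
  have "y \<in> {k..<T} \<rightarrow>\<^sub>E carrier_vec ny" "X \<in> {k..T} \<rightarrow>\<^sub>E carrier_vec nX"
    using p by (auto simp: prediction_def)
  then have "restrict y {t..<T} \<in> {t..<T} \<rightarrow>\<^sub>E carrier_vec ny" "restrict X {t..T} \<in> {t..T} \<rightarrow>\<^sub>E carrier_vec nX"
    using t by auto
  moreover have "restrict y {t..<T} s = D_agg G s *\<^sub>v restrict X {t..T} s
              + vec_sum ny (\<lambda>n. Gp_agg G s n *\<^sub>v restrict y {t..<T} n) {s..<T}
              + Hp_agg G s + vec_expectation (\<Omega> G) ny (xi G s)"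
    "restrict X {t..T} (Suc s) = A_agg G s *\<^sub>v restrict X {t..T} s
              + vec_sum nX (\<lambda>n. GX_agg G s n *\<^sub>v restrict y {t..<T} n) {s..<T}
              + HX_agg G s + C_agg G s *\<^sub>v restrict y {t..<T} s + vec_expectation (\<Omega> G) nX (W_dist G s)"
    if s: "s \<in> {t..<T}" for s
  proof -
    have "vec_sum ny (\<lambda>n. Gp_agg G s n *\<^sub>v restrict y {t..<T} n) {s..<T} = vec_sum ny (\<lambda>n. Gp_agg G s n *\<^sub>v y n) {s..<T}"
      "vec_sum nX (\<lambda>n. GX_agg G s n *\<^sub>v restrict y {t..<T} n) {s..<T} = vec_sum nX (\<lambda>n. GX_agg G s n *\<^sub>v y n) {s..<T}"
      using s by (auto intro!: vec_sum_cong)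
    then show "restrict y {t..<T} s = D_agg G s *\<^sub>v restrict X {t..T} s
              + vec_sum ny (\<lambda>n. Gp_agg G s n *\<^sub>v restrict y {t..<T} n) {s..<T}
              + Hp_agg G s + vec_expectation (\<Omega> G) ny (xi G s)"
    "restrict X {t..T} (Suc s) = A_agg G s *\<^sub>v restrict X {t..T} s
              + vec_sum nX (\<lambda>n. GX_agg G s n *\<^sub>v restrict y {t..<T} n) {s..<T}
              + HX_agg G s + C_agg G s *\<^sub>v restrict y {t..<T} s + vec_expectation (\<Omega> G) nX (W_dist G s)"
      using prediction_eqs(2,3)[OF p, of s] s t by auto
  qed
  ultimately show ?thesis
    using t unfolding prediction_def prod.case by (intro conjI ballI) simp_all
qed

lemma weighted_mean_observation:
  assumes "bounded_weight M g B" and one: "(\<integral>x. g x \<partial>M) = 1" and t: "t < T"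
    and X: "L2_vec M nX X" and Y: "\<And>n. t \<le> n \<Longrightarrow> n < T \<Longrightarrow> L2_vec M ny (Y n)" and V: "L2_vec M ny V"
  shows "weighted_mean M g ny (\<lambda>\<omega>. D_agg G t *\<^sub>v X \<omega> + vec_sum ny (\<lambda>n. Gp_agg G t n *\<^sub>v Y n \<omega>) {t..<T}
        + Hp_agg G t + V \<omega>)
    = D_agg G t *\<^sub>v weighted_mean M g nX X + vec_sum ny (\<lambda>n. Gp_agg G t n *\<^sub>v weighted_mean M g ny (Y n)) {t..<T}
        + Hp_agg G t + weighted_mean M g ny V"
proof -
  interpret bounded_weight M g B by fact
  note D = D_agg_carrier[OF t]
  have GY: "L2_vec M ny (\<lambda>\<omega>. Gp_agg G t n *\<^sub>v Y n \<omega>)" if "t \<le> n" "n < T" for n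
    by (rule L2_vec_mult_mat[OF Gp_agg_carrier Y[OF that]])
  have s: "L2_vec M ny (\<lambda>\<omega>. vec_sum ny (\<lambda>n. Gp_agg G t n *\<^sub>v Y n \<omega>) {t..<T})"
    using GY by (intro L2_vec_sum) auto
  have d: "L2_vec M ny (\<lambda>\<omega>. D_agg G t *\<^sub>v X \<omega>)" by (rule L2_vec_mult_mat[OF D X])
  have h: "L2_vec M ny (\<lambda>\<omega>. Hp_agg G t)" by (rule L2_vec_const[OF Hp_agg_carrier])
  have "weighted_mean M g ny (\<lambda>\<omega>. vec_sum ny (\<lambda>n. Gp_agg G t n *\<^sub>v Y n \<omega>) {t..<T})
      = vec_sum ny (\<lambda>n. Gp_agg G t n *\<^sub>v weighted_mean M g ny (Y n)) {t..<T}"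
    using GY by (subst weighted_mean_sum) (auto intro!: vec_sum_cong weighted_mean_mult_mat[OF Gp_agg_carrier Y])
  moreover have "weighted_mean M g ny (\<lambda>\<omega>. Hp_agg G t) = Hp_agg G t"
    unfolding weighted_mean_const[OF Hp_agg_carrier] one by (rule one_smult_vec)
  ultimately show ?thesis
    by (simp add: weighted_mean_add[OF L2_vec_add[OF L2_vec_add[OF d s] h] V] weighted_mean_add[OF L2_vec_add[OF d s] h]
        weighted_mean_add[OF d s] weighted_mean_mult_mat[OF D X])
qed

lemma weighted_mean_state:
  assumes "bounded_weight M g B" and one: "(\<integral>x. g x \<partial>M) = 1" and t: "t < T"
    and X: "L2_vec M nX X" and Y: "\<And>n. t \<le> n \<Longrightarrow> n < T \<Longrightarrow> L2_vec M ny (Y n)" and Z: "L2_vec M ny Z" and V: "L2_vec M nX V"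
  shows "weighted_mean M g nX (\<lambda>\<omega>. A_agg G t *\<^sub>v X \<omega> + vec_sum nX (\<lambda>n. GX_agg G t n *\<^sub>v Y n \<omega>) {t..<T}
        + HX_agg G t + C_agg G t *\<^sub>v Z \<omega> + V \<omega>)
    = A_agg G t *\<^sub>v weighted_mean M g nX X + vec_sum nX (\<lambda>n. GX_agg G t n *\<^sub>v weighted_mean M g ny (Y n)) {t..<T}
        + HX_agg G t + C_agg G t *\<^sub>v weighted_mean M g ny Z + weighted_mean M g nX V"
proof -
  interpret bounded_weight M g B by fact
  note A = A_agg_carrier[OF t] and C = C_agg_carrier[OF t] and H = HX_agg_carrier[OF t]
  have GY: "L2_vec M nX (\<lambda>\<omega>. GX_agg G t n *\<^sub>v Y n \<omega>)" if "t \<le> n" "n < T" for n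
    by (rule L2_vec_mult_mat[OF GX_agg_carrier[OF that] Y[OF that]])
  have s: "L2_vec M nX (\<lambda>\<omega>. vec_sum nX (\<lambda>n. GX_agg G t n *\<^sub>v Y n \<omega>) {t..<T})"
    using GY by (intro L2_vec_sum) auto
  have d: "L2_vec M nX (\<lambda>\<omega>. A_agg G t *\<^sub>v X \<omega>)" by (rule L2_vec_mult_mat[OF A X])
  have c: "L2_vec M nX (\<lambda>\<omega>. C_agg G t *\<^sub>v Z \<omega>)" by (rule L2_vec_mult_mat[OF C Z])
  have h: "L2_vec M nX (\<lambda>\<omega>. HX_agg G t)" by (rule L2_vec_const[OF H])
  note dsh = L2_vec_add[OF L2_vec_add[OF d s] h]
  have "weighted_mean M g nX (\<lambda>\<omega>. vec_sum nX (\<lambda>n. GX_agg G t n *\<^sub>v Y n \<omega>) {t..<T})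
      = vec_sum nX (\<lambda>n. GX_agg G t n *\<^sub>v weighted_mean M g ny (Y n)) {t..<T}"
    using GY by (subst weighted_mean_sum) (auto intro!: vec_sum_cong weighted_mean_mult_mat[OF GX_agg_carrier Y])
  moreover have "weighted_mean M g nX (\<lambda>\<omega>. HX_agg G t) = HX_agg G t"
    unfolding weighted_mean_const[OF H] one by (rule one_smult_vec)
  ultimately show ?thesis
    by (simp add: weighted_mean_add[OF L2_vec_add[OF dsh c] V] weighted_mean_add[OF dsh c]
        weighted_mean_add[OF L2_vec_add[OF d s] h] weighted_mean_add[OF d s]
        weighted_mean_mult_mat[OF A X] weighted_mean_mult_mat[OF C Z])
qed

text \<open>The prediction equations are affine, so total weight one keeps the constant terms. Finite affine
  combinations are the case of a counting measure.\<close>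

lemma prediction_weighted_mean:
  assumes w: "bounded_weight M g B" and one: "(\<integral>x. g x \<partial>M) = 1" and k: "k < T"
    and p: "\<And>\<omega>. \<omega> \<in> space M \<Longrightarrow> prediction G k (x \<omega>) (y \<omega>, X \<omega>)"
    and y: "\<And>t. k \<le> t \<Longrightarrow> t < T \<Longrightarrow> L2_vec M ny (\<lambda>\<omega>. y \<omega> t)"
    and X: "\<And>t. k \<le> t \<Longrightarrow> t \<le> T \<Longrightarrow> L2_vec M nX (\<lambda>\<omega>. X \<omega> t)"
  shows "prediction G k (weighted_mean M g nX x)
    (\<lambda>t\<in>{k..<T}. weighted_mean M g ny (\<lambda>\<omega>. y \<omega> t), \<lambda>t\<in>{k..T}. weighted_mean M g nX (\<lambda>\<omega>. X \<omega> t))"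
proof -
  interpret bounded_weight M g B by fact
  have c1: "weighted_mean M g n (\<lambda>\<omega>. c) = c" if "c \<in> carrier_vec n" for n and c :: "real vec"
    unfolding weighted_mean_const[OF that] one by (rule one_smult_vec)
  have eq_y: "weighted_mean M g ny (\<lambda>\<omega>. y \<omega> t) = D_agg G t *\<^sub>v weighted_mean M g nX (\<lambda>\<omega>. X \<omega> t)
      + vec_sum ny (\<lambda>n. Gp_agg G t n *\<^sub>v weighted_mean M g ny (\<lambda>\<omega>. y \<omega> n)) {t..<T}
      + Hp_agg G t + vec_expectation (\<Omega> G) ny (xi G t)" if t: "k \<le> t" "t < T" for t
  proof -
    have "weighted_mean M g ny (\<lambda>\<omega>. y \<omega> t) = weighted_mean M g ny (\<lambda>\<omega>. D_agg G t *\<^sub>v X \<omega> t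
        + vec_sum ny (\<lambda>n. Gp_agg G t n *\<^sub>v y \<omega> n) {t..<T} + Hp_agg G t + vec_expectation (\<Omega> G) ny (xi G t))"
      by (rule weighted_mean_cong) (rule prediction_eqs(2)[OF p t])
    also have "\<dots> = D_agg G t *\<^sub>v weighted_mean M g nX (\<lambda>\<omega>. X \<omega> t)
      + vec_sum ny (\<lambda>n. Gp_agg G t n *\<^sub>v weighted_mean M g ny (\<lambda>\<omega>. y \<omega> n)) {t..<T}
      + Hp_agg G t + weighted_mean M g ny (\<lambda>\<omega>. vec_expectation (\<Omega> G) ny (xi G t))"
      by (rule weighted_mean_observation[OF w one t(2)]) (use X y t in \<open>auto intro!: L2_vec_const\<close>)
    finally show ?thesis by (simp add: c1)
  qed
  have eq_X: "weighted_mean M g nX (\<lambda>\<omega>. X \<omega> (Suc t)) = A_agg G t *\<^sub>v weighted_mean M g nX (\<lambda>\<omega>. X \<omega> t)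
      + vec_sum nX (\<lambda>n. GX_agg G t n *\<^sub>v weighted_mean M g ny (\<lambda>\<omega>. y \<omega> n)) {t..<T}
      + HX_agg G t + C_agg G t *\<^sub>v weighted_mean M g ny (\<lambda>\<omega>. y \<omega> t) + vec_expectation (\<Omega> G) nX (W_dist G t)"
    if t: "k \<le> t" "t < T" for t
  proof -
    have "weighted_mean M g nX (\<lambda>\<omega>. X \<omega> (Suc t)) = weighted_mean M g nX (\<lambda>\<omega>. A_agg G t *\<^sub>v X \<omega> t
        + vec_sum nX (\<lambda>n. GX_agg G t n *\<^sub>v y \<omega> n) {t..<T} + HX_agg G t + C_agg G t *\<^sub>v y \<omega> t
        + vec_expectation (\<Omega> G) nX (W_dist G t))"
      by (rule weighted_mean_cong) (rule prediction_eqs(3)[OF p t])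
    also have "\<dots> = A_agg G t *\<^sub>v weighted_mean M g nX (\<lambda>\<omega>. X \<omega> t)
      + vec_sum nX (\<lambda>n. GX_agg G t n *\<^sub>v weighted_mean M g ny (\<lambda>\<omega>. y \<omega> n)) {t..<T}
      + HX_agg G t + C_agg G t *\<^sub>v weighted_mean M g ny (\<lambda>\<omega>. y \<omega> t)
      + weighted_mean M g nX (\<lambda>\<omega>. vec_expectation (\<Omega> G) nX (W_dist G t))"
      by (rule weighted_mean_state[OF w one t(2)]) (use X y t in \<open>auto intro!: L2_vec_const\<close>)
    finally show ?thesis by (simp add: c1)
  qed
  have eq_k: "weighted_mean M g nX (\<lambda>\<omega>. X \<omega> k) = weighted_mean M g nX x"
    by (rule weighted_mean_cong) (rule prediction_eqs(1)[OF p])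
  have eq_sum: "vec_sum n (\<lambda>m. f m *\<^sub>v (\<lambda>t\<in>{k..<T}. weighted_mean M g ny (\<lambda>\<omega>. y \<omega> t)) m) {t..<T}
      = vec_sum n (\<lambda>m. f m *\<^sub>v weighted_mean M g ny (\<lambda>\<omega>. y \<omega> m)) {t..<T}" if "k \<le> t" for n t and f :: "nat \<Rightarrow> real mat"
    using that by (intro vec_sum_cong) auto
  show ?thesis
    unfolding prediction_def prod.case
  proof (intro conjI ballI)
    show "(\<lambda>t\<in>{k..T}. weighted_mean M g nX (\<lambda>\<omega>. X \<omega> t)) k = weighted_mean M g nX x"
      using k eq_k by simp
    fix t assume "t \<in> {k..<T}"
    then have t: "k \<le> t" "t < T" by auto
    then have r: "(\<lambda>t\<in>{k..<T}. weighted_mean M g ny (\<lambda>\<omega>. y \<omega> t)) t = weighted_mean M g ny (\<lambda>\<omega>. y \<omega> t)"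
      "(\<lambda>t\<in>{k..T}. weighted_mean M g nX (\<lambda>\<omega>. X \<omega> t)) t = weighted_mean M g nX (\<lambda>\<omega>. X \<omega> t)"
      "(\<lambda>t\<in>{k..T}. weighted_mean M g nX (\<lambda>\<omega>. X \<omega> t)) (Suc t) = weighted_mean M g nX (\<lambda>\<omega>. X \<omega> (Suc t))"
      by simp_all
    show "(\<lambda>t\<in>{k..<T}. weighted_mean M g ny (\<lambda>\<omega>. y \<omega> t)) t
        = D_agg G t *\<^sub>v (\<lambda>t\<in>{k..T}. weighted_mean M g nX (\<lambda>\<omega>. X \<omega> t)) t
          + vec_sum ny (\<lambda>n. Gp_agg G t n *\<^sub>v (\<lambda>t\<in>{k..<T}. weighted_mean M g ny (\<lambda>\<omega>. y \<omega> t)) n) {t..<T}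
          + Hp_agg G t + vec_expectation (\<Omega> G) ny (xi G t)"
      unfolding r eq_sum[OF t(1)] by (rule eq_y[OF t])
    show "(\<lambda>t\<in>{k..T}. weighted_mean M g nX (\<lambda>\<omega>. X \<omega> t)) (Suc t)
        = A_agg G t *\<^sub>v (\<lambda>t\<in>{k..T}. weighted_mean M g nX (\<lambda>\<omega>. X \<omega> t)) t
          + vec_sum nX (\<lambda>n. GX_agg G t n *\<^sub>v (\<lambda>t\<in>{k..<T}. weighted_mean M g ny (\<lambda>\<omega>. y \<omega> t)) n) {t..<T}
          + HX_agg G t + C_agg G t *\<^sub>v (\<lambda>t\<in>{k..<T}. weighted_mean M g ny (\<lambda>\<omega>. y \<omega> t)) t
          + vec_expectation (\<Omega> G) nX (W_dist G t)"
      unfolding r eq_sum[OF t(1)] by (rule eq_X[OF t])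
  qed auto
qed

lemma L2_vec_count_space:
  "finite S \<Longrightarrow> (\<And>s. s \<in> S \<Longrightarrow> X s \<in> carrier_vec n) \<Longrightarrow> L2_vec (count_space S) n X"
  by (auto simp: L2_vec_def L2_rv_def integrable_count_space)

text \<open>A vector \<open>x\<close> is the combination of the unit vectors with weights \<open>x\<^sub>1, x\<^sub>2, \<dots>\<close> and of the origin with
  the remaining weight. By uniqueness the prediction from \<open>x\<close> is the same combination of the
  predictions from these points; those from the unit vectors minus the one from the origin are the
  columns of \<open>a\<close>, and the one from the origin is \<open>b\<close>.\<close>

lemma prediction_coeffs_exist:
  assumes unique: "unique_predictions G"
  shows "\<exists>a b. prediction_coeffs G a b"
proof -
  define sol where "sol k x = (THE yX. prediction G k x yX)" for k x
  have sol: "prediction G k x (sol k x)" if "k < T" "x \<in> carrier_vec nX" for k x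
    unfolding sol_def by (rule theI') (use unique that in \<open>auto simp: unique_predictions_def\<close>)
  \<comment> \<open>Index \<open>nX\<close> stands for the origin.\<close>
  define pt where "pt s = (if s < nX then unit_vec nX s else 0\<^sub>v nX :: real vec)" for s
  have pt: "pt s \<in> carrier_vec nX" for s by (simp add: pt_def)
  define ys Xs where "ys k s = fst (sol k (pt s))" and "Xs k s = snd (sol k (pt s))" for k s
  have p: "prediction G k (pt s) (ys k s, Xs k s)" if "k < T" for k s
    using sol[OF that pt] by (simp add: ys_def Xs_def)
  define a where "a t k = mat ny nX (\<lambda>(r, c). ys k c t $ r - ys k nX t $ r)" for t k
  define b where "b t k = ys k nX t" for t k
  have "y t = a t k *\<^sub>v x + b t k"
    if k: "k < T" and t: "k \<le> t" "t < T" and x: "x \<in> carrier_vec nX" and yX: "prediction G k x (y, X)" for k t x y X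
  proof -
    \<comment> \<open>Weights of total one that represent \<open>x\<close>.\<close>
    define g where "g s = (if s < nX then x $ s else 1 - (\<Sum>c<nX. x $ c))" for s
    let ?M = "count_space {..nX}"
    have int: "(\<integral>s. f s \<partial>?M) = (\<Sum>c<nX. f c) + f nX" for f :: "nat \<Rightarrow> real"
      by (subst lebesgue_integral_count_space_finite) (auto simp: lessThan_Suc_atMost[symmetric])
    have "\<bar>g s\<bar> \<le> (\<Sum>s\<le>nX. \<bar>g s\<bar>)" if "s \<le> nX" for s
      by (rule member_le_sum[of s "{..nX}" "\<lambda>s. \<bar>g s\<bar>"]) (use that in auto)
    then have w: "bounded_weight ?M g (\<Sum>s\<le>nX. \<bar>g s\<bar>)"
      by (intro bounded_weight.intro finite_measure_count_space bounded_weight_axioms.intro) auto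
    have one: "(\<integral>s. g s \<partial>?M) = 1" unfolding int by (simp add: g_def)
    have wm_pt: "weighted_mean ?M g nX pt = x"
    proof (rule eq_vecI)
      fix r assume "r < dim_vec x"
      then have r: "r < nX" using x by simp
      have "(\<integral>s. g s * pt s $ r \<partial>?M) = (\<Sum>c<nX. if c = r then x $ r else 0)"
      proof -
        have "(\<Sum>c<nX. g c * pt c $ r) = (\<Sum>c<nX. if c = r then x $ r else 0)"
          by (rule sum.cong[OF refl]) (use r in \<open>auto simp: g_def pt_def\<close>)
        moreover have "g nX * pt nX $ r = 0" using r by (simp add: pt_def)
        ultimately show ?thesis unfolding int by simp
      qed
      then show "weighted_mean ?M g nX pt $ r = x $ r" using r by simp
    qed (use x in simp)
    have "prediction G k (weighted_mean ?M g nX pt)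
      (\<lambda>t\<in>{k..<T}. weighted_mean ?M g ny (\<lambda>s. ys k s t), \<lambda>t\<in>{k..T}. weighted_mean ?M g nX (\<lambda>s. Xs k s t))"
      by (rule prediction_weighted_mean[OF w one k p[OF k]])
        (auto intro!: L2_vec_count_space prediction_carrier[OF p[OF k]])
    moreover have "\<exists>!yX. prediction G k x yX" using unique k x by (auto simp: unique_predictions_def)
    ultimately have "(y, X) = (\<lambda>t\<in>{k..<T}. weighted_mean ?M g ny (\<lambda>s. ys k s t), \<lambda>t\<in>{k..T}. weighted_mean ?M g nX (\<lambda>s. Xs k s t))"
      using yX unfolding wm_pt by blast
    then have y: "y t = weighted_mean ?M g ny (\<lambda>s. ys k s t)" using t by simp
    have yc: "ys k s t \<in> carrier_vec ny" for s by (rule prediction_carrier(1)[OF p[OF k] t])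
    show ?thesis
    proof (rule eq_vecI)
      fix r assume "r < dim_vec (a t k *\<^sub>v x + b t k)"
      then have r: "r < ny" using carrier_vecD[OF yc] by (simp add: b_def)
      have "(\<Sum>c<nX. (ys k c t $ r - ys k nX t $ r) * x $ c)
          = (\<Sum>c<nX. x $ c * ys k c t $ r) - (\<Sum>c<nX. x $ c) * ys k nX t $ r"
        by (simp add: right_diff_distrib left_diff_distrib sum_subtractf sum_distrib_right mult.commute)
      moreover have "(a t k *\<^sub>v x) $ r = (\<Sum>c<nX. (ys k c t $ r - ys k nX t $ r) * x $ c)"
        by (subst mult_mat_vec_index_sum[of _ ny nX]) (auto simp: a_def r x)
      ultimately show "y t $ r = (a t k *\<^sub>v x + b t k) $ r"
        using r carrier_vecD[OF yc] unfolding y by (simp add: int g_def b_def left_diff_distrib)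
    qed (simp add: y b_def carrier_vecD[OF yc])
  qed
  moreover have "a t k \<in> carrier_mat ny nX" for t k by (simp add: a_def)
  moreover have "b t k \<in> carrier_vec ny" if "k < T" "k \<le> t" "t < T" for t k
    unfolding b_def by (rule prediction_carrier(1)[OF p[OF that(1)] that(2,3)])
  ultimately have "prediction_coeffs G a b"
    unfolding prediction_coeffs_def by auto
  then show ?thesis by blast
qed

end

section \<open>The reference recursion\<close>

locale reference_recursion = noisy_game G for G :: "'w lq_game" +
  fixes a :: "nat \<Rightarrow> nat \<Rightarrow> real mat" and b :: "nat \<Rightarrow> nat \<Rightarrow> real vec"
  assumes coeffs: "prediction_coeffs G a b" and unique: "unique_predictions G"
begin

lemma coeff_carrier: "t \<le> n \<Longrightarrow> n < T \<Longrightarrow> a n t \<in> carrier_mat ny nX" "t \<le> n \<Longrightarrow> n < T \<Longrightarrow> b n t \<in> carrier_vec ny"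
  using coeffs unfolding prediction_coeffs_def by auto

text \<open>By time consistency the coefficients of time \<open>t\<close> also apply inside a prediction made at an
  earlier time \<open>k\<close>. This puts the prediction equations into the closed-loop form of the reference recursion.\<close>

lemma prediction_coeff:
  assumes p: "prediction G k x (y, X)" and k: "k \<le> t" "t \<le> n" "n < T"
  shows "y n = a n t *\<^sub>v X t + b n t"
proof -
  have t: "t < T" using k by simp
  have "prediction G t (X t) (restrict y {t..<T}, restrict X {t..T})"
    by (rule prediction_restrict[OF p k(1) t])
  moreover have "X t \<in> carrier_vec nX" by (rule prediction_carrier(2)[OF p k(1)]) (use t in simp)
  ultimately have "restrict y {t..<T} n = a n t *\<^sub>v X t + b n t"
    using coeffs t k unfolding prediction_coeffs_def by (metis atLeastLessThan_iff)
  then show ?thesis using k by simp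
qed

abbreviation "Xbar \<equiv> bar_X G a b"
abbreviation "Xhat \<equiv> bar_hat G a b"
abbreviation "ybar \<equiv> bar_y G a b"
abbreviation "predicted n t \<omega> \<equiv> a n t *\<^sub>v Xhat t \<omega> + b n t"

abbreviation observations :: "nat \<Rightarrow> 'w \<Rightarrow> nat \<Rightarrow> real vec" where
  "observations t \<omega> \<equiv> \<lambda>k\<in>{..<t}. ybar k \<omega>"

abbreviation obs_algebra :: "nat \<Rightarrow> 'w measure" where
  "obs_algebra t \<equiv> vimage_algebra (space (\<Omega> G)) (observations t) (Y_seqs G t)"

abbreviation "past_algebra t \<equiv> primitive_algebra G (past t)"

lemma past_mono: "s \<le> t \<Longrightarrow> t \<le> T \<Longrightarrow> subalgebra (past_algebra t) (past_algebra s)"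
  by (rule primitive_algebra_mono[OF _ past_subset]) (auto simp: past_def)

lemma past_subalgebra: "t \<le> T \<Longrightarrow> subalgebra (\<Omega> G) (past_algebra t)"
  by (rule primitive_algebra_subalgebra[OF past_subset])

lemma bar_hat_eq: "Xhat t = vec_cond_exp (\<Omega> G) (obs_algebra t) nX (Xbar t)"
  by (rule bar_hat.simps)

lemma obs_algebra_past:
  assumes "t \<le> T" "\<And>k. k < t \<Longrightarrow> ybar k \<in> past_algebra t \<rightarrow>\<^sub>M borel_vec ny"
  shows "subalgebra (past_algebra t) (obs_algebra t)"
  using subalgebra_vimage[of "observations t" "past_algebra t" "Y_seqs G t"] assms(2)
  unfolding Y_seqs_def by (simp add: measurable_restrict)

text \<open>The estimate at time \<open>t\<close> is measurable with respect to observations before \<open>t\<close>, so no primitive of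
  time \<open>t\<close> enters before it is used; square integrability passes from the state to its estimate and on
  to the next state.\<close>

lemma bar_invariant:
  "t \<le> T \<Longrightarrow> Xbar t \<in> past_algebra t \<rightarrow>\<^sub>M borel_vec nX \<and> L2_vec (\<Omega> G) nX (Xbar t) \<and>
     (\<forall>k<t. ybar k \<in> past_algebra t \<rightarrow>\<^sub>M borel_vec ny \<and> L2_vec (\<Omega> G) ny (ybar k))"
proof (induction t)
  case 0
  have "primitive_rv G Initial \<in> past_algebra 0 \<rightarrow>\<^sub>M borel_vec nX"
    using primitive_in_algebra[OF past_subset, of 0 Initial] by (simp add: past_def)
  moreover have "L2_vec (\<Omega> G) nX (primitive_rv G Initial)"
    using primitive_L2[of Initial] by (simp add: primitives_def)
  ultimately show ?case by (simp add: bar_X.simps)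
next
  case (Suc t)
  then have t: "t < T" "t \<le> T" by auto
  note IH = Suc.IH[OF t(2)]
  let ?N = "past_algebra (Suc t)"
  have sub: "subalgebra ?N (past_algebra t)" by (rule past_mono) (use Suc.prems in auto)
  have obs: "subalgebra (past_algebra t) (obs_algebra t)"
    by (rule obs_algebra_past[OF t(2)]) (use IH in auto)
  have obs_\<Omega>: "subalgebra (\<Omega> G) (obs_algebra t)" by (rule subalgebra_trans[OF past_subalgebra[OF t(2)] obs])
  note hat = Om.vec_cond_exp_properties[OF obs_\<Omega>, of nX "Xbar t", folded bar_hat_eq]
  have X: "Xbar t \<in> ?N \<rightarrow>\<^sub>M borel_vec nX" "L2_vec (\<Omega> G) nX (Xbar t)"
    using IH measurable_from_subalg[OF sub] by auto
  have h: "Xhat t \<in> ?N \<rightarrow>\<^sub>M borel_vec nX" "L2_vec (\<Omega> G) nX (Xhat t)"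
    using hat(1,2)[OF X(2)] measurable_from_subalg[OF subalgebra_trans[OF sub obs]] by auto
  have xi: "xi G t \<in> ?N \<rightarrow>\<^sub>M borel_vec ny"
    using primitive_in_algebra[OF past_subset[OF Suc.prems], of "Noise t"] by (simp add: past_def)
  have W: "W_dist G t \<in> ?N \<rightarrow>\<^sub>M borel_vec nX"
    using primitive_in_algebra[OF past_subset[OF Suc.prems], of "Disturb t"] by (simp add: past_def)
  have pred: "(predicted n t) \<in> ?N \<rightarrow>\<^sub>M borel_vec ny"
    "L2_vec (\<Omega> G) ny (predicted n t)" if "t \<le> n" "n < T" for n
    using that coeff_carrier[OF that]
    by (auto intro!: borel_vec_add borel_vec_mult_mat[OF _ h(1)] borel_vec_const L2_vec_add Om.L2_vec_mult_mat[OF _ h(2)] Om.L2_vec_const)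
  have sum: "(\<lambda>\<omega>. vec_sum m (\<lambda>n. P n *\<^sub>v predicted n t \<omega>) {t..<T}) \<in> ?N \<rightarrow>\<^sub>M borel_vec m"
    "L2_vec (\<Omega> G) m (\<lambda>\<omega>. vec_sum m (\<lambda>n. P n *\<^sub>v predicted n t \<omega>) {t..<T})"
    if "\<And>n. t \<le> n \<Longrightarrow> n < T \<Longrightarrow> P n \<in> carrier_mat m ny" for P m
    using borel_vec_mult_mat[OF that pred(1)] Om.L2_vec_mult_mat[OF that pred(2)]
    by (auto intro!: borel_vec_vec_sum Om.L2_vec_sum)
  note cD = D_agg_carrier[OF t(1)] and cA = A_agg_carrier[OF t(1)] and cC = C_agg_carrier[OF t(1)]
    and cH = HX_agg_carrier[OF t(1)]
  have y: "ybar t \<in> ?N \<rightarrow>\<^sub>M borel_vec ny" "L2_vec (\<Omega> G) ny (ybar t)"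
    unfolding bar_y.simps
    by (rule borel_vec_add[OF borel_vec_add[OF borel_vec_add[OF borel_vec_mult_mat[OF cD X(1)]
            sum(1)[OF Gp_agg_carrier]] borel_vec_const[OF Hp_agg_carrier]] xi])
      (rule L2_vec_add[OF L2_vec_add[OF L2_vec_add[OF Om.L2_vec_mult_mat[OF cD X(2)]
            sum(2)[OF Gp_agg_carrier]] Om.L2_vec_const[OF Hp_agg_carrier]] xi_L2[OF t(1)]])
  have "Xbar (Suc t) \<in> ?N \<rightarrow>\<^sub>M borel_vec nX"
    unfolding bar_X.simps
    by (rule borel_vec_add[OF borel_vec_add[OF borel_vec_add[OF borel_vec_add[OF borel_vec_mult_mat[OF cA X(1)]
            sum(1)[OF GX_agg_carrier]] borel_vec_const[OF cH]] borel_vec_mult_mat[OF cC y(1)]] W])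
  moreover have "L2_vec (\<Omega> G) nX (Xbar (Suc t))"
    unfolding bar_X.simps
    by (rule L2_vec_add[OF L2_vec_add[OF L2_vec_add[OF L2_vec_add[OF Om.L2_vec_mult_mat[OF cA X(2)]
            sum(2)[OF GX_agg_carrier]] Om.L2_vec_const[OF cH]] Om.L2_vec_mult_mat[OF cC y(2)]] W_L2[OF t(1)]])
  moreover have "ybar k \<in> ?N \<rightarrow>\<^sub>M borel_vec ny \<and> L2_vec (\<Omega> G) ny (ybar k)" if "k < Suc t" for k
  proof (cases "k = t")
    case False
    then have "k < t" using that by simp
    then show ?thesis using IH by (auto intro: measurable_from_subalg[OF sub])
  qed (use y in simp)
  ultimately show ?case by blast
qed

lemma bar_X_L2: "t \<le> T \<Longrightarrow> L2_vec (\<Omega> G) nX (Xbar t)"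
  and bar_y_past: "k < t \<Longrightarrow> t \<le> T \<Longrightarrow> ybar k \<in> past_algebra t \<rightarrow>\<^sub>M borel_vec ny"
  using bar_invariant by auto

lemma bar_y_L2: "k < T \<Longrightarrow> L2_vec (\<Omega> G) ny (ybar k)"
  using bar_invariant[of T] by auto

lemma obs_subalgebra: "t \<le> T \<Longrightarrow> subalgebra (\<Omega> G) (obs_algebra t)"
  by (rule subalgebra_trans[OF past_subalgebra obs_algebra_past]) (auto intro: bar_y_past)

lemma bar_hat_L2: "t \<le> T \<Longrightarrow> L2_vec (\<Omega> G) nX (Xhat t)"
  and bar_hat_obs: "t \<le> T \<Longrightarrow> Xhat t \<in> obs_algebra t \<rightarrow>\<^sub>M borel_vec nX"
  unfolding bar_hat_eq using Om.vec_cond_exp_properties(1,2)[OF obs_subalgebra bar_X_L2] by auto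

lemma observations_space: "t \<le> T \<Longrightarrow> observations t \<in> space (\<Omega> G) \<rightarrow> space (Y_seqs G t)"
  using L2_vec_carrier[OF bar_y_L2] by (auto simp: Y_seqs_def space_PiM)

lemma observations_measurable: "k \<le> t \<Longrightarrow> t \<le> T \<Longrightarrow> observations k \<in> obs_algebra t \<rightarrow>\<^sub>M Y_seqs G k"
proof -
  assume k: "k \<le> t" "t \<le> T"
  have "(\<lambda>\<omega>. restrict (observations t \<omega>) {..<k}) \<in> obs_algebra t \<rightarrow>\<^sub>M Y_seqs G k"
    by (rule measurable_compose[OF measurable_vimage_algebra1[OF observations_space[OF k(2)]]])
      (unfold Y_seqs_def, rule measurable_restrict_subset, use k in auto)
  moreover have "restrict (observations t \<omega>) {..<k} = observations k \<omega>" for \<omega>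
    using k by (auto simp: restrict_def fun_eq_iff)
  ultimately show ?thesis by simp
qed

lemma estimator_exists: "\<exists>est. state_estimator G a b est"
proof -
  have "\<exists>h\<in>Y_seqs G t \<rightarrow>\<^sub>M borel_vec nX. \<forall>\<omega>\<in>space (\<Omega> G). Xhat t \<omega> = h (observations t \<omega>)" if "t < T" for t
    by (rule Doob_Dynkin_vec[OF bar_hat_obs observations_space]) (use that in auto)
  then obtain est where "\<And>t. t < T \<Longrightarrow> est t \<in> Y_seqs G t \<rightarrow>\<^sub>M borel_vec nX"
    "\<And>t \<omega>. t < T \<Longrightarrow> \<omega> \<in> space (\<Omega> G) \<Longrightarrow> Xhat t \<omega> = est t (observations t \<omega>)"
    by metis
  then have "state_estimator G a b est"
    unfolding state_estimator_def by auto
  then show ?thesis by blast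
qed

section \<open>Forecast errors are orthogonal to the past\<close>

context
  fixes k :: nat and \<phi> :: "(nat \<Rightarrow> real vec) \<Rightarrow> real" and B :: real
  assumes k: "k < T" and \<phi>: "\<phi> \<in> borel_measurable (Y_seqs G k)" and \<phi>_bounded: "\<And>y. \<bar>\<phi> y\<bar> \<le> B"
begin

abbreviation "wt \<equiv> \<lambda>\<omega>. \<phi> (observations k \<omega>)"

lemma wt_obs: "k \<le> t \<Longrightarrow> t \<le> T \<Longrightarrow> wt \<in> borel_measurable (obs_algebra t)"
  by (rule measurable_compose[OF observations_measurable \<phi>])

lemma wt_past: "k \<le> t \<Longrightarrow> t \<le> T \<Longrightarrow> wt \<in> borel_measurable (past_algebra t)"
  by (rule measurable_from_subalg[OF obs_algebra_past wt_obs]) (auto intro: bar_y_past)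

lemma bounded_weight_wt: "bounded_weight (\<Omega> G) wt B"
  by unfold_locales
    (use measurable_from_subalg[OF obs_subalgebra wt_obs, of k] k \<phi>_bounded in auto)

lemma wt_hat: "k \<le> t \<Longrightarrow> t \<le> T \<Longrightarrow>
  weighted_mean (\<Omega> G) wt nX (Xhat t) = weighted_mean (\<Omega> G) wt nX (Xbar t)"
  unfolding bar_hat_eq
  by (rule Om.vec_cond_exp_properties(3)[OF obs_subalgebra bar_X_L2 wt_obs \<phi>_bounded])

lemma wt_primitive:
  assumes one: "(\<integral>\<omega>. wt \<omega> \<partial>\<Omega> G) = 1" and t: "k \<le> t" "t < T"
  shows "weighted_mean (\<Omega> G) wt ny (xi G t) = vec_expectation (\<Omega> G) ny (xi G t)"
    and "weighted_mean (\<Omega> G) wt nX (W_dist G t) = vec_expectation (\<Omega> G) nX (W_dist G t)"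
proof -
  have g: "wt \<in> borel_measurable (past_algebra t)" by (rule wt_past) (use t in auto)
  have J: "past t \<subseteq> primitives G" by (rule past_subset) (use t in simp)
  have "Noise t \<in> primitives G" "Noise t \<notin> past t" "Disturb t \<in> primitives G" "Disturb t \<notin> past t"
    using t by (auto simp: primitives_def past_def)
  then show "weighted_mean (\<Omega> G) wt ny (xi G t) = vec_expectation (\<Omega> G) ny (xi G t)"
    "weighted_mean (\<Omega> G) wt nX (W_dist G t) = vec_expectation (\<Omega> G) nX (W_dist G t)"
    using primitive_weighted_mean[of "Noise t", OF _ J _ g \<phi>_bounded]
      primitive_weighted_mean[of "Disturb t", OF _ J _ g \<phi>_bounded] one by simp_all
qed

text \<open>Both sequences of averages start at the average of the estimate of time \<open>k\<close> and follow the same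
  deterministic closed-loop recursion as the prediction from that point. In the average the estimate
  can be replaced by the state at every later time as well, because the weight is a function of even
  fewer observations.\<close>

lemma wt_prediction:
  assumes one: "(\<integral>\<omega>. wt \<omega> \<partial>\<Omega> G) = 1"
    and p: "prediction G k (weighted_mean (\<Omega> G) wt nX (Xhat k)) (y, X)"
  shows "k \<le> t \<Longrightarrow> t < T \<Longrightarrow> weighted_mean (\<Omega> G) wt ny (ybar t) = y t"
proof -
  interpret bounded_weight "\<Omega> G" wt B by (rule bounded_weight_wt)
  have pred_mean: "weighted_mean (\<Omega> G) wt ny (predicted n t) = y n"
    if X: "weighted_mean (\<Omega> G) wt nX (Xbar t) = X t" and t: "k \<le> t" "t \<le> n" "n < T" for t n
  proof -
    note c = coeff_carrier[OF t(2,3)]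
    have h: "L2_vec (\<Omega> G) nX (Xhat t)" by (rule bar_hat_L2) (use t in simp)
    have "weighted_mean (\<Omega> G) wt ny (\<lambda>\<omega>. b n t) = b n t"
      unfolding weighted_mean_const[OF c(2)] one by (rule one_smult_vec)
    then have "weighted_mean (\<Omega> G) wt ny (predicted n t)
        = a n t *\<^sub>v weighted_mean (\<Omega> G) wt nX (Xhat t) + b n t"
      by (simp add: weighted_mean_add[OF Om.L2_vec_mult_mat[OF c(1) h] Om.L2_vec_const[OF c(2)]]
          weighted_mean_mult_mat[OF c(1) h])
    also have "\<dots> = y n" using wt_hat[of t] X prediction_coeff[OF p t] t by simp
    finally show ?thesis .
  qed
  have pred_L2: "L2_vec (\<Omega> G) ny (predicted n t)" if "t \<le> n" "n < T" for n t
    using that coeff_carrier[OF that] bar_hat_L2[of t] by (auto intro!: L2_vec_add Om.L2_vec_mult_mat Om.L2_vec_const)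
  have sums: "vec_sum m (\<lambda>n. P n *\<^sub>v weighted_mean (\<Omega> G) wt ny (predicted n t)) {t..<T}
      = vec_sum m (\<lambda>n. P n *\<^sub>v y n) {t..<T}"
    if "weighted_mean (\<Omega> G) wt nX (Xbar t) = X t" "k \<le> t" for m t and P :: "nat \<Rightarrow> real mat"
    using pred_mean[OF that] by (intro vec_sum_cong) auto
  have y_mean: "weighted_mean (\<Omega> G) wt ny (ybar t) = y t"
    if X: "weighted_mean (\<Omega> G) wt nX (Xbar t) = X t" and t: "k \<le> t" "t < T" for t
  proof -
    have "weighted_mean (\<Omega> G) wt ny (ybar t)
      = D_agg G t *\<^sub>v weighted_mean (\<Omega> G) wt nX (Xbar t)
        + vec_sum ny (\<lambda>n. Gp_agg G t n *\<^sub>v weighted_mean (\<Omega> G) wt ny (predicted n t)) {t..<T}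
        + Hp_agg G t + weighted_mean (\<Omega> G) wt ny (xi G t)"
      unfolding bar_y.simps[of G a b t]
      by (rule weighted_mean_observation[OF bounded_weight_wt one t(2)]) (use t bar_X_L2 xi_L2 pred_L2 in auto)
    then show ?thesis
      unfolding sums[OF X t(1)] X wt_primitive[OF one t] prediction_eqs(2)[OF p t, symmetric] .
  qed
  have X_mean: "k \<le> t \<Longrightarrow> t \<le> T \<Longrightarrow> weighted_mean (\<Omega> G) wt nX (Xbar t) = X t" for t
  proof (induction t rule: nat_induct_at_least)
    case base
    show ?case unfolding prediction_eqs(1)[OF p] by (rule wt_hat[symmetric]) (use k in auto)
  next
    case (Suc t)
    from Suc.hyps Suc.prems have t: "k \<le> t" "t < T" by auto
    have X: "weighted_mean (\<Omega> G) wt nX (Xbar t) = X t" by (rule Suc.IH) (use t in simp)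
    have "weighted_mean (\<Omega> G) wt nX (Xbar (Suc t))
      = A_agg G t *\<^sub>v weighted_mean (\<Omega> G) wt nX (Xbar t)
        + vec_sum nX (\<lambda>n. GX_agg G t n *\<^sub>v weighted_mean (\<Omega> G) wt ny (predicted n t)) {t..<T}
        + HX_agg G t + C_agg G t *\<^sub>v weighted_mean (\<Omega> G) wt ny (ybar t) + weighted_mean (\<Omega> G) wt nX (W_dist G t)"
      unfolding bar_X.simps
      by (rule weighted_mean_state[OF bounded_weight_wt one t(2)]) (use t bar_X_L2 bar_y_L2 W_L2 pred_L2 in auto)
    then show ?case
      unfolding sums[OF X t(1)] X y_mean[OF X t] wt_primitive[OF one t] prediction_eqs(3)[OF p t, symmetric] .
  qed
  show "k \<le> t \<Longrightarrow> t < T \<Longrightarrow> weighted_mean (\<Omega> G) wt ny (ybar t) = y t"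
    using y_mean X_mean by simp
qed

lemma prediction_error_mean_one:
  assumes one: "(\<integral>\<omega>. wt \<omega> \<partial>\<Omega> G) = 1" and t: "k \<le> t" "t < T"
  shows "weighted_mean (\<Omega> G) wt ny (\<lambda>\<omega>. predicted t k \<omega> - ybar t \<omega>) = 0\<^sub>v ny"
proof -
  interpret bounded_weight "\<Omega> G" wt B by (rule bounded_weight_wt)
  let ?x = "weighted_mean (\<Omega> G) wt nX (Xhat k)"
  obtain y X where p: "prediction G k ?x (y, X)"
    using unique k unfolding unique_predictions_def by (metis surj_pair weighted_mean_carrier)
  note c = coeff_carrier[OF t]
  have h: "L2_vec (\<Omega> G) nX (Xhat k)" by (rule bar_hat_L2) (use k in simp)
  have b1: "weighted_mean (\<Omega> G) wt ny (\<lambda>\<omega>. b t k) = b t k"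
    unfolding weighted_mean_const[OF c(2)] one by (rule one_smult_vec)
  have "weighted_mean (\<Omega> G) wt ny (\<lambda>\<omega>. predicted t k \<omega> - ybar t \<omega>)
      = (a t k *\<^sub>v ?x + b t k) - weighted_mean (\<Omega> G) wt ny (ybar t)"
    by (simp add: weighted_mean_minus[OF L2_vec_add[OF Om.L2_vec_mult_mat[OF c(1) h] Om.L2_vec_const[OF c(2)]] bar_y_L2[OF t(2)]]
        weighted_mean_add[OF Om.L2_vec_mult_mat[OF c(1) h] Om.L2_vec_const[OF c(2)]]
        weighted_mean_mult_mat[OF c(1) h] b1)
  also have "weighted_mean (\<Omega> G) wt ny (ybar t) = y t" by (rule wt_prediction[OF one p t])
  also have "y t = a t k *\<^sub>v ?x + b t k"
    using prediction_coeff[OF p order_refl t] prediction_eqs(1)[OF p] by simp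
  also have "(a t k *\<^sub>v ?x + b t k) - (a t k *\<^sub>v ?x + b t k) = 0\<^sub>v ny"
    by (rule minus_cancel_vec) (use c in simp)
  finally show ?thesis .
qed

end

text \<open>Adding a constant to the weight makes its mean one, and the constant one is itself a weight of
  mean one; both averages of the error vanish, hence so does their difference.\<close>

lemma prediction_error_orthogonal:
  assumes t: "k \<le> t" "t < T" and \<phi>: "\<phi> \<in> borel_measurable (Y_seqs G k)" "\<And>y. \<bar>\<phi> y\<bar> \<le> B"
  shows "weighted_mean (\<Omega> G) (\<lambda>\<omega>. \<phi> (observations k \<omega>)) ny
    (\<lambda>\<omega>. predicted t k \<omega> - ybar t \<omega>) = 0\<^sub>v ny"
proof (rule eq_vecI)
  fix r assume "r < dim_vec (0\<^sub>v ny :: real vec)"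
  then have r: "r < ny" by simp
  have k: "k < T" using t by simp
  let ?e = "\<lambda>\<omega>. (predicted t k \<omega> - ybar t \<omega>) $ r"
  let ?g = "\<lambda>\<omega>. \<phi> (observations k \<omega>)"
  interpret bounded_weight "\<Omega> G" ?g B by (rule bounded_weight_wt[OF k \<phi>])
  \<comment> \<open>The constant that raises the mean of the weight to one.\<close>
  define c where "c = 1 - (\<integral>\<omega>. ?g \<omega> \<partial>\<Omega> G)"
  have g_int: "integrable (\<Omega> G) ?g"
    using integrable_bounded_mult[of "\<Omega> G" "\<lambda>_. 1" ?g B] g_meas g_bounded by simp
  have e_L2: "L2_vec (\<Omega> G) ny (\<lambda>\<omega>. predicted t k \<omega> - ybar t \<omega>)"
    using coeff_carrier[OF t] bar_hat_L2[of k] bar_y_L2[OF t(2)] k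
    by (auto intro!: Om.L2_vec_minus L2_vec_add Om.L2_vec_mult_mat Om.L2_vec_const)
  have e_int: "integrable (\<Omega> G) ?e" by (rule Om.L2_rv_integrable[OF L2_vec_index[OF e_L2 r]])
  have ge_int: "integrable (\<Omega> G) (\<lambda>\<omega>. ?g \<omega> * ?e \<omega>)" by (rule weighted_integrable[OF e_L2 r])
  have 1: "(\<integral>\<omega>. (?g \<omega> + c) * ?e \<omega> \<partial>\<Omega> G) = 0"
  proof -
    have "\<bar>\<phi> y + c\<bar> \<le> B + \<bar>c\<bar>" for y using \<phi>(2)[of y] by linarith
    moreover have "(\<integral>\<omega>. ?g \<omega> + c \<partial>\<Omega> G) = 1" using g_int by (simp add: c_def Om.prob_space)
    ultimately have "weighted_mean (\<Omega> G) (\<lambda>\<omega>. \<phi> (observations k \<omega>) + c) ny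
        (\<lambda>\<omega>. predicted t k \<omega> - ybar t \<omega>) $ r = 0\<^sub>v ny $ r"
      using \<phi>(1) by (subst prediction_error_mean_one[OF k, of "\<lambda>y. \<phi> y + c" "B + \<bar>c\<bar>", OF _ _ _ t]) auto
    then show ?thesis using r by simp
  qed
  have 2: "(\<integral>\<omega>. ?e \<omega> \<partial>\<Omega> G) = 0"
  proof -
    have "weighted_mean (\<Omega> G) (\<lambda>\<omega>. 1) ny
        (\<lambda>\<omega>. predicted t k \<omega> - ybar t \<omega>) $ r = 0\<^sub>v ny $ r"
      by (subst prediction_error_mean_one[OF k, of "\<lambda>y. 1" 1, OF _ _ _ t]) (auto simp: Om.prob_space)
    then show ?thesis using r by simp
  qed
  have "(\<integral>\<omega>. ?g \<omega> * ?e \<omega> \<partial>\<Omega> G) = (\<integral>\<omega>. (?g \<omega> + c) * ?e \<omega> \<partial>\<Omega> G) - c * (\<integral>\<omega>. ?e \<omega> \<partial>\<Omega> G)"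
    using ge_int e_int by (simp add: distrib_right)
  then show "weighted_mean (\<Omega> G) ?g ny (\<lambda>\<omega>. predicted t k \<omega> - ybar t \<omega>) $ r = 0\<^sub>v ny $ r"
    using r 1 2 by simp
qed simp

end

declare game_x.simps [simp del] game_u.simps [simp del] game_y.simps [simp del]

section \<open>The game under the candidate strategies\<close>

text \<open>The given estimator agrees with the conditional expectation almost surely only, so the
  game under the candidate strategies can differ from the reference recursion on a null set.\<close>

locale candidate_equilibrium = reference_recursion G a b
  for G :: "'w lq_game" and a :: "nat \<Rightarrow> nat \<Rightarrow> real mat" and b :: "nat \<Rightarrow> nat \<Rightarrow> real vec" +
  fixes est :: "nat \<Rightarrow> (nat \<Rightarrow> real vec) \<Rightarrow> real vec"
  assumes estimator: "state_estimator G a b est"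
begin

abbreviation "N \<equiv> num_dm G"
abbreviation "s \<equiv> eq_strategy G a b est"

definition forecast :: "nat \<Rightarrow> nat \<Rightarrow> (nat \<Rightarrow> real vec) \<Rightarrow> real vec" where
  "forecast t k y = a k t *\<^sub>v est t y + b k t"

lemma est_measurable: "t < T \<Longrightarrow> est t \<in> Y_seqs G t \<rightarrow>\<^sub>M borel_vec nX"
  and est_AE: "t < T \<Longrightarrow> AE \<omega> in \<Omega> G. est t (observations t \<omega>) = Xhat t \<omega>"
  using estimator unfolding state_estimator_def by auto

lemma forecast_measurable: "t \<le> k \<Longrightarrow> k < T \<Longrightarrow> forecast t k \<in> Y_seqs G t \<rightarrow>\<^sub>M borel_vec ny"
  unfolding forecast_def[abs_def]
  by (intro borel_vec_add borel_vec_mult_mat[OF coeff_carrier(1)] est_measurable borel_vec_const coeff_carrier(2)) auto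

lemma G_mat_dim: "j \<in> DM G \<Longrightarrow> t \<le> k \<Longrightarrow> k < T \<Longrightarrow> G_mat G j t k \<in> carrier_mat (dim_u G j) ny"
  and H_vec_dim: "j \<in> DM G \<Longrightarrow> t < T \<Longrightarrow> H_vec G j t \<in> carrier_vec (dim_u G j)"
  using decision_maker.G_mat_carrier[OF decision_makerI] decision_maker.H_vec_carrier[OF decision_makerI] by auto

abbreviation reply :: "nat \<Rightarrow> nat \<Rightarrow> (nat \<Rightarrow> real vec) \<Rightarrow> real vec" where
  "reply j t y \<equiv> decision_maker.response G j forecast t y"

lemma reply_eq: "j \<in> DM G \<Longrightarrow> reply j t y
    = vec_sum (dim_u G j) (\<lambda>k. G_mat G j t k *\<^sub>v forecast t k y) {t..<T} + H_vec G j t"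
  using decision_maker.response_def[OF decision_makerI] .

text \<open>Forecasts are affine in the state estimate; \<open>G_total\<close> and \<open>H_check\<close> collect the coefficients of the
  response to them.\<close>

lemma eq_strategy_reply:
  assumes j: "j \<in> DM G" and t: "t < T" and e: "est t y \<in> carrier_vec nX"
  shows "s j t ((x, u), y) = F_mat G j t *\<^sub>v x t + reply j t y"
proof -
  let ?d = "dim_u G j"
  have Gc: "G_mat G j t k \<in> carrier_mat ?d ny" if "k \<in> {t..<T}" for k using G_mat_dim[OF j] that by simp
  have ac: "a k t \<in> carrier_mat ny nX" "b k t \<in> carrier_vec ny" if "k \<in> {t..<T}" for k
    using coeff_carrier that by auto
  have "G_total G a j t *\<^sub>v est t y = vec_sum ?d (\<lambda>k. G_mat G j t k *\<^sub>v (a k t *\<^sub>v est t y)) {t..<T}"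
    unfolding G_total_def using mult_carrier_mat[OF Gc ac(1)] e
    by (subst mat_sum_mult_vec) (auto intro!: vec_sum_cong assoc_mult_mat_vec[OF Gc ac(1)])
  moreover have "vec_sum ?d (\<lambda>k. G_mat G j t k *\<^sub>v forecast t k y) {t..<T}
      = vec_sum ?d (\<lambda>k. G_mat G j t k *\<^sub>v (a k t *\<^sub>v est t y)) {t..<T} + vec_sum ?d (\<lambda>k. G_mat G j t k *\<^sub>v b k t) {t..<T}"
  proof -
    have "vec_sum ?d (\<lambda>k. G_mat G j t k *\<^sub>v forecast t k y) {t..<T}
        = vec_sum ?d (\<lambda>k. G_mat G j t k *\<^sub>v (a k t *\<^sub>v est t y) + G_mat G j t k *\<^sub>v b k t) {t..<T}"
      unfolding forecast_def using mult_mat_vec_carrier[OF ac(1) e] ac(2)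
      by (intro vec_sum_cong refl mult_add_distrib_mat_vec[OF Gc]) auto
    also have "\<dots> = vec_sum ?d (\<lambda>k. G_mat G j t k *\<^sub>v (a k t *\<^sub>v est t y)) {t..<T} + vec_sum ?d (\<lambda>k. G_mat G j t k *\<^sub>v b k t) {t..<T}"
      using mult_mat_vec_carrier[OF ac(1) e] ac(2) by (intro vec_sum_add mult_mat_vec_carrier[OF Gc]) auto
    finally show ?thesis .
  qed
  ultimately show ?thesis
    unfolding eq_strategy_def H_check_def reply_eq[OF j] using H_vec_dim[OF j t] game_matrix_carrier(8)[OF t j]
    by (auto intro!: eq_vecI simp: carrier_vecD[OF H_vec_dim[OF j t]])
qed

lemma eq_strategy_pure:
  assumes j: "j \<in> DM G"
  shows "s j \<in> pure_strategies G j"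
proof -
  have "s j t \<in> ((\<Pi>\<^sub>M k\<in>{..t}. X_space G j) \<Otimes>\<^sub>M (\<Pi>\<^sub>M k\<in>{..<t}. U_space G j)) \<Otimes>\<^sub>M Y_seqs G t \<rightarrow>\<^sub>M borel_vec (dim_u G j)"
    if t: "t < T" for t
  proof -
    have x: "(\<lambda>p. fst (fst p) t) \<in> ((\<Pi>\<^sub>M k\<in>{..t}. X_space G j) \<Otimes>\<^sub>M (\<Pi>\<^sub>M k\<in>{..<t}. U_space G j)) \<Otimes>\<^sub>M Y_seqs G t
        \<rightarrow>\<^sub>M borel_vec (dim_x G j)"
      unfolding X_space_def
      by (rule measurable_compose[OF measurable_fst measurable_compose[OF measurable_fst measurable_component_singleton]]) simp
    have h: "H_check G b j t \<in> carrier_vec (dim_u G j)"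
      unfolding H_check_def using H_vec_dim[OF j t] by simp
    have g: "G_total G a j t \<in> carrier_mat (dim_u G j) nX" by (simp add: G_total_def)
    show ?thesis
      unfolding eq_strategy_def split_beta'
      by (intro borel_vec_add borel_vec_mult_mat[OF game_matrix_carrier(8)[OF t j] x] borel_vec_const h
          borel_vec_mult_mat[OF g measurable_compose[OF measurable_snd est_measurable[OF t]]])
  qed
  then show ?thesis unfolding pure_strategies_def U_space_def by simp
qed

lemma range_split: "{..<Suc N} = insert 0 (DM G)" "0 \<notin> DM G" "finite (DM G)"
  by (auto simp: DM_def)

lemma mult_reply:
  assumes j: "j \<in> DM G" and t: "t < T" and P: "P \<in> carrier_mat m (dim_u G j)"
    and y: "\<And>n. n \<in> {t..<T} \<Longrightarrow> forecast t n y \<in> carrier_vec ny"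
  shows "P *\<^sub>v reply j t y = vec_sum m (\<lambda>n. (P * G_mat G j t n) *\<^sub>v forecast t n y) {t..<T} + P *\<^sub>v H_vec G j t"
proof -
  have Gc: "G_mat G j t k \<in> carrier_mat (dim_u G j) ny" if "k \<in> {t..<T}" for k using G_mat_dim[OF j] that by simp
  have "P *\<^sub>v vec_sum (dim_u G j) (\<lambda>n. G_mat G j t n *\<^sub>v forecast t n y) {t..<T}
      = vec_sum m (\<lambda>n. (P * G_mat G j t n) *\<^sub>v forecast t n y) {t..<T}"
    using mult_mat_vec_carrier[OF Gc y] by (subst mult_mat_vec_sum[OF P]) (auto intro!: vec_sum_cong assoc_mult_mat_vec[symmetric, OF P Gc y])
  then show ?thesis
    unfolding reply_eq[OF j] by (simp add: mult_add_distrib_mat_vec[OF P vec_sum_carrier H_vec_dim[OF j t]])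
qed

text \<open>Elimination of the controls from a sum over all decision makers. With \<open>E\<close>-matrices for \<open>P, R\<close> this yields the
  observation equation, with \<open>B\<close>-matrices the environment dynamics.\<close>

lemma aggregate_feedback:
  assumes t: "t < T" and Z: "Z \<in> carrier_mat m (dim_x G 0)"
    and P: "\<And>j. j \<in> DM G \<Longrightarrow> P j \<in> carrier_mat m (dim_u G j)"
    and R: "\<And>j. j \<in> DM G \<Longrightarrow> R j \<in> carrier_mat m (dim_x G j)"
    and x: "\<And>j. j \<le> N \<Longrightarrow> x j \<in> carrier_vec (dim_x G j)"
    and y: "\<And>n. n \<in> {t..<T} \<Longrightarrow> forecast t n y \<in> carrier_vec ny"
    and u: "\<And>j. j \<in> DM G \<Longrightarrow> u j = F_mat G j t *\<^sub>v x j + reply j t y"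
  shows "Z *\<^sub>v x 0 + vec_sum m (\<lambda>j. P j *\<^sub>v u j + R j *\<^sub>v x j) (DM G)
    = vec_sum m (\<lambda>j. (if j = 0 then Z else P j * F_mat G j t + R j) *\<^sub>v x j) {..<Suc N}
      + vec_sum m (\<lambda>n. mat_sum m ny (\<lambda>j. P j * G_mat G j t n) (DM G) *\<^sub>v forecast t n y) {t..<T}
      + vec_sum m (\<lambda>j. P j *\<^sub>v H_vec G j t) (DM G)" (is "?L = ?R")
proof (rule eq_vecI)
  fix r assume "r < dim_vec ?R"
  then have r: "r < m" by simp
  have x0: "x 0 \<in> carrier_vec (dim_x G 0)" by (rule x) simp
  have pj: "(P j *\<^sub>v u j + R j *\<^sub>v x j) $ r = ((P j * F_mat G j t + R j) *\<^sub>v x j) $ r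
      + (\<Sum>n\<in>{t..<T}. ((P j * G_mat G j t n) *\<^sub>v forecast t n y) $ r) + (P j *\<^sub>v H_vec G j t) $ r" if j: "j \<in> DM G" for j
  proof -
    have xj: "x j \<in> carrier_vec (dim_x G j)" using x j by (simp add: DM_def)
    note F = game_matrix_carrier(8)[OF t j]
    have rc: "reply j t y \<in> carrier_vec (dim_u G j)"
      unfolding reply_eq[OF j] using H_vec_dim[OF j t] by simp
    have "P j *\<^sub>v u j = (P j * F_mat G j t) *\<^sub>v x j + P j *\<^sub>v reply j t y"
      unfolding u[OF j] mult_add_distrib_mat_vec[OF P[OF j] mult_mat_vec_carrier[OF F xj] rc] assoc_mult_mat_vec[OF P[OF j] F xj] ..
    moreover have "(P j * F_mat G j t + R j) *\<^sub>v x j = (P j * F_mat G j t) *\<^sub>v x j + R j *\<^sub>v x j"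
      by (rule add_mult_distrib_mat_vec[OF mult_carrier_mat[OF P[OF j] F] R[OF j] xj])
    moreover have "dim_row (P j) = m" "dim_row (R j) = m" using P[OF j] R[OF j] by auto
    moreover have "P j *\<^sub>v reply j t y
        = vec_sum m (\<lambda>n. (P j * G_mat G j t n) *\<^sub>v forecast t n y) {t..<T} + P j *\<^sub>v H_vec G j t"
      by (rule mult_reply[OF j t P[OF j]]) (rule y)
    ultimately show ?thesis
      using r mult_mat_vec_carrier[OF P[OF j] H_vec_dim[OF j t]]
      by (simp del: index_mult_mat_vec assoc_mult_mat_vec)
  qed
  have ms: "(mat_sum m ny (\<lambda>j. P j * G_mat G j t n) (DM G) *\<^sub>v forecast t n y) $ r
      = (\<Sum>j\<in>DM G. ((P j * G_mat G j t n) *\<^sub>v forecast t n y) $ r)" if n: "n \<in> {t..<T}" for n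
    using r G_mat_dim n mult_carrier_mat[OF P] by (subst mat_sum_mult_vec[OF _ y[OF n]]) auto
  have "?L $ r = (Z *\<^sub>v x 0) $ r + (\<Sum>j\<in>DM G. ((P j * F_mat G j t + R j) *\<^sub>v x j) $ r)
      + (\<Sum>n\<in>{t..<T}. \<Sum>j\<in>DM G. ((P j * G_mat G j t n) *\<^sub>v forecast t n y) $ r) + (\<Sum>j\<in>DM G. (P j *\<^sub>v H_vec G j t) $ r)"
    using r pj sum.swap[of "\<lambda>n j. ((P j * G_mat G j t n) *\<^sub>v forecast t n y) $ r" "DM G" "{t..<T}"]
    by (simp add: sum.distrib del: index_mult_mat_vec assoc_mult_mat_vec)
  also have "(Z *\<^sub>v x 0) $ r + (\<Sum>j\<in>DM G. ((P j * F_mat G j t + R j) *\<^sub>v x j) $ r)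
      = (\<Sum>j\<in>{..<Suc N}. ((if j = 0 then Z else P j * F_mat G j t + R j) *\<^sub>v x j) $ r)"
  proof -
    have "(\<Sum>j\<in>DM G. ((if j = 0 then Z else P j * F_mat G j t + R j) *\<^sub>v x j) $ r)
        = (\<Sum>j\<in>DM G. ((P j * F_mat G j t + R j) *\<^sub>v x j) $ r)"
      by (rule sum.cong) (auto simp: DM_def)
    then show ?thesis unfolding range_split(1) using range_split(2,3) by (simp del: index_mult_mat_vec)
  qed
  also have "(\<Sum>n\<in>{t..<T}. \<Sum>j\<in>DM G. ((P j * G_mat G j t n) *\<^sub>v forecast t n y) $ r)
      = (\<Sum>n\<in>{t..<T}. (mat_sum m ny (\<lambda>j. P j * G_mat G j t n) (DM G) *\<^sub>v forecast t n y) $ r)"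
    using ms by simp
  finally show "?L $ r = ?R $ r" using r by (simp del: index_mult_mat_vec)
qed simp

abbreviation observed :: "nat \<Rightarrow> 'w \<Rightarrow> nat \<Rightarrow> real vec" where
  "observed t \<omega> \<equiv> \<lambda>k\<in>{..<t}. game_y G s \<omega> k"

abbreviation joint_state :: "nat \<Rightarrow> 'w \<Rightarrow> real vec" where
  "joint_state t \<omega> \<equiv> stack_vec (Suc N) (\<lambda>i. game_x G s \<omega> i t)"

lemma game_x_carrier: "\<omega> \<in> space (\<Omega> G) \<Longrightarrow> t \<le> T \<Longrightarrow> i \<le> N \<Longrightarrow> game_x G s \<omega> i t \<in> carrier_vec (dim_x G i)"
  using init_carrier[of i \<omega>] wdist_carrier[of i "t - 1" \<omega>]
  by (cases t) (auto simp: game_x.simps intro!: carrier_vecI)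

lemma game_y_carrier: "\<omega> \<in> space (\<Omega> G) \<Longrightarrow> t < T \<Longrightarrow> game_y G s \<omega> t \<in> carrier_vec ny"
  using L2_vec_carrier[OF xi_L2, of t \<omega>] by (subst game_y.simps) (auto intro!: carrier_vecI)

lemma observed_space: "\<omega> \<in> space (\<Omega> G) \<Longrightarrow> t \<le> T \<Longrightarrow> observed t \<omega> \<in> space (Y_seqs G t)"
  using game_y_carrier by (auto simp: Y_seqs_def space_PiM)

context
  fixes \<omega> t
  assumes \<omega>: "\<omega> \<in> space (\<Omega> G)" and t: "t < T"
begin

lemma est_carrier: "est t (observed t \<omega>) \<in> carrier_vec nX"
  using measurable_space[OF est_measurable[OF t] observed_space[OF \<omega>]] t by simp

lemma forecast_carrier: "n \<in> {t..<T} \<Longrightarrow> forecast t n (observed t \<omega>) \<in> carrier_vec ny"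
  using measurable_space[OF forecast_measurable observed_space[OF \<omega>], of t n] t by simp

lemma game_u_reply: "j \<in> DM G \<Longrightarrow> game_u G s \<omega> j t = F_mat G j t *\<^sub>v game_x G s \<omega> j t + reply j t (observed t \<omega>)"
  by (subst game_u.simps) (simp add: eq_strategy_reply[OF _ t est_carrier])

lemma x_carrier: "i \<le> N \<Longrightarrow> game_x G s \<omega> i t \<in> carrier_vec (dim_x G i)"
  using game_x_carrier[OF \<omega>] t by simp

lemma game_y_recursion:
  "game_y G s \<omega> t = D_agg G t *\<^sub>v joint_state t \<omega>
     + vec_sum ny (\<lambda>n. Gp_agg G t n *\<^sub>v forecast t n (observed t \<omega>)) {t..<T} + Hp_agg G t + xi G t \<omega>"
proof -
  have D: "D_agg G t *\<^sub>v joint_state t \<omega>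
      = vec_sum ny (\<lambda>j. (if j = 0 then Dm G t else E1 G j t * F_mat G j t + E2 G j t) *\<^sub>v game_x G s \<omega> j t) {..<Suc N}"
    unfolding D_agg_def
    by (rule stack_cols_mult_vec[OF D_agg_block_carrier]) (use t x_carrier in auto)
  show ?thesis
    unfolding D Gp_agg_def Hp_agg_def
    by (subst game_y.simps, subst aggregate_feedback[OF t environment_carrier(1)[OF t] _ _ x_carrier forecast_carrier game_u_reply])
      (use game_matrix_carrier[OF t] in auto)
qed

text \<open>Both sides are compared block by block: the block of the environment by the elimination of all
  controls, the block of a decision maker by that of a single control.\<close>

lemma joint_state_recursion:
  "joint_state (Suc t) \<omega> = A_agg G t *\<^sub>v joint_state t \<omega>
     + vec_sum nX (\<lambda>n. GX_agg G t n *\<^sub>v forecast t n (observed t \<omega>)) {t..<T}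
     + HX_agg G t + C_agg G t *\<^sub>v game_y G s \<omega> t + W_dist G t \<omega>"
proof -
  let ?x = "\<lambda>j. game_x G s \<omega> j t" and ?y = "game_y G s \<omega> t" and ?f = "\<lambda>n. forecast t n (observed t \<omega>)"
  define Ab where "Ab i j = (if i = 0 then (if j = 0 then Am G 0 t else B1 G j t * F_mat G j t + B2 G j t)
    else (if j = i then Am G i t + Bm G i t * F_mat G i t else 0\<^sub>m (dim_x G i) (dim_x G j)))" for i j
  define Gb where "Gb n i = (if i = 0 then mat_sum (dim_x G 0) ny (\<lambda>j. B1 G j t * G_mat G j t n) (DM G)
          else Bm G i t * G_mat G i t n)" for n i
  define Hb where "Hb i = (if i = 0 then vec_sum (dim_x G 0) (\<lambda>j. B1 G j t *\<^sub>v H_vec G j t) (DM G)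
          else Bm G i t *\<^sub>v H_vec G i t)" for i
  define Cb where "Cb i = (if i = 0 then 0\<^sub>m (dim_x G 0) ny else Cm G i t)" for i
  define va where "va i = vec_sum (dim_x G i) (\<lambda>j. Ab i j *\<^sub>v ?x j) {..<Suc N}" for i
  define vg where "vg i = vec_sum (dim_x G i) (\<lambda>n. Gb n i *\<^sub>v ?f n) {t..<T}" for i
  define vc where "vc i = Cb i *\<^sub>v ?y" for i
  have Abc: "Ab i j \<in> carrier_mat (dim_x G i) (dim_x G j)" if "i < Suc N" "j < Suc N" for i j
    unfolding Ab_def by (rule A_agg_block_carrier[OF t that])
  have Gbc: "Gb n i \<in> carrier_mat (dim_x G i) ny" if "n \<in> {t..<T}" "i < Suc N" for n i
    unfolding Gb_def by (rule GX_agg_block_carrier) (use that in auto)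
  have Hbc: "Hb i \<in> carrier_vec (dim_x G i)" if "i < Suc N" for i
    unfolding Hb_def by (rule HX_agg_block_carrier[OF t that])
  have Cbc: "Cb i \<in> carrier_mat (dim_x G i) ny" if "i < Suc N" for i
    unfolding Cb_def by (rule C_agg_block_carrier[OF t that])
  have y: "?y \<in> carrier_vec ny" by (rule game_y_carrier[OF \<omega> t])
  have vcc: "vc i \<in> carrier_vec (dim_x G i)" if "i < Suc N" for i
    unfolding vc_def by (rule mult_mat_vec_carrier[OF Cbc[OF that] y])
  have wc: "wdist G i t \<omega> \<in> carrier_vec (dim_x G i)" if "i < Suc N" for i
    using wdist_carrier[OF _ t \<omega>] that by simp
  have vac: "va i \<in> carrier_vec (dim_x G i)" and vgc: "vg i \<in> carrier_vec (dim_x G i)" for i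
    by (simp_all add: va_def vg_def)
  have xs: "joint_state t \<omega> \<in> carrier_vec nX"
    unfolding dim_X_eq by (rule stack_vec_carrier) (use x_carrier in auto)
  have 1: "A_agg G t *\<^sub>v joint_state t \<omega> = stack_vec (Suc N) va"
  proof -
    have "A_agg G t *\<^sub>v joint_state t \<omega> = stack_vec (Suc N) (\<lambda>i. stack_cols (dim_x G i) (Suc N) (Ab i) *\<^sub>v joint_state t \<omega>)"
      unfolding A_agg_def Ab_def by (rule stack_rows_mult_vec[OF xs A_agg_row_carrier[OF t]])
    also have "\<dots> = stack_vec (Suc N) va"
      unfolding va_def using x_carrier by (intro stack_vec_cong stack_cols_mult_vec[where d = "dim_x G"] Abc) auto
    finally show ?thesis .
  qed
  have 2: "vec_sum nX (\<lambda>n. GX_agg G t n *\<^sub>v ?f n) {t..<T} = stack_vec (Suc N) vg"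
  proof -
    have "GX_agg G t n *\<^sub>v ?f n = stack_vec (Suc N) (\<lambda>i. Gb n i *\<^sub>v ?f n)" if n: "n \<in> {t..<T}" for n
      unfolding GX_agg_def Gb_def
      by (rule stack_rows_mult_vec[OF forecast_carrier[OF n] GX_agg_block_carrier]) (use n in auto)
    then have "vec_sum nX (\<lambda>n. GX_agg G t n *\<^sub>v ?f n) {t..<T} = vec_sum nX (\<lambda>n. stack_vec (Suc N) (\<lambda>i. Gb n i *\<^sub>v ?f n)) {t..<T}"
      by (intro vec_sum_cong) auto
    also have "\<dots> = stack_vec (Suc N) vg"
      unfolding vg_def dim_X_eq
      by (rule stack_vec_vec_sum[symmetric]) (rule mult_mat_vec_carrier[OF Gbc forecast_carrier])
    finally show ?thesis .
  qed
  have 3: "HX_agg G t = stack_vec (Suc N) Hb"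
    unfolding HX_agg_def Hb_def ..
  have 4: "C_agg G t *\<^sub>v ?y = stack_vec (Suc N) vc"
    unfolding C_agg_def vc_def Cb_def by (rule stack_rows_mult_vec[OF y C_agg_block_carrier[OF t]])
  have comp: "game_x G s \<omega> i (Suc t) = va i + vg i + Hb i + vc i + wdist G i t \<omega>" if i: "i < Suc N" for i
  proof (cases "i = 0")
    case True
    have "Am G 0 t *\<^sub>v ?x 0 + vec_sum (dim_x G 0) (\<lambda>j. B1 G j t *\<^sub>v game_u G s \<omega> j t + B2 G j t *\<^sub>v ?x j) (DM G)
        = va 0 + vg 0 + Hb 0"
      unfolding va_def vg_def Hb_def Ab_def Gb_def if_P[OF refl]
      by (rule aggregate_feedback[OF t environment_carrier(2)[OF t] _ _ x_carrier forecast_carrier game_u_reply])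
        (use game_matrix_carrier[OF t] in auto)
    moreover have "va 0 + vg 0 + Hb 0 + vc 0 = va 0 + vg 0 + Hb 0"
    proof -
      have "vc 0 = 0\<^sub>v (dim_x G 0)" unfolding vc_def Cb_def using y by (intro eq_vecI) auto
      moreover have "va 0 + vg 0 + Hb 0 \<in> carrier_vec (dim_x G 0)" using Hbc[of 0] vac vgc by simp
      ultimately show ?thesis by simp
    qed
    ultimately show ?thesis unfolding True by (simp add: game_x.simps)
  next
    case False
    then have i': "i \<in> DM G" "i \<le> N" using i by (auto simp: DM_def)
    note c = game_matrix_carrier[OF t i'(1)] and x = x_carrier[OF i'(2)]
    have va_i: "va i = (Am G i t + Bm G i t * F_mat G i t) *\<^sub>v ?x i"
    proof (rule eq_vecI)
      fix r assume "r < dim_vec ((Am G i t + Bm G i t * F_mat G i t) *\<^sub>v ?x i)"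
      then have r: "r < dim_x G i" using c by simp
      have "(\<Sum>j<Suc N. (Ab i j *\<^sub>v ?x j) $ r) = (\<Sum>j<Suc N. if j = i then ((Am G i t + Bm G i t * F_mat G i t) *\<^sub>v ?x i) $ r else 0)"
      proof (rule sum.cong[OF refl])
        fix j assume "j \<in> {..<Suc N}"
        then have xj: "?x j \<in> carrier_vec (dim_x G j)" using x_carrier by simp
        show "(Ab i j *\<^sub>v ?x j) $ r = (if j = i then ((Am G i t + Bm G i t * F_mat G i t) *\<^sub>v ?x i) $ r else 0)"
        proof (cases "j = i")
          case False
          then have "Ab i j = 0\<^sub>m (dim_x G i) (dim_x G j)" using \<open>i \<noteq> 0\<close> by (simp add: Ab_def)
          then show ?thesis using False r xj by simp
        qed (use \<open>i \<noteq> 0\<close> in \<open>simp add: Ab_def\<close>)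
      qed
      then show "va i $ r = ((Am G i t + Bm G i t * F_mat G i t) *\<^sub>v ?x i) $ r"
        unfolding va_def using r i by (simp del: index_mult_mat_vec sum.lessThan_Suc)
    qed (use c in \<open>simp add: va_def\<close>)
    have rc: "reply i t (observed t \<omega>) \<in> carrier_vec (dim_u G i)"
      unfolding reply_eq[OF i'(1)] using H_vec_dim[OF i'(1) t] by simp
    have Fx: "F_mat G i t *\<^sub>v ?x i \<in> carrier_vec (dim_u G i)" by (rule mult_mat_vec_carrier[OF c(8) x])
    have mr: "Bm G i t *\<^sub>v reply i t (observed t \<omega>)
        = vec_sum (dim_x G i) (\<lambda>n. (Bm G i t * G_mat G i t n) *\<^sub>v ?f n) {t..<T} + Bm G i t *\<^sub>v H_vec G i t"
      by (rule mult_reply[OF i'(1) t c(5)]) (rule forecast_carrier)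
    have u: "Bm G i t *\<^sub>v game_u G s \<omega> i t = (Bm G i t * F_mat G i t) *\<^sub>v ?x i + (vg i + Hb i)"
      unfolding game_u_reply[OF i'(1)] mult_add_distrib_mat_vec[OF c(5) Fx rc] mr assoc_mult_mat_vec[OF c(5) c(8) x]
      using False by (simp add: vg_def Hb_def Gb_def)
    have AB: "(Am G i t + Bm G i t * F_mat G i t) *\<^sub>v ?x i = Am G i t *\<^sub>v ?x i + (Bm G i t * F_mat G i t) *\<^sub>v ?x i"
      by (rule add_mult_distrib_mat_vec[OF c(7) mult_carrier_mat[OF c(5) c(8)] x])
    have "Am G i t *\<^sub>v ?x i + Bm G i t *\<^sub>v game_u G s \<omega> i t = va i + vg i + Hb i"
      unfolding u va_i AB
      using mult_mat_vec_carrier[OF c(7) x] mult_mat_vec_carrier[OF mult_carrier_mat[OF c(5) c(8)] x] vgc[of i] Hbc[OF i]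
      by (intro four_term_assoc) auto
    then show ?thesis
      using False by (simp add: game_x.simps vc_def Cb_def)
  qed
  have "joint_state (Suc t) \<omega> = stack_vec (Suc N) (\<lambda>i. va i + vg i + Hb i + vc i + wdist G i t \<omega>)"
    by (rule stack_vec_cong) (rule comp)
  also have "\<dots> = stack_vec (Suc N) va + stack_vec (Suc N) vg + stack_vec (Suc N) Hb + stack_vec (Suc N) vc + W_dist G t \<omega>"
    unfolding W_dist_def
    by (simp add: stack_vec_add[where d = "dim_x G"] vac vgc Hbc vcc wc del: stack_vec.simps)
  finally show ?thesis unfolding 1 2 3 4 .
qed

end

end

context candidate_equilibrium
begin

text \<open>The two recursions have the same coefficients, and the estimator applied to equal observations
  gives the conditional expectation almost surely; so agreement propagates in time. Measurability of the
  game variables is needed for their law to be a probability measure at all.\<close>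

lemma game_matches_reference:
  "t \<le> T \<Longrightarrow> (joint_state t \<in> \<Omega> G \<rightarrow>\<^sub>M borel_vec nX \<and> (\<forall>k<t. (\<lambda>\<omega>. game_y G s \<omega> k) \<in> \<Omega> G \<rightarrow>\<^sub>M borel_vec ny)) \<and>
     (AE \<omega> in \<Omega> G. joint_state t \<omega> = Xbar t \<omega> \<and> (\<forall>k<t. game_y G s \<omega> k = ybar k \<omega>))"
proof (induction t)
  case 0
  have "joint_state 0 \<omega> = Xbar 0 \<omega>" for \<omega>
    by (simp add: game_x.simps bar_X.simps X_init_def del: stack_vec.simps)
  moreover from this have "joint_state 0 = Xbar 0" by (rule ext)
  ultimately show ?case using L2_vec_measurable[OF bar_X_L2[of 0]] by (simp del: stack_vec.simps)
next
  case (Suc t)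
  then have t: "t < T" "t \<le> T" by auto
  have X: "joint_state t \<in> \<Omega> G \<rightarrow>\<^sub>M borel_vec nX"
    and Y: "\<And>k. k < t \<Longrightarrow> (\<lambda>\<omega>. game_y G s \<omega> k) \<in> \<Omega> G \<rightarrow>\<^sub>M borel_vec ny"
    and ae: "AE \<omega> in \<Omega> G. joint_state t \<omega> = Xbar t \<omega> \<and> (\<forall>k<t. game_y G s \<omega> k = ybar k \<omega>)"
    using Suc.IH[OF t(2)] by auto
  have obs: "observed t \<in> \<Omega> G \<rightarrow>\<^sub>M Y_seqs G t"
    unfolding Y_seqs_def by (intro measurable_restrict Y) auto
  have f: "(\<lambda>\<omega>. forecast t n (observed t \<omega>)) \<in> \<Omega> G \<rightarrow>\<^sub>M borel_vec ny" if "t \<le> n" "n < T" for n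
    by (rule measurable_compose[OF obs forecast_measurable[OF that]])
  have sum: "(\<lambda>\<omega>. vec_sum m (\<lambda>n. P n *\<^sub>v forecast t n (observed t \<omega>)) {t..<T}) \<in> \<Omega> G \<rightarrow>\<^sub>M borel_vec m"
    if "\<And>n. t \<le> n \<Longrightarrow> n < T \<Longrightarrow> P n \<in> carrier_mat m ny" for P m
    using borel_vec_mult_mat[OF that f] by (auto intro!: borel_vec_vec_sum)
  have y: "(\<lambda>\<omega>. game_y G s \<omega> t) \<in> \<Omega> G \<rightarrow>\<^sub>M borel_vec ny"
  proof (subst measurable_cong[OF game_y_recursion[OF _ t(1)]])
    show "(\<lambda>\<omega>. D_agg G t *\<^sub>v joint_state t \<omega>
        + vec_sum ny (\<lambda>n. Gp_agg G t n *\<^sub>v forecast t n (observed t \<omega>)) {t..<T} + Hp_agg G t + xi G t \<omega>) \<in> \<Omega> G \<rightarrow>\<^sub>M borel_vec ny"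
      by (rule borel_vec_add[OF borel_vec_add[OF borel_vec_add[OF borel_vec_mult_mat[OF D_agg_carrier[OF t(1)] X]
            sum[OF Gp_agg_carrier]] borel_vec_const[OF Hp_agg_carrier]] L2_vec_measurable[OF xi_L2[OF t(1)]]])
  qed
  have X': "joint_state (Suc t) \<in> \<Omega> G \<rightarrow>\<^sub>M borel_vec nX"
  proof (subst measurable_cong[OF joint_state_recursion[OF _ t(1)]])
    show "(\<lambda>\<omega>. A_agg G t *\<^sub>v joint_state t \<omega>
        + vec_sum nX (\<lambda>n. GX_agg G t n *\<^sub>v forecast t n (observed t \<omega>)) {t..<T}
        + HX_agg G t + C_agg G t *\<^sub>v game_y G s \<omega> t + W_dist G t \<omega>) \<in> \<Omega> G \<rightarrow>\<^sub>M borel_vec nX"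
      by (rule borel_vec_add[OF borel_vec_add[OF borel_vec_add[OF borel_vec_add[OF borel_vec_mult_mat[OF A_agg_carrier[OF t(1)] X]
            sum[OF GX_agg_carrier]] borel_vec_const[OF HX_agg_carrier[OF t(1)]]]
            borel_vec_mult_mat[OF C_agg_carrier[OF t(1)] y]] L2_vec_measurable[OF W_L2[OF t(1)]]])
  qed
  have "AE \<omega> in \<Omega> G. joint_state (Suc t) \<omega> = Xbar (Suc t) \<omega> \<and> (\<forall>k<Suc t. game_y G s \<omega> k = ybar k \<omega>)"
    using ae est_AE[OF t(1)] AE_space[of "\<Omega> G"]
  proof eventually_elim
    case (elim \<omega>)
    have X_eq: "joint_state t \<omega> = Xbar t \<omega>" and y_eq: "\<And>k. k < t \<Longrightarrow> game_y G s \<omega> k = ybar k \<omega>"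
      and hat: "est t (observations t \<omega>) = Xhat t \<omega>" and \<omega>: "\<omega> \<in> space (\<Omega> G)"
      using elim by auto
    have "observed t \<omega> = observations t \<omega>" using y_eq by (intro restrict_ext) auto
    then have fc: "forecast t n (observed t \<omega>) = predicted n t \<omega>" for n
      using hat by (simp add: forecast_def)
    have y_t: "game_y G s \<omega> t = ybar t \<omega>"
      unfolding game_y_recursion[OF \<omega> t(1)] fc X_eq by (simp add: bar_y.simps)
    have "joint_state (Suc t) \<omega> = Xbar (Suc t) \<omega>"
      unfolding joint_state_recursion[OF \<omega> t(1)] fc X_eq y_t by (simp add: bar_X.simps)
    with y_eq y_t show ?case by (auto simp: less_Suc_eq simp del: stack_vec.simps)
  qed
  with X' Y y show ?case by (auto simp: less_Suc_eq simp del: stack_vec.simps)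
qed

lemma game_y_measurable: "t < T \<Longrightarrow> (\<lambda>\<omega>. game_y G s \<omega> t) \<in> \<Omega> G \<rightarrow>\<^sub>M borel_vec ny"
  using game_matches_reference[of T] by blast

lemma game_y_AE: "AE \<omega> in \<Omega> G. \<forall>k<T. game_y G s \<omega> k = ybar k \<omega>"
  using game_matches_reference[of T] by (auto elim!: eventually_mono)

abbreviation "env_path \<omega> \<equiv> \<lambda>t\<in>{..<T}. game_y G s \<omega> t"
abbreviation "belief \<equiv> env_law G s"

lemma env_path_measurable: "env_path \<in> \<Omega> G \<rightarrow>\<^sub>M Y_seqs G T"
  unfolding Y_seqs_def by (intro measurable_restrict game_y_measurable) auto

lemma restrict_env_path: "t \<le> T \<Longrightarrow> restrict (env_path \<omega>) {..<t} = observed t \<omega>"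
  by (auto simp: restrict_def fun_eq_iff)

lemma belief_eq: "belief = distr (\<Omega> G) (Y_seqs G T) env_path"
  by (simp add: env_law_def)

lemma belief_in_beliefs: "belief \<in> beliefs G"
  unfolding beliefs_def belief_eq using Om.prob_space_distr[OF env_path_measurable] by simp

lemma restriction_measurable: "t \<le> T \<Longrightarrow> (\<lambda>z. restrict z {..<t}) \<in> Y_seqs G T \<rightarrow>\<^sub>M Y_seqs G t"
  unfolding Y_seqs_def by (rule measurable_restrict_subset) auto

lemma coordinate_measurable: "k < T \<Longrightarrow> (\<lambda>z. z k) \<in> Y_seqs G T \<rightarrow>\<^sub>M borel_vec ny"
  unfolding Y_seqs_def by (rule measurable_component_singleton) simp

lemma belief_L2: "k < T \<Longrightarrow> L2_vec belief ny (\<lambda>z. z k)"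
  unfolding belief_eq
proof (rule L2_vec_distrI[OF env_path_measurable coordinate_measurable])
  assume k: "k < T"
  have "AE \<omega> in \<Omega> G. ybar k \<omega> = env_path \<omega> k"
    using game_y_AE by eventually_elim (use k in auto)
  then show "L2_vec (\<Omega> G) ny (\<lambda>\<omega>. env_path \<omega> k)"
    by (rule L2_vec_cong_AE[OF _ _ bar_y_L2[OF k]]) (use game_y_measurable[OF k] k in simp)
qed

lemma forecast_AE:
  assumes t: "t < T"
  shows "AE \<omega> in \<Omega> G. observed t \<omega> = observations t \<omega> \<and>
    (\<forall>k. forecast t k (observed t \<omega>) = predicted k t \<omega>)"
  using game_y_AE est_AE[OF t]
proof eventually_elim
  case (elim \<omega>)
  then have "observed t \<omega> = observations t \<omega>" using t by (intro restrict_ext) auto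
  with elim show ?case by (simp add: forecast_def)
qed

lemma restricted_forecast_measurable:
  "t \<le> k \<Longrightarrow> k < T \<Longrightarrow> (\<lambda>z. forecast t k (restrict z {..<t})) \<in> Y_seqs G T \<rightarrow>\<^sub>M borel_vec ny"
  by (rule measurable_compose[OF restriction_measurable forecast_measurable]) auto

lemma forecast_L2:
  assumes t: "t \<le> k" "k < T"
  shows "L2_vec belief ny (\<lambda>z. forecast t k (restrict z {..<t}))"
  unfolding belief_eq
proof (rule L2_vec_distrI[OF env_path_measurable restricted_forecast_measurable[OF t]])
  have tT: "t < T" using t by simp
  have "AE \<omega> in \<Omega> G. predicted k t \<omega> = forecast t k (restrict (env_path \<omega>) {..<t})"
    using forecast_AE[OF tT]
  proof eventually_elim
    case (elim \<omega>)
    then have "forecast t k (observed t \<omega>) = predicted k t \<omega>" by blast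
    then show ?case using restrict_env_path[of t \<omega>] tT by simp
  qed
  then show "L2_vec (\<Omega> G) ny (\<lambda>\<omega>. forecast t k (restrict (env_path \<omega>) {..<t}))"
  proof (rule L2_vec_cong_AE)
    show "(\<lambda>\<omega>. forecast t k (restrict (env_path \<omega>) {..<t})) \<in> \<Omega> G \<rightarrow>\<^sub>M borel_vec ny"
      by (rule measurable_compose[OF env_path_measurable restricted_forecast_measurable[OF t]])
    show "L2_vec (\<Omega> G) ny (predicted k t)"
      using bar_hat_L2[of t] tT
      by (intro L2_vec_add Om.L2_vec_mult_mat[OF coeff_carrier(1)[OF t]] Om.L2_vec_const coeff_carrier(2)[OF t]) auto
  qed
qed

text \<open>Orthogonality of the forecast error is a statement about the law of the environment variables, and
  this law is unchanged when the game is replaced by the reference recursion.\<close>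

lemma forecast_orthogonal:
  assumes t: "t \<le> k" "k < T" and g: "g \<in> borel_measurable (Y_seqs G t)" "\<And>y. \<bar>g y\<bar> \<le> B"
  shows "weighted_mean belief (\<lambda>z. g (restrict z {..<t})) ny (\<lambda>z. forecast t k (restrict z {..<t}) - z k) = 0\<^sub>v ny"
proof (rule eq_vecI)
  fix r assume "r < dim_vec (0\<^sub>v ny :: real vec)"
  then have r: "r < ny" by simp
  have tT: "t < T" using t by simp
  have gm: "(\<lambda>z. g (restrict z {..<t})) \<in> borel_measurable (Y_seqs G T)"
    by (rule measurable_compose[OF restriction_measurable g(1)]) (use tT in simp)
  have em: "(\<lambda>z. (forecast t k (restrict z {..<t}) - z k) $ r) \<in> borel_measurable (Y_seqs G T)"
    by (rule borel_vec_index[OF borel_vec_minus[OF restricted_forecast_measurable[OF t] coordinate_measurable[OF t(2)]] r])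
  let ?e = "\<lambda>\<omega>. (predicted k t \<omega> - ybar k \<omega>) $ r"
  have e_bar: "?e \<in> borel_measurable (\<Omega> G)"
    by (rule borel_vec_index[OF borel_vec_minus[OF borel_vec_add[OF borel_vec_mult_mat[OF coeff_carrier(1)[OF t]
            L2_vec_measurable[OF bar_hat_L2]] borel_vec_const[OF coeff_carrier(2)[OF t]]] L2_vec_measurable[OF bar_y_L2[OF t(2)]]] r])
      (use tT in simp)
  have obs: "observations t \<in> \<Omega> G \<rightarrow>\<^sub>M Y_seqs G t"
    unfolding Y_seqs_def using tT by (intro measurable_restrict L2_vec_measurable[OF bar_y_L2]) auto
  have "(\<integral>z. g (restrict z {..<t}) * (forecast t k (restrict z {..<t}) - z k) $ r \<partial>belief)
      = (\<integral>\<omega>. g (restrict (env_path \<omega>) {..<t}) * (forecast t k (restrict (env_path \<omega>) {..<t}) - env_path \<omega> k) $ r \<partial>\<Omega> G)"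
    unfolding belief_eq by (rule integral_distr[OF env_path_measurable borel_measurable_times[OF gm em]])
  also have "\<dots> = (\<integral>\<omega>. g (observations t \<omega>) * ?e \<omega> \<partial>\<Omega> G)"
  proof (rule integral_cong_AE)
    show "(\<lambda>\<omega>. g (restrict (env_path \<omega>) {..<t}) * (forecast t k (restrict (env_path \<omega>) {..<t}) - env_path \<omega> k) $ r) \<in> borel_measurable (\<Omega> G)"
      by (rule measurable_compose[OF env_path_measurable borel_measurable_times[OF gm em]])
    show "(\<lambda>\<omega>. g (observations t \<omega>) * ?e \<omega>) \<in> borel_measurable (\<Omega> G)"
      by (intro borel_measurable_times e_bar measurable_compose[OF obs g(1)])
    show "AE \<omega> in \<Omega> G. g (restrict (env_path \<omega>) {..<t}) * (forecast t k (restrict (env_path \<omega>) {..<t}) - env_path \<omega> k) $ r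
        = g (observations t \<omega>) * ?e \<omega>"
      using forecast_AE[OF tT] game_y_AE
    proof eventually_elim
      case (elim \<omega>)
      have "restrict (env_path \<omega>) {..<t} = observations t \<omega>" using elim restrict_env_path[of t \<omega>] tT by simp
      moreover have "forecast t k (observations t \<omega>) = predicted k t \<omega>" using elim by metis
      moreover have "env_path \<omega> k = ybar k \<omega>" using elim t by simp
      ultimately show ?case by simp
    qed
  qed
  also have "\<dots> = weighted_mean (\<Omega> G) (\<lambda>\<omega>. g (observations t \<omega>)) ny
      (\<lambda>\<omega>. predicted k t \<omega> - ybar k \<omega>) $ r"
    using r by simp
  also have "\<dots> = 0" using prediction_error_orthogonal[OF t g] r by simp
  finally show "weighted_mean belief (\<lambda>z. g (restrict z {..<t})) ny (\<lambda>z. forecast t k (restrict z {..<t}) - z k) $ r = 0\<^sub>v ny $ r"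
    using r by simp
qed simp

end

section \<open>The equilibrium\<close>

lemma (in candidate_equilibrium) candidate_is_equilibrium: "SEBEU G s"
proof -
  have optimal: "ext_expectation belief (subj_cost G i (s i)) \<le> ext_expectation belief (subj_cost G i s')"
    if i: "i \<in> DM G" and s': "s' \<in> pure_strategies G i" for i s'
  proof -
    have i_le: "i \<le> N" using i by (simp add: DM_def)
    have exo: "exogenous_belief G i belief"
      by (intro exogenous_belief.intro[OF decision_makerI[OF i]] exogenous_belief_axioms.intro
          belief_in_beliefs belief_L2 init_L2[OF i_le] wdist_L2[OF i_le])
    show ?thesis
    proof (rule exogenous_belief.optimal_response[OF exo, where \<F> = past_algebra and pred = forecast])
      show "subalgebra (\<Omega> G) (past_algebra t)" if "t < T" for t
        by (rule past_subalgebra) (use that in simp)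
      show "init G i \<in> past_algebra t \<rightarrow>\<^sub>M borel_vec (dim_x G i)" if "t < T" for t
        by (rule init_in_algebra[OF past_subset _ i_le]) (use that in \<open>auto simp: past_def\<close>)
      show "wdist G i k \<in> past_algebra t \<rightarrow>\<^sub>M borel_vec (dim_x G i)" if "k < t" "t < T" for t k
        by (rule wdist_in_algebra[OF past_subset _ _ i_le]) (use that in \<open>auto simp: past_def\<close>)
      show "weighted_mean (\<Omega> G) g (dim_x G i)
          (\<lambda>\<omega>. vec_expectation (\<Omega> G) (dim_x G i) (wdist G i k) - wdist G i k \<omega>) = 0\<^sub>v (dim_x G i)"
        if "t \<le> k" "k < T" "g \<in> borel_measurable (past_algebra t)" "\<And>\<omega>. \<bar>g \<omega>\<bar> \<le> B" for t k g B
        by (rule wdist_innovation[OF i_le that(2) past_subset _ that(3,4)]) (use that in \<open>auto simp: past_def\<close>)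
      show "s i t ((x, u), y) = F_mat G i t *\<^sub>v x t + reply i t y"
        if "t < T" "y \<in> space (Y_seqs G t)" for t x u y
        using measurable_space[OF est_measurable[OF that(1)] that(2)]
        by (intro eq_strategy_reply[OF i that(1)]) simp
    qed (fact forecast_measurable forecast_L2 forecast_orthogonal eq_strategy_pure[OF i] s')+
  qed
  show ?thesis
    unfolding SEBEU_def
    by (intro conjI ballI exI[of _ "\<lambda>_. belief"]) (auto intro: eq_strategy_pure belief_in_beliefs optimal)
qed

theorem theorem3p1p2:
  fixes G :: "'w lq_game"
  assumes "valid_game G"
    and "independent_primitives G"
    and "unique_predictions G"
  shows "(\<exists>a b est. prediction_coeffs G a b \<and> state_estimator G a b est) \<and>
    (\<forall>a b est. prediction_coeffs G a b \<longrightarrow> state_estimator G a b est \<longrightarrow>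
       SEBEU G (eq_strategy G a b est))"
proof -
  have noisy: "noisy_game G" using assms(1,2) by (rule noisy_game.intro)
  have reference: "reference_recursion G a b" if "prediction_coeffs G a b" for a b
    by (rule reference_recursion.intro[OF noisy reference_recursion_axioms.intro[OF that assms(3)]])
  obtain a b where "prediction_coeffs G a b"
    using noisy_game.prediction_coeffs_exist[OF noisy assms(3)] by blast
  moreover from this obtain est where "state_estimator G a b est"
    using reference_recursion.estimator_exists[OF reference] by blast
  ultimately have "\<exists>a b est. prediction_coeffs G a b \<and> state_estimator G a b est" by blast
  moreover have "SEBEU G (eq_strategy G a b est)"
    if "prediction_coeffs G a b" "state_estimator G a b est" for a b est
    by (rule candidate_equilibrium.candidate_is_equilibrium)
      (rule candidate_equilibrium.intro[OF reference[OF that(1)] candidate_equilibrium_axioms.intro[OF that(2)]])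
  ultimately show ?thesis by blast
qed

end
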